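(* For any assignment of real numbers to the variables $u_\alpha$ ($\alpha$ a Lyndon composition), the linear operator $\Phi$ on $\mathcal{Q}$ defined by $$\Phi(M_\beta)=\sum_{\alpha\in\operatorname{Comp}(n),\,\alpha\le\beta}A_n(\beta,\alpha)\,M_\alpha\qquad\text{for all }n\ge0,\ \beta\in\operatorname{Comp}(n)$$ is an endomorphism of $\mathcal{Q}$ (an element of $\mathrm{End}(\mathcal{Q})$). Moreover, every element of $\mathrm{End}(\mathcal{Q})$ has this form for some such assignment.
   Context: Work over $\mathbb{R}$. Compositions $\alpha=(a_1,\dots,a_k)$ of $n$, $\operatorname{Comp}(n)$, $(n)$; $S_\alpha=\{a_1,\dots,a_1+\dots+a_{k-1}\}$; $\alpha\le\beta$ iff $S_\alpha\subseteq S_\beta$, i.e.\ iff $\beta=\beta_1\cdots\beta_k$ (concatenation) with $a_i=|\beta_i|$ (sum of parts). $M_\alpha=\sum_{i_1<\dots<i_k}x_{i_1}^{a_1}\cdots x_{i_k}^{a_k}$, $M_{()}=1$; $\mathcal{Q}$ the graded Hopf algebra of quasisymmetric functions with coproduct $\Delta(M_\alpha)=\sum_{\alpha=\beta\cdot\gamma}M_\beta\otimes M_\gamma$; $\mathrm{End}(\mathcal{Q})$ = graded Hopf algebra endomorphisms. A composition is Lyndon if, as a word over the positive integers, it is lexicographically strictly smaller than all its nontrivial cyclic rearrangements; $\mathcal{Q}$ is the free polynomial algebra on $\{M_\alpha:\alpha\text{ Lyndon}\}$, so each $M_\beta$ has a unique expression (Lyndon expansion) as a polynomial in these. Let $u_\alpha$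 ($\alpha$ Lyndon) be commuting variables and, for $\beta\in\operatorname{Comp}(n)$, let $A_n(\beta,(n))$ be the polynomial obtained by substituting $u_\alpha$ for $M_\alpha$ in the Lyndon expansion of $M_\beta$. For $\alpha=(a_1,\dots,a_k),\beta\in\operatorname{Comp}(n)$: $A_n(\beta,\alpha)=0$ if $\alpha\not\le\beta$, and otherwise $A_n(\beta,\alpha)=A_{a_1}(\beta_1,(a_1))\cdots A_{a_k}(\beta_k,(a_k))$ where $\beta=\beta_1\cdots\beta_k$ with $|\beta_i|=a_i$; $A_0=(1)$. *)

theory Defs
  imports "HOL-Analysis.Analysis" "HOL-Analysis.Finite_Function_Topology"
begin

section \<open>Tensor products of real vector spaces\<close>

definition tensor_relations :: "(('a::real_vector \<times> 'b::real_vector) \<Rightarrow>\<^sub>0 real) set" where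
  "tensor_relations =
     {Poly_Mapping.single (x + x', y) 1 - Poly_Mapping.single (x, y) 1 - Poly_Mapping.single (x', y) 1 | x x' y. True} \<union>
     {Poly_Mapping.single (x, y + y') 1 - Poly_Mapping.single (x, y) 1 - Poly_Mapping.single (x, y') 1 | x y y'. True} \<union>
     {Poly_Mapping.single (r *\<^sub>R x, y) 1 - r *\<^sub>R Poly_Mapping.single (x, y) 1 | r x y. True} \<union>
     {Poly_Mapping.single (x, r *\<^sub>R y) 1 - r *\<^sub>R Poly_Mapping.single (x, y) 1 | r x y. True}"

definition tensor_rel :: "(('a::real_vector \<times> 'b::real_vector) \<Rightarrow>\<^sub>0 real) \<Rightarrow> (('a \<times> 'b) \<Rightarrow>\<^sub>0 real) \<Rightarrow> bool" where
  "tensor_rel p q \<longleftrightarrow> p - q \<in> span tensor_relations"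

lemma equivp_tensor_rel: "equivp tensor_rel"
proof (rule equivpI)
  show "reflp tensor_rel"
    by (auto simp: reflp_def tensor_rel_def span_zero)
  show "symp tensor_rel"
    unfolding symp_def tensor_rel_def by (metis minus_diff_eq span_neg)
  show "transp tensor_rel"
    unfolding transp_def tensor_rel_def
    by (metis (no_types, opaque_lifting) add_diff_cancel diff_add_cancel span_add add.commute add_diff_eq)
qed

quotient_type (overloaded) ('a, 'b) tensor =
  "(('a::real_vector \<times> 'b::real_vector) \<Rightarrow>\<^sub>0 real)" / tensor_rel
  by (rule equivp_tensor_rel)

instantiation tensor :: (real_vector, real_vector) real_vector
begin

lift_definition zero_tensor :: "('a, 'b) tensor" is 0 .

lift_definition plus_tensor :: "('a, 'b) tensor \<Rightarrow> ('a, 'b) tensor \<Rightarrow> ('a, 'b) tensor" is "(+)"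
  unfolding tensor_rel_def by (metis add_diff_add span_add)

lift_definition uminus_tensor :: "('a, 'b) tensor \<Rightarrow> ('a, 'b) tensor" is uminus
  unfolding tensor_rel_def by (metis minus_diff_minus span_neg)

lift_definition minus_tensor :: "('a, 'b) tensor \<Rightarrow> ('a, 'b) tensor \<Rightarrow> ('a, 'b) tensor" is "(-)"
proof -
  fix p p' q q' :: "('a \<times> 'b) \<Rightarrow>\<^sub>0 real"
  assume "tensor_rel p p'" "tensor_rel q q'"
  then have "(p - p') - (q - q') \<in> span tensor_relations"
    unfolding tensor_rel_def by (rule span_diff)
  moreover have "(p - p') - (q - q') = (p - q) - (p' - q')" by simp
  ultimately show "tensor_rel (p - q) (p' - q')" unfolding tensor_rel_def by metis
qed

lift_definition scaleR_tensor :: "real \<Rightarrow> ('a, 'b) tensor \<Rightarrow> ('a, 'b) tensor" is "scaleR"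
  unfolding tensor_rel_def by (metis scaleR_diff_right span_scale)

instance
  by standard
    (transfer; simp add: algebra_simps tensor_rel_def span_zero scaleR_add_left scaleR_add_right)+

end

lift_definition pure_tensor :: "'a::real_vector \<Rightarrow> 'b::real_vector \<Rightarrow> ('a, 'b) tensor"
    (infixl "\<otimes>\<^sub>R" 75)
  is "\<lambda>x y. Poly_Mapping.single (x, y) 1" .

definition formal_sum :: "('x \<Rightarrow> 'v::real_vector) \<Rightarrow> ('x \<Rightarrow>\<^sub>0 real) \<Rightarrow> 'v" where
  "formal_sum h p = (\<Sum>k\<in>Poly_Mapping.keys p. Poly_Mapping.lookup p k *\<^sub>R h k)"

text \<open>The linear map induced by a bilinear map \<open>h\<close>; the value on a tensor is computed from an
  arbitrary representative, which is harmless only for bilinear \<open>h\<close>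
  (see \<open>tensor_lift_pure\<close> and \<open>linear_tensor_lift\<close>).\<close>

definition tensor_lift ::
  "('a::real_vector \<Rightarrow> 'b::real_vector \<Rightarrow> 'v::real_vector) \<Rightarrow> ('a, 'b) tensor \<Rightarrow> 'v" where
  "tensor_lift h t = formal_sum (\<lambda>(x, y). h x y) (rep_tensor t)"

definition tensor_map ::
  "('a::real_vector \<Rightarrow> 'c::real_vector) \<Rightarrow> ('b::real_vector \<Rightarrow> 'd::real_vector)
    \<Rightarrow> ('a, 'b) tensor \<Rightarrow> ('c, 'd) tensor" where
  "tensor_map f g = tensor_lift (\<lambda>x y. f x \<otimes>\<^sub>R g y)"

lemma lookup_scaleR: "Poly_Mapping.lookup (r *\<^sub>R p) k = r *\<^sub>R Poly_Mapping.lookup p k"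
  for p :: "'x \<Rightarrow>\<^sub>0 real"
proof -
  have "finite {i. r * Poly_Mapping.lookup p i \<noteq> 0}"
    by (rule finite_subset[OF _ finite_lookup[of p]]) auto
  then show ?thesis by (simp add: scaleR_poly_mapping_def)
qed

lemma formal_sum_superset:
  assumes "finite K" "Poly_Mapping.keys p \<subseteq> K"
  shows "formal_sum h p = (\<Sum>k\<in>K. Poly_Mapping.lookup p k *\<^sub>R h k)"
  unfolding formal_sum_def using assms
  by (intro sum.mono_neutral_left) (auto simp: in_keys_iff)

lemma linear_formal_sum: "linear (formal_sum h)"
proof (rule linearI)
  fix p q :: "'a \<Rightarrow>\<^sub>0 real" and r :: real
  let ?K = "Poly_Mapping.keys p \<union> Poly_Mapping.keys q"
  have "formal_sum h (p + q) = (\<Sum>k\<in>?K. Poly_Mapping.lookup (p + q) k *\<^sub>R h k)"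
    by (rule formal_sum_superset) (auto dest: subsetD[OF keys_add])
  also have "\<dots> = (\<Sum>k\<in>?K. Poly_Mapping.lookup p k *\<^sub>R h k) + (\<Sum>k\<in>?K. Poly_Mapping.lookup q k *\<^sub>R h k)"
    by (simp add: lookup_add scaleR_add_left sum.distrib)
  also have "\<dots> = formal_sum h p + formal_sum h q"
    by (subst (1 2) formal_sum_superset[of ?K]) auto
  finally show "formal_sum h (p + q) = formal_sum h p + formal_sum h q" .
  have "formal_sum h (r *\<^sub>R p) = (\<Sum>k\<in>Poly_Mapping.keys p. Poly_Mapping.lookup (r *\<^sub>R p) k *\<^sub>R h k)"
    by (rule formal_sum_superset) (auto simp: in_keys_iff lookup_scaleR)
  then show "formal_sum h (r *\<^sub>R p) = r *\<^sub>R formal_sum h p"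
    by (simp add: lookup_scaleR formal_sum_def scaleR_sum_right)
qed

lemma formal_sum_single: "formal_sum h (Poly_Mapping.single k c) = c *\<^sub>R h k"
  by (cases "c = 0") (simp_all add: formal_sum_def)

lemma formal_sum_relations:
  assumes h: "bilinear h" and p: "p \<in> span tensor_relations"
  shows "formal_sum (\<lambda>(x, y). h x y) p = 0"
  using p
proof (rule linear_eq_0_on_span[OF linear_formal_sum, rotated])
  fix p assume "p \<in> (tensor_relations :: (('a \<times> 'b) \<Rightarrow>\<^sub>0 real) set)"
  then show "formal_sum (\<lambda>(x, y). h x y) p = 0"
    unfolding tensor_relations_def
    by (auto simp: linear_diff[OF linear_formal_sum] linear_scale[OF linear_formal_sum]
        formal_sum_single bilinear_ladd[OF h] bilinear_radd[OF h] bilinear_lmul[OF h] bilinear_rmul[OF h])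
qed

lemma formal_sum_respects:
  assumes "bilinear h" "tensor_rel p q"
  shows "formal_sum (\<lambda>(x, y). h x y) p = formal_sum (\<lambda>(x, y). h x y) q"
  using formal_sum_relations[OF assms(1), of "p - q"] assms(2)
  by (simp add: tensor_rel_def linear_diff[OF linear_formal_sum])

lemma tensor_lift_abs:
  assumes "bilinear h"
  shows "tensor_lift h (abs_tensor p) = formal_sum (\<lambda>(x, y). h x y) p"
  unfolding tensor_lift_def
  by (rule formal_sum_respects[OF assms]) (metis Quotient_tensor Quotient_rep_abs equivp_tensor_rel equivp_reflp)

lemma tensor_lift_pure: "bilinear h \<Longrightarrow> tensor_lift h (x \<otimes>\<^sub>R y) = h x y"
  by (simp add: pure_tensor.abs_eq tensor_lift_abs formal_sum_single)

lemma linear_tensor_lift: "bilinear h \<Longrightarrow> linear (tensor_lift h)"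
proof (rule linearI)
  fix s t :: "('a, 'b) tensor" and r :: real
  assume h: "bilinear h"
  obtain p q where "s = abs_tensor p" "t = abs_tensor q"
    by (metis Quotient_tensor Quotient_abs_rep)
  then show "tensor_lift h (s + t) = tensor_lift h s + tensor_lift h t"
    "tensor_lift h (r *\<^sub>R s) = r *\<^sub>R tensor_lift h s"
    by (simp_all add: plus_tensor.abs_eq scaleR_tensor.abs_eq tensor_lift_abs[OF h]
        linear_add[OF linear_formal_sum] linear_scale[OF linear_formal_sum])
qed

lemma bilinear_pure_tensor: "bilinear (\<otimes>\<^sub>R)"
proof -
  have "(x + x') \<otimes>\<^sub>R y = x \<otimes>\<^sub>R y + x' \<otimes>\<^sub>R y" for x x' :: 'a and y :: 'b
  proof transfer
    fix x x' :: 'a and y :: 'b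
    have "Poly_Mapping.single (x + x', y) (1::real) - Poly_Mapping.single (x, y) 1 - Poly_Mapping.single (x', y) 1
        \<in> tensor_relations" unfolding tensor_relations_def by blast
    then show "tensor_rel (Poly_Mapping.single (x + x', y) 1)
        (Poly_Mapping.single (x, y) 1 + Poly_Mapping.single (x', y) 1)"
      unfolding tensor_rel_def diff_diff_eq by (rule span_base)
  qed
  moreover have "x \<otimes>\<^sub>R (y + y') = x \<otimes>\<^sub>R y + x \<otimes>\<^sub>R y'" for x :: 'a and y y' :: 'b
  proof transfer
    fix x :: 'a and y y' :: 'b
    have "Poly_Mapping.single (x, y + y') (1::real) - Poly_Mapping.single (x, y) 1 - Poly_Mapping.single (x, y') 1
        \<in> tensor_relations" unfolding tensor_relations_def by blast
    then show "tensor_rel (Poly_Mapping.single (x, y + y') 1)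
        (Poly_Mapping.single (x, y) 1 + Poly_Mapping.single (x, y') 1)"
      unfolding tensor_rel_def diff_diff_eq by (rule span_base)
  qed
  moreover have "(r *\<^sub>R x) \<otimes>\<^sub>R y = r *\<^sub>R (x \<otimes>\<^sub>R y)" for r and x :: 'a and y :: 'b
    by transfer (unfold tensor_rel_def tensor_relations_def, rule span_base, blast)
  moreover have "x \<otimes>\<^sub>R (r *\<^sub>R y) = r *\<^sub>R (x \<otimes>\<^sub>R y)" for r and x :: 'a and y :: 'b
    by transfer (unfold tensor_rel_def tensor_relations_def, rule span_base, blast)
  ultimately show ?thesis
    by (auto simp: bilinear_def intro!: linearI)
qed

lemma tensor_map_pure:
  assumes "linear f" "linear g"
  shows "tensor_map f g (x \<otimes>\<^sub>R y) = f x \<otimes>\<^sub>R g y" "linear (tensor_map f g)"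
proof -
  have "bilinear (\<lambda>x y. f x \<otimes>\<^sub>R g y)"
    using bilinear_pure_tensor[where 'a='c and 'b='d] assms
    by (auto simp: bilinear_def intro!: linearI
        simp: linear_add linear_scale bilinear_ladd[OF bilinear_pure_tensor]
          bilinear_radd[OF bilinear_pure_tensor] bilinear_lmul[OF bilinear_pure_tensor]
          bilinear_rmul[OF bilinear_pure_tensor])
  then show "tensor_map f g (x \<otimes>\<^sub>R y) = f x \<otimes>\<^sub>R g y" "linear (tensor_map f g)"
    by (simp_all add: tensor_map_def tensor_lift_pure linear_tensor_lift)
qed

section \<open>Quasisymmetric functions as formal power series\<close>

type_synonym monomial = "nat \<Rightarrow>\<^sub>0 nat"

text \<open>For the monomial \<open>x\<^bsub>i\<^sub>1\<^esub>\<^bsup>a\<^sub>1\<^esup> \<cdots> x\<^bsub>i\<^sub>k\<^esub>\<^bsup>a\<^sub>k\<^esup>\<close> with \<open>i\<^sub>1 < \<dots> < i\<^sub>k\<close> and all \<open>a\<^sub>j > 0\<close>, the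
  composition \<open>(a\<^sub>1, \<dots>, a\<^sub>k)\<close>. Variables are indexed by \<open>0, 1, 2, \<dots>\<close>.\<close>

definition exps :: "monomial \<Rightarrow> nat list" where
  "exps m = map (Poly_Mapping.lookup m) (sorted_list_of_set (Poly_Mapping.keys m))"

definition mdeg :: "monomial \<Rightarrow> nat" where
  "mdeg m = sum_list (exps m)"

lemma mdeg_eq_sum: "mdeg m = (\<Sum>i\<in>Poly_Mapping.keys m. Poly_Mapping.lookup m i)"
  unfolding mdeg_def exps_def
  by (metis distinct_sorted_list_of_set finite_keys set_sorted_list_of_set sum_list_distinct_conv_sum_set)

lemma mdeg_superset:
  "finite K \<Longrightarrow> Poly_Mapping.keys m \<subseteq> K \<Longrightarrow> mdeg m = (\<Sum>i\<in>K. Poly_Mapping.lookup m i)"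
  unfolding mdeg_eq_sum by (intro sum.mono_neutral_left) (auto simp: in_keys_iff)

lemma mdeg_add: "mdeg (a + b) = mdeg a + mdeg b"
proof -
  let ?K = "Poly_Mapping.keys a \<union> Poly_Mapping.keys b"
  have "mdeg (a + b) = (\<Sum>i\<in>?K. Poly_Mapping.lookup (a + b) i)"
    by (rule mdeg_superset) (auto dest: subsetD[OF keys_add])
  also have "\<dots> = (\<Sum>i\<in>?K. Poly_Mapping.lookup a i) + (\<Sum>i\<in>?K. Poly_Mapping.lookup b i)"
    by (simp add: lookup_add sum.distrib)
  also have "\<dots> = mdeg a + mdeg b"
    by (subst (1 2) mdeg_superset[of ?K]) auto
  finally show ?thesis .
qed

lemma exps_eq_Nil_iff [simp]: "exps m = [] \<longleftrightarrow> m = 0"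
  by (simp add: exps_def)

lemma exps_zero [simp]: "exps 0 = []"
  by simp

lemma keys_add_nat: "Poly_Mapping.keys (a + b) = Poly_Mapping.keys a \<union> Poly_Mapping.keys b"
  for a b :: monomial
  by (auto simp: in_keys_iff lookup_add)

lemma finite_divisor_pairs: "finite {(a, b). a + b = (m :: monomial)}"
proof -
  let ?D = "{a. \<forall>i. Poly_Mapping.lookup a i \<le> Poly_Mapping.lookup m i}"
  have "finite {f. \<forall>i. (i \<in> Poly_Mapping.keys m \<longrightarrow> f i \<in> {..mdeg m}) \<and> (i \<notin> Poly_Mapping.keys m \<longrightarrow> f i = (0::nat))}"
    by (rule finite_set_of_finite_funs) auto
  moreover have "Poly_Mapping.lookup ` ?D \<subseteq>
      {f. \<forall>i. (i \<in> Poly_Mapping.keys m \<longrightarrow> f i \<in> {..mdeg m}) \<and> (i \<notin> Poly_Mapping.keys m \<longrightarrow> f i = (0::nat))}"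
  proof
    fix f assume "f \<in> Poly_Mapping.lookup ` ?D"
    then obtain a where f: "f = Poly_Mapping.lookup a"
      and a: "\<And>i. Poly_Mapping.lookup a i \<le> Poly_Mapping.lookup m i" by auto
    have "f i \<in> {..mdeg m}" if "i \<in> Poly_Mapping.keys m" for i
      using a[of i] member_le_sum[OF that, of "Poly_Mapping.lookup m"] f
      by (simp add: mdeg_eq_sum)
    moreover have "f i = 0" if "i \<notin> Poly_Mapping.keys m" for i
      using a[of i] that f by (simp add: in_keys_iff)
    ultimately show "f \<in> {f. \<forall>i. (i \<in> Poly_Mapping.keys m \<longrightarrow> f i \<in> {..mdeg m}) \<and> (i \<notin> Poly_Mapping.keys m \<longrightarrow> f i = (0::nat))}"
      by blast
  qed
  ultimately have "finite (Poly_Mapping.lookup ` ?D)" by (rule rev_finite_subset)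
  then have D: "finite ?D"
    by (rule finite_imageD) (auto intro!: inj_onI poly_mapping_eqI)
  have "{(a, b). a + b = m} \<subseteq> ?D \<times> ?D"
    by (auto simp: lookup_add)
  then show ?thesis using D by (meson finite_SigmaI rev_finite_subset)
qed

subsection \<open>Order-preserving relabelling of variables\<close>

definition relabel :: "(nat \<Rightarrow> nat) \<Rightarrow> nat set \<Rightarrow> monomial \<Rightarrow> monomial" where
  "relabel \<tau> K a = Abs_poly_mapping (\<lambda>j. if j \<in> K then Poly_Mapping.lookup a (\<tau> j) else 0)"

lemma lookup_relabel:
  "finite K \<Longrightarrow> Poly_Mapping.lookup (relabel \<tau> K a) j = (if j \<in> K then Poly_Mapping.lookup a (\<tau> j) else 0)"
  unfolding relabel_def by (subst lookup_Abs_poly_mapping) (auto elim: rev_finite_subset)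

lemma exps_relabel:
  assumes K: "finite K'" "bij_betw \<sigma> K K'" "strict_mono_on K \<sigma>" "\<And>i. i \<in> K \<Longrightarrow> \<tau> (\<sigma> i) = i"
    and a: "Poly_Mapping.keys a \<subseteq> K"
  shows "exps (relabel \<tau> K' a) = exps a"
proof -
  have "Poly_Mapping.keys (relabel \<tau> K' a) = \<sigma> ` Poly_Mapping.keys a"
  proof safe
    fix j assume "j \<in> Poly_Mapping.keys (relabel \<tau> K' a)"
    then have j: "j \<in> K'" "Poly_Mapping.lookup a (\<tau> j) \<noteq> 0"
      by (auto simp: in_keys_iff lookup_relabel[OF K(1)] split: if_splits)
    then obtain i where "i \<in> K" "j = \<sigma> i" using K(2) by (auto simp: bij_betw_def)
    then show "j \<in> \<sigma> ` Poly_Mapping.keys a" using j(2) K(4) by (auto simp: in_keys_iff)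
  next
    fix i assume "i \<in> Poly_Mapping.keys a"
    moreover from this a have "i \<in> K" by auto
    moreover from this have "\<sigma> i \<in> K'" using K(2) by (auto simp: bij_betw_def)
    ultimately show "\<sigma> i \<in> Poly_Mapping.keys (relabel \<tau> K' a)"
      using K(4) by (simp add: in_keys_iff lookup_relabel[OF K(1)])
  qed
  moreover have "sorted_list_of_set (\<sigma> ` Poly_Mapping.keys a) = map \<sigma> (sorted_list_of_set (Poly_Mapping.keys a))"
  proof -
    let ?l = "sorted_list_of_set (Poly_Mapping.keys a)"
    have "strict_mono_on (set ?l) \<sigma>" using K(3) a by (auto simp: monotone_on_def)
    then have "sorted_wrt (<) (map \<sigma> ?l)"
      unfolding sorted_wrt_map
      by (intro sorted_wrt_mono_rel[OF _ strict_sorted_list_of_set]) (auto simp: monotone_on_def)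
    then show ?thesis
      by (metis finite_imageI finite_keys list.set_map set_sorted_list_of_set
          sorted_list_of_set.idem_if_sorted_distinct strict_sorted_iff)
  qed
  moreover have "\<tau> (\<sigma> i) = i" "\<sigma> i \<in> K'" if "i \<in> Poly_Mapping.keys a" for i
    using that a K by (auto simp: bij_betw_def)
  ultimately show ?thesis
    unfolding exps_def by (auto simp: lookup_relabel[OF K(1)])
qed

lemma exps_eq_relabel:
  assumes e: "exps m = exps m'"
  defines "K \<equiv> Poly_Mapping.keys m" and "K' \<equiv> Poly_Mapping.keys m'"
  obtains \<sigma> \<tau> where "bij_betw \<sigma> K K'" "strict_mono_on K \<sigma>" "\<And>i. i \<in> K \<Longrightarrow> \<tau> (\<sigma> i) = i"
    "bij_betw \<tau> K' K" "strict_mono_on K' \<tau>" "\<And>i. i \<in> K' \<Longrightarrow> \<sigma> (\<tau> i) = i"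
    "relabel \<tau> K' m = m'" "relabel \<sigma> K m' = m"
proof -
  define xs where "xs = sorted_list_of_set K"
  define ys where "ys = sorted_list_of_set K'"
  have fin: "finite K" "finite K'" by (simp_all add: K_def K'_def)
  have xs: "set xs = K" "distinct xs" "sorted_wrt (<) xs"
    and ys: "set ys = K'" "distinct ys" "sorted_wrt (<) ys"
    using fin by (simp_all add: xs_def ys_def)
  have mm: "map (Poly_Mapping.lookup m) xs = map (Poly_Mapping.lookup m') ys"
    using e by (simp add: exps_def xs_def ys_def K_def K'_def)
  then have len: "length xs = length ys" by (metis length_map)
  define n where "n = length xs"
  have lk: "Poly_Mapping.lookup m (xs ! k) = Poly_Mapping.lookup m' (ys ! k)" if "k < n" for k
    using mm that len by (metis n_def nth_map)
  define p where "p = the_inv_into {..<n} ((!) xs)"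
  define q where "q = the_inv_into {..<n} ((!) ys)"
  have bx: "bij_betw ((!) xs) {..<n} K" and bY: "bij_betw ((!) ys) {..<n} K'"
    using xs ys len by (auto simp: n_def intro!: bij_betw_nth)
  have p: "p (xs ! k) = k" if "k < n" for k
    using bx that unfolding p_def bij_betw_def by (simp add: the_inv_into_f_f)
  have q: "q (ys ! k) = k" if "k < n" for k
    using bY that unfolding q_def bij_betw_def by (simp add: the_inv_into_f_f)
  have xE: "\<exists>k<n. i = xs ! k" if "i \<in> K" for i
    using that bx by (auto simp: bij_betw_def)
  have yE: "\<exists>k<n. i = ys ! k" if "i \<in> K'" for i
    using that bY by (auto simp: bij_betw_def)
  have xK: "xs ! k \<in> K" and yK: "ys ! k \<in> K'" if "k < n" for k
    using that bx bY by (auto simp: bij_betw_def)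
  define \<sigma> where "\<sigma> = (\<lambda>i. ys ! p i)"
  define \<tau> where "\<tau> = (\<lambda>i. xs ! q i)"
  have \<sigma>: "\<sigma> (xs ! k) = ys ! k" and \<tau>: "\<tau> (ys ! k) = xs ! k" if "k < n" for k
    using that p q by (auto simp: \<sigma>_def \<tau>_def)
  have xless: "xs ! k < xs ! l \<longleftrightarrow> k < l" if "k < n" "l < n" for k l
    using that xs(3) by (metis n_def not_less_iff_gr_or_eq order_less_imp_not_less sorted_wrt_nth_less)
  have yless: "ys ! k < ys ! l \<longleftrightarrow> k < l" if "k < n" "l < n" for k l
    using that ys(3) len by (metis n_def not_less_iff_gr_or_eq order_less_imp_not_less sorted_wrt_nth_less)
  have ts: "\<tau> (\<sigma> i) = i" if "i \<in> K" for i using xE[OF that] \<sigma> \<tau> by auto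
  have st: "\<sigma> (\<tau> i) = i" if "i \<in> K'" for i using yE[OF that] \<sigma> \<tau> by auto
  have sK: "\<sigma> i \<in> K'" if "i \<in> K" for i using xE[OF that] \<sigma> yK by auto
  have tK: "\<tau> i \<in> K" if "i \<in> K'" for i using yE[OF that] \<tau> xK by auto
  show ?thesis
  proof (rule that)
    show "bij_betw \<sigma> K K'" by (rule bij_betw_byWitness[of _ \<tau>]) (use ts st sK tK in auto)
    show "bij_betw \<tau> K' K" by (rule bij_betw_byWitness[of _ \<sigma>]) (use ts st sK tK in auto)
    show "strict_mono_on K \<sigma>"
      unfolding monotone_on_def using xE \<sigma> xless yless by metis
    show "strict_mono_on K' \<tau>"
      unfolding monotone_on_def using yE \<tau> xless yless by metis
    show "\<tau> (\<sigma> i) = i" if "i \<in> K" for i by (rule ts[OF that])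
    show "\<sigma> (\<tau> i) = i" if "i \<in> K'" for i by (rule st[OF that])
    show "relabel \<tau> K' m = m'"
    proof (rule poly_mapping_eqI)
      fix j show "Poly_Mapping.lookup (relabel \<tau> K' m) j = Poly_Mapping.lookup m' j"
        using yE[of j] lk \<tau> in_keys_iff[of j m'] unfolding lookup_relabel[OF fin(2)] by (auto simp: K'_def)
    qed
    show "relabel \<sigma> K m' = m"
    proof (rule poly_mapping_eqI)
      fix j show "Poly_Mapping.lookup (relabel \<sigma> K m') j = Poly_Mapping.lookup m j"
        using xE[of j] lk \<sigma> in_keys_iff[of j m] unfolding lookup_relabel[OF fin(1)] by (auto simp: K_def)
    qed
  qed
qed

subsection \<open>The algebra of quasisymmetric functions\<close>

text \<open>A power series of bounded degree is quasisymmetric if the coefficient of a monomial depends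
  only on the sequence of its nonzero exponents.\<close>

typedef qsym = "{f :: monomial \<Rightarrow> real.
    (\<forall>m m'. exps m = exps m' \<longrightarrow> f m = f m') \<and> (\<exists>d. \<forall>m. f m \<noteq> 0 \<longrightarrow> mdeg m \<le> d)}"
  morphisms qcoeff Abs_qsym
  by (rule exI[of _ "\<lambda>_. 0"]) auto

setup_lifting type_definition_qsym

definition conv :: "(monomial \<Rightarrow> real) \<Rightarrow> (monomial \<Rightarrow> real) \<Rightarrow> monomial \<Rightarrow> real" where
  "conv f g m = (\<Sum>(a, b) | a + b = m. f a * g b)"

lemma conv_quasi:
  assumes f: "\<And>m m'. exps m = exps m' \<Longrightarrow> f m = f m'" and g: "\<And>m m'. exps m = exps m' \<Longrightarrow> g m = g m'"
    and e: "exps m = exps m'"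
  shows "conv f g m = conv f g m'"
proof -
  define K K' where "K = Poly_Mapping.keys m" and "K' = Poly_Mapping.keys m'"
  have fin: "finite K" "finite K'" by (simp_all add: K_def K'_def)
  obtain \<sigma> \<tau> where s: "bij_betw \<sigma> K K'" "strict_mono_on K \<sigma>" "\<And>i. i \<in> K \<Longrightarrow> \<tau> (\<sigma> i) = i"
    and t: "bij_betw \<tau> K' K" "strict_mono_on K' \<tau>" "\<And>i. i \<in> K' \<Longrightarrow> \<sigma> (\<tau> i) = i"
    and r: "relabel \<tau> K' m = m'" "relabel \<sigma> K m' = m"
    using exps_eq_relabel[OF e] unfolding K_def K'_def by metis
  have radd: "relabel \<rho> L (a + b) = relabel \<rho> L a + relabel \<rho> L b" if "finite L" for \<rho> L a b
    by (rule poly_mapping_eqI) (simp add: lookup_add lookup_relabel[OF that])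
  have bck: "relabel \<sigma> K (relabel \<tau> K' a) = a" if "Poly_Mapping.keys a \<subseteq> K" for a
  proof (rule poly_mapping_eqI)
    fix j show "Poly_Mapping.lookup (relabel \<sigma> K (relabel \<tau> K' a)) j = Poly_Mapping.lookup a j"
      using that s by (auto simp: lookup_relabel fin bij_betw_def in_keys_iff)
  qed
  have forth: "relabel \<tau> K' (relabel \<sigma> K a) = a" if "Poly_Mapping.keys a \<subseteq> K'" for a
  proof (rule poly_mapping_eqI)
    fix j show "Poly_Mapping.lookup (relabel \<tau> K' (relabel \<sigma> K a)) j = Poly_Mapping.lookup a j"
      using that t by (auto simp: lookup_relabel fin bij_betw_def in_keys_iff)
  qed
  have keysK: "Poly_Mapping.keys a \<subseteq> K" "Poly_Mapping.keys b \<subseteq> K" if "a + b = m" for a b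
    using that keys_add_nat[of a b] by (auto simp: K_def)
  have keysK': "Poly_Mapping.keys a \<subseteq> K'" "Poly_Mapping.keys b \<subseteq> K'" if "a + b = m'" for a b
    using that keys_add_nat[of a b] by (auto simp: K'_def)
  show ?thesis
    unfolding conv_def
  proof (rule sum.reindex_bij_witness[of _ "\<lambda>(a, b). (relabel \<sigma> K a, relabel \<sigma> K b)"
        "\<lambda>(a, b). (relabel \<tau> K' a, relabel \<tau> K' b)"])
    fix x assume x: "x \<in> {(a, b). a + b = m}"
    obtain a b where ab: "x = (a, b)" "a + b = m" using x by auto
    note k = keysK[OF ab(2)]
    show "(case case x of (a, b) \<Rightarrow> (relabel \<tau> K' a, relabel \<tau> K' b) of
        (a, b) \<Rightarrow> (relabel \<sigma> K a, relabel \<sigma> K b)) = x"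
      using ab bck k by simp
    show "(case x of (a, b) \<Rightarrow> (relabel \<tau> K' a, relabel \<tau> K' b)) \<in> {(a, b). a + b = m'}"
      using ab r(1) by (simp add: radd[symmetric] fin)
    have *: "exps (relabel \<tau> K' c) = exps c" if "Poly_Mapping.keys c \<subseteq> K" for c
      by (rule exps_relabel[OF fin(2) s that])
    show "(case case x of (a, b) \<Rightarrow> (relabel \<tau> K' a, relabel \<tau> K' b) of (a, b) \<Rightarrow> f a * g b)
        = (case x of (a, b) \<Rightarrow> f a * g b)"
      using f[OF *[OF k(1)]] g[OF *[OF k(2)]] ab(1) by simp
  next
    fix x assume x: "x \<in> {(a, b). a + b = m'}"
    obtain a b where ab: "x = (a, b)" "a + b = m'" using x by auto
    note k = keysK'[OF ab(2)]
    show "(case case x of (a, b) \<Rightarrow> (relabel \<sigma> K a, relabel \<sigma> K b) of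
        (a, b) \<Rightarrow> (relabel \<tau> K' a, relabel \<tau> K' b)) = x"
      using ab forth k by simp
    show "(case x of (a, b) \<Rightarrow> (relabel \<sigma> K a, relabel \<sigma> K b)) \<in> {(a, b). a + b = m}"
      using ab r(2) by (simp add: radd[symmetric] fin)
  qed
qed

lemma conv_bounded:
  assumes "\<forall>m. f m \<noteq> 0 \<longrightarrow> mdeg m \<le> d" "\<forall>m. g m \<noteq> 0 \<longrightarrow> mdeg m \<le> e" "conv f g m \<noteq> 0"
  shows "mdeg m \<le> d + e"
proof -
  have "\<exists>x\<in>{(a, b). a + b = m}. (case x of (a, b) \<Rightarrow> f a * g b) \<noteq> 0"
    using assms(3) unfolding conv_def by (meson sum.neutral)
  then obtain a b where ab: "m = a + b" "f a \<noteq> 0" "g b \<noteq> 0" by auto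
  have "mdeg a \<le> d" "mdeg b \<le> e" using assms(1,2) ab(2,3) by blast+
  then show ?thesis by (simp add: ab(1) mdeg_add)
qed

lemma conv_assoc: "conv (conv f g) h m = conv f (conv g h) m"
proof -
  let ?P = "\<lambda>m::monomial. {(a, b). a + b = m}"
  have "conv (conv f g) h m = (\<Sum>(p, c)\<in>?P m. \<Sum>(a, b)\<in>?P p. f a * g b * h c)"
    unfolding conv_def by (simp add: sum_distrib_right case_prod_unfold)
  also have "\<dots> = (\<Sum>((p, c), (a, b))\<in>Sigma (?P m) (\<lambda>(p, c). ?P p). f a * g b * h c)"
    by (subst sum.Sigma[symmetric]) (use finite_divisor_pairs in \<open>auto simp: case_prod_unfold\<close>)
  also have "\<dots> = (\<Sum>((a, q), (b, c))\<in>Sigma (?P m) (\<lambda>(a, q). ?P q). f a * (g b * h c))"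
    by (rule sum.reindex_bij_witness[of _ "\<lambda>((a, q), (b, c)). ((a + b, c), (a, b))"
        "\<lambda>((p, c), (a, b)). ((a, b + c), (b, c))"]) (auto simp: add.assoc mult.assoc)
  also have "\<dots> = (\<Sum>(a, q)\<in>?P m. \<Sum>(b, c)\<in>?P q. f a * (g b * h c))"
    by (subst sum.Sigma[symmetric]) (use finite_divisor_pairs in \<open>auto simp: case_prod_unfold\<close>)
  also have "\<dots> = conv f (conv g h) m"
    unfolding conv_def by (simp add: sum_distrib_left case_prod_unfold)
  finally show ?thesis .
qed

lemma conv_commute: "conv f g m = conv g f m"
  unfolding conv_def
  by (rule sum.reindex_bij_witness[of _ prod.swap prod.swap]) (auto simp: add.commute mult.commute)

lemma conv_one: "conv (\<lambda>m. if m = 0 then 1 else 0) g m = g m"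
proof -
  have "conv (\<lambda>m. if m = 0 then 1 else 0) g m =
      (\<Sum>(a, b)\<in>{(0 :: monomial, m)}. (if a = 0 then 1 else 0) * g b)"
    unfolding conv_def
    by (rule sum.mono_neutral_right) (use finite_divisor_pairs[of m] in \<open>auto split: if_splits\<close>)
  then show ?thesis by simp
qed

instantiation qsym :: "{comm_ring_1, real_algebra_1}"
begin

lift_definition zero_qsym :: qsym is "\<lambda>_. 0" by simp

lift_definition one_qsym :: qsym is "\<lambda>m. if m = 0 then 1 else 0"
  by (auto split: if_splits simp flip: exps_eq_Nil_iff simp: mdeg_def)

lift_definition plus_qsym :: "qsym \<Rightarrow> qsym \<Rightarrow> qsym" is "\<lambda>f g m. f m + g m"
proof safe
  fix f g :: "monomial \<Rightarrow> real" and d e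
  assume "\<forall>m. f m \<noteq> 0 \<longrightarrow> mdeg m \<le> d" "\<forall>m. g m \<noteq> 0 \<longrightarrow> mdeg m \<le> e"
  then have *: "f m = 0 \<or> mdeg m \<le> d + e" "g m = 0 \<or> mdeg m \<le> d + e" for m
    by (blast intro: trans_le_add1, blast intro: trans_le_add2)
  show "\<exists>d. \<forall>m. f m + g m \<noteq> 0 \<longrightarrow> mdeg m \<le> d"
  proof (intro exI allI impI)
    fix m assume "f m + g m \<noteq> 0"
    then have "f m \<noteq> 0 \<or> g m \<noteq> 0" by auto
    then show "mdeg m \<le> d + e" using *[of m] by blast
  qed
next
  fix f g :: "monomial \<Rightarrow> real" and m m'
  assume "\<forall>m m'. exps m = exps m' \<longrightarrow> f m = f m'" "\<forall>m m'. exps m = exps m' \<longrightarrow> g m = g m'"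
    "exps m = exps m'"
  then have "f m = f m'" "g m = g m'" by blast+
  then show "f m + g m = f m' + g m'" by simp
qed

lift_definition uminus_qsym :: "qsym \<Rightarrow> qsym" is "\<lambda>f m. - f m"
proof safe
  fix f :: "monomial \<Rightarrow> real" and d
  assume "\<forall>m. f m \<noteq> 0 \<longrightarrow> mdeg m \<le> d"
  then show "\<exists>d. \<forall>m. - f m \<noteq> 0 \<longrightarrow> mdeg m \<le> d" by (intro exI[of _ d]) simp
next
  fix f :: "monomial \<Rightarrow> real" and m m'
  assume "\<forall>m m'. exps m = exps m' \<longrightarrow> f m = f m'" "exps m = exps m'"
  then have "f m = f m'" by blast
  then show "- f m = - f m'" by simp
qed

lift_definition minus_qsym :: "qsym \<Rightarrow> qsym \<Rightarrow> qsym" is "\<lambda>f g m. f m - g m"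
proof safe
  fix f g :: "monomial \<Rightarrow> real" and d e
  assume "\<forall>m. f m \<noteq> 0 \<longrightarrow> mdeg m \<le> d" "\<forall>m. g m \<noteq> 0 \<longrightarrow> mdeg m \<le> e"
  then have *: "f m = 0 \<or> mdeg m \<le> d + e" "g m = 0 \<or> mdeg m \<le> d + e" for m
    by (blast intro: trans_le_add1, blast intro: trans_le_add2)
  show "\<exists>d. \<forall>m. f m - g m \<noteq> 0 \<longrightarrow> mdeg m \<le> d"
  proof (intro exI allI impI)
    fix m assume "f m - g m \<noteq> 0"
    then have "f m \<noteq> 0 \<or> g m \<noteq> 0" by auto
    then show "mdeg m \<le> d + e" using *[of m] by blast
  qed
next
  fix f g :: "monomial \<Rightarrow> real" and m m'
  assume "\<forall>m m'. exps m = exps m' \<longrightarrow> f m = f m'" "\<forall>m m'. exps m = exps m' \<longrightarrow> g m = g m'"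
    "exps m = exps m'"
  then have "f m = f m'" "g m = g m'" by blast+
  then show "f m - g m = f m' - g m'" by simp
qed

lift_definition scaleR_qsym :: "real \<Rightarrow> qsym \<Rightarrow> qsym" is "\<lambda>r f m. r * f m"
proof safe
  fix f :: "monomial \<Rightarrow> real" and r :: real and d
  assume "\<forall>m. f m \<noteq> 0 \<longrightarrow> mdeg m \<le> d"
  then show "\<exists>d. \<forall>m. r * f m \<noteq> 0 \<longrightarrow> mdeg m \<le> d" by (intro exI[of _ d]) simp
next
  fix f :: "monomial \<Rightarrow> real" and r :: real and m m'
  assume "\<forall>m m'. exps m = exps m' \<longrightarrow> f m = f m'" "exps m = exps m'"
  then have "f m = f m'" by blast
  then show "r * f m = r * f m'" by simp
qed

lift_definition times_qsym :: "qsym \<Rightarrow> qsym \<Rightarrow> qsym" is conv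
proof safe
  fix f g :: "monomial \<Rightarrow> real" and d e
  assume "\<forall>m. f m \<noteq> 0 \<longrightarrow> mdeg m \<le> d" "\<forall>m. g m \<noteq> 0 \<longrightarrow> mdeg m \<le> e"
  then show "\<exists>d. \<forall>m. conv f g m \<noteq> 0 \<longrightarrow> mdeg m \<le> d"
    by (intro exI[of _ "d + e"] allI impI) (rule conv_bounded)
next
  fix f g :: "monomial \<Rightarrow> real" and m m'
  assume f: "\<forall>m m'. exps m = exps m' \<longrightarrow> f m = f m'" and g: "\<forall>m m'. exps m = exps m' \<longrightarrow> g m = g m'"
    and e: "exps m = exps m'"
  show "conv f g m = conv f g m'"
  proof (rule conv_quasi[OF _ _ e])
    show "f a = f b" if "exps a = exps b" for a b using f that by blast
    show "g a = g b" if "exps a = exps b" for a b using g that by blast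
  qed
qed

instance
proof
  note eqI = iffD1[OF qcoeff_inject, OF ext]
  note reps = zero_qsym.rep_eq one_qsym.rep_eq plus_qsym.rep_eq uminus_qsym.rep_eq
    minus_qsym.rep_eq scaleR_qsym.rep_eq times_qsym.rep_eq
  fix f g h :: qsym and r s :: real
  show "f + g + h = f + (g + h)" "f + g = g + f" "0 + f = f" "- f + f = 0" "f - g = f + - g"
    by (rule eqI; simp add: reps)+
  show "r *\<^sub>R (f + g) = r *\<^sub>R f + r *\<^sub>R g" "(r + s) *\<^sub>R f = r *\<^sub>R f + s *\<^sub>R f"
    "r *\<^sub>R s *\<^sub>R f = (r * s) *\<^sub>R f" "1 *\<^sub>R f = f"
    by (rule eqI; simp add: reps algebra_simps)+
  show "f * g * h = f * (g * h)" by (rule eqI) (simp add: reps conv_assoc)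
  show "f * g = g * f" by (rule eqI) (simp only: reps conv_commute[of "qcoeff f"])
  show "1 * f = f" by (rule eqI) (simp add: reps conv_one)
  show "(f + g) * h = f * h + g * h"
    by (rule eqI) (simp add: reps conv_def distrib_right sum.distrib case_prod_unfold)
  show "r *\<^sub>R f * g = r *\<^sub>R (f * g)"
    by (rule eqI) (simp add: reps conv_def sum_distrib_left mult.assoc case_prod_unfold)
  show "f * r *\<^sub>R g = r *\<^sub>R (f * g)"
    by (rule eqI) (simp add: reps conv_def sum_distrib_left mult.left_commute case_prod_unfold)
  show "f * (g + h) = f * g + f * h"
    by (rule eqI) (simp add: reps conv_def distrib_left sum.distrib case_prod_unfold)
  show "f * 1 = f" by (rule eqI) (simp only: reps conv_one conv_commute[of "qcoeff f" "\<lambda>m. if m = 0 then 1 else 0"])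
  have "qcoeff 0 0 \<noteq> qcoeff 1 0" by (simp add: reps)
  then show "(0::qsym) \<noteq> 1" by metis
qed

end

definition homogeneous :: "nat \<Rightarrow> qsym \<Rightarrow> bool" where
  "homogeneous n f \<longleftrightarrow> (\<forall>m. qcoeff f m \<noteq> 0 \<longrightarrow> mdeg m = n)"

section \<open>Compositions and the monomial basis\<close>

definition composition :: "nat list \<Rightarrow> bool" where
  "composition \<alpha> \<longleftrightarrow> 0 \<notin> set \<alpha>"

definition Comp :: "nat \<Rightarrow> nat list set" where
  "Comp n = {\<alpha>. composition \<alpha> \<and> sum_list \<alpha> = n}"

definition partial_sums :: "nat list \<Rightarrow> nat set" where
  "partial_sums \<alpha> = {sum_list (take i \<alpha>) | i. 1 \<le> i \<and> i < length \<alpha>}"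

definition coarser :: "nat list \<Rightarrow> nat list \<Rightarrow> bool" (infix "\<preceq>" 50) where
  "\<alpha> \<preceq> \<beta> \<longleftrightarrow> sum_list \<alpha> = sum_list \<beta> \<and> partial_sums \<alpha> \<subseteq> partial_sums \<beta>"

text \<open>Each monomial with exponent sequence \<open>\<alpha>\<close> occurs exactly once in
  \<open>\<Sum> x\<^bsub>i\<^sub>1\<^esub>\<^bsup>a\<^sub>1\<^esup> \<cdots> x\<^bsub>i\<^sub>k\<^esub>\<^bsup>a\<^sub>k\<^esup>\<close>. For lists containing \<open>0\<close>, which are not compositions, this gives \<open>M \<alpha> = 0\<close>.\<close>

lift_definition M :: "nat list \<Rightarrow> qsym" is "\<lambda>\<alpha> m. if exps m = \<alpha> then 1 else 0"
  by (auto simp: mdeg_def)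

text \<open>The coefficient of \<open>M \<alpha>\<close> in \<open>f\<close> is that of \<open>x\<^sub>0\<^bsup>a\<^sub>1\<^esup> x\<^sub>1\<^bsup>a\<^sub>2\<^esup> \<cdots>\<close>.\<close>

definition M_coeff :: "qsym \<Rightarrow> nat list \<Rightarrow> real" where
  "M_coeff f \<alpha> = qcoeff f (Poly_Mapping.nth \<alpha>)"

text \<open>The linear map with \<open>M \<alpha> \<mapsto> g \<alpha>\<close> for all compositions \<open>\<alpha>\<close>; see \<open>linear_M_extend\<close>, \<open>M_extend_M\<close>
  and \<open>M_extend_unique\<close>.\<close>

definition M_extend :: "(nat list \<Rightarrow> 'v::real_vector) \<Rightarrow> qsym \<Rightarrow> 'v" where
  "M_extend g f = (\<Sum>\<alpha> | composition \<alpha> \<and> M_coeff f \<alpha> \<noteq> 0. M_coeff f \<alpha> *\<^sub>R g \<alpha>)"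

lemma composition_exps: "composition (exps m)"
  by (auto simp: composition_def exps_def in_keys_iff)

lemma exps_nth:
  assumes "composition \<alpha>"
  shows "exps (Poly_Mapping.nth \<alpha>) = \<alpha>"
proof -
  have pos: "nth_default 0 \<alpha> i \<noteq> 0 \<longleftrightarrow> i < length \<alpha>" for i
    using assms nth_mem[of i \<alpha>] unfolding composition_def nth_default_def by metis
  have "Poly_Mapping.keys (Poly_Mapping.nth \<alpha>) = {0..<length \<alpha>}"
    by (rule set_eqI) (simp only: in_keys_iff lookup_nth pos atLeastLessThan_iff le0 simp_thms)
  then have "exps (Poly_Mapping.nth \<alpha>) = map (nth_default 0 \<alpha>) [0..<length \<alpha>]"
    unfolding exps_def by (simp only: lookup_nth sorted_list_of_set_range)
  also have "\<dots> = \<alpha>" by (rule nth_equalityI) (simp_all add: nth_default_def)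
  finally show ?thesis .
qed

lemma qcoeff_exps: "exps m = exps m' \<Longrightarrow> qcoeff f m = qcoeff f m'"
  using qcoeff[of f] unfolding mem_Collect_eq by blast

lemma M_coeff_exps: "M_coeff f (exps m) = qcoeff f m"
  unfolding M_coeff_def by (rule qcoeff_exps) (simp add: exps_nth composition_exps)

lemma length_le_sum_list: "composition \<alpha> \<Longrightarrow> length \<alpha> \<le> sum_list \<alpha>"
proof (induction \<alpha>)
  case (Cons a \<alpha>)
  then have "a > 0" "length \<alpha> \<le> sum_list \<alpha>" by (auto simp: composition_def intro: gr0I)
  then show ?case by simp
qed simp

lemma finite_compositions_le: "finite {\<alpha>. composition \<alpha> \<and> sum_list \<alpha> \<le> d}"
proof (rule finite_subset)
  show "{\<alpha>. composition \<alpha> \<and> sum_list \<alpha> \<le> d} \<subseteq> {\<alpha>. set \<alpha> \<subseteq> {..d} \<and> length \<alpha> \<le> d}"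
  proof safe
    fix \<alpha> a assume "composition \<alpha>" "sum_list \<alpha> \<le> d"
    then show "length \<alpha> \<le> d" using length_le_sum_list[of \<alpha>] by simp
    show "a \<le> d" if "a \<in> set \<alpha>"
      using member_le_sum_list[OF that] \<open>sum_list \<alpha> \<le> d\<close> by simp
  qed
  show "finite {\<alpha>. set \<alpha> \<subseteq> {..d} \<and> length \<alpha> \<le> d}"
    by (rule finite_lists_length_le) simp
qed

lemma finite_Comp: "finite (Comp n)"
  by (rule finite_subset[OF _ finite_compositions_le[of n]]) (auto simp: Comp_def)

lemma finite_M_support: "finite {\<alpha>. composition \<alpha> \<and> M_coeff f \<alpha> \<noteq> 0}"
proof -
  obtain d where d: "\<And>m. qcoeff f m \<noteq> 0 \<Longrightarrow> mdeg m \<le> d"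
    using qcoeff[of f] unfolding mem_Collect_eq by blast
  have "{\<alpha>. composition \<alpha> \<and> M_coeff f \<alpha> \<noteq> 0} \<subseteq> {\<alpha>. composition \<alpha> \<and> sum_list \<alpha> \<le> d}"
  proof safe
    fix \<alpha> assume \<alpha>: "composition \<alpha>" "M_coeff f \<alpha> \<noteq> 0"
    then show "sum_list \<alpha> \<le> d"
      using d[of "Poly_Mapping.nth \<alpha>"] unfolding M_coeff_def mdeg_def exps_nth[OF \<alpha>(1)] by blast
  qed
  then show ?thesis using finite_compositions_le finite_subset by blast
qed

lemma M_coeff_M: "composition \<alpha> \<Longrightarrow> M_coeff (M \<beta>) \<alpha> = (if \<alpha> = \<beta> then 1 else 0)"
  by (simp add: M_coeff_def M.rep_eq exps_nth)

lemma M_coeff_linear [simp]: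
  "M_coeff (f + g) \<alpha> = M_coeff f \<alpha> + M_coeff g \<alpha>" "M_coeff (r *\<^sub>R f) \<alpha> = r * M_coeff f \<alpha>"
  by (simp_all add: M_coeff_def plus_qsym.rep_eq scaleR_qsym.rep_eq)

lemma M_extend_superset:
  assumes "finite S" "{\<alpha>. composition \<alpha> \<and> M_coeff f \<alpha> \<noteq> 0} \<subseteq> S" "\<And>\<alpha>. \<alpha> \<in> S \<Longrightarrow> composition \<alpha>"
  shows "M_extend g f = (\<Sum>\<alpha>\<in>S. M_coeff f \<alpha> *\<^sub>R g \<alpha>)"
  unfolding M_extend_def using assms by (intro sum.mono_neutral_left) auto

lemma linear_M_extend: "linear (M_extend g)"
proof (rule linearI)
  fix f f' :: qsym and r :: real
  let ?S = "{\<alpha>. composition \<alpha> \<and> M_coeff f \<alpha> \<noteq> 0} \<union> {\<alpha>. composition \<alpha> \<and> M_coeff f' \<alpha> \<noteq> 0}"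
  note fin = finite_M_support[of f] finite_M_support[of f']
  have "M_extend g (f + f') = (\<Sum>\<alpha>\<in>?S. M_coeff (f + f') \<alpha> *\<^sub>R g \<alpha>)"
    by (rule M_extend_superset) (use fin in auto)
  also have "\<dots> = (\<Sum>\<alpha>\<in>?S. M_coeff f \<alpha> *\<^sub>R g \<alpha>) + (\<Sum>\<alpha>\<in>?S. M_coeff f' \<alpha> *\<^sub>R g \<alpha>)"
    by (simp add: scaleR_add_left sum.distrib)
  also have "\<dots> = M_extend g f + M_extend g f'"
    by (subst (1 2) M_extend_superset[of ?S]) (use fin in auto)
  finally show "M_extend g (f + f') = M_extend g f + M_extend g f'" .
  have "M_extend g (r *\<^sub>R f) = (\<Sum>\<alpha> | composition \<alpha> \<and> M_coeff f \<alpha> \<noteq> 0. M_coeff (r *\<^sub>R f) \<alpha> *\<^sub>R g \<alpha>)"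
    by (rule M_extend_superset) (use fin in auto)
  then show "M_extend g (r *\<^sub>R f) = r *\<^sub>R M_extend g f"
    by (simp add: M_extend_def scaleR_sum_right)
qed

lemma M_extend_M:
  assumes "composition \<alpha>"
  shows "M_extend g (M \<alpha>) = g \<alpha>"
proof -
  have "M_extend g (M \<alpha>) = (\<Sum>\<beta>\<in>{\<alpha>}. M_coeff (M \<alpha>) \<beta> *\<^sub>R g \<beta>)"
    by (rule M_extend_superset) (use assms in \<open>auto simp: M_coeff_M split: if_splits\<close>)
  then show ?thesis using assms by (simp add: M_coeff_M)
qed

lemma qcoeff_sum: "qcoeff (sum F S) m = (\<Sum>x\<in>S. qcoeff (F x) m)"
  by (induction S rule: infinite_finite_induct)
    (simp_all add: zero_qsym.rep_eq plus_qsym.rep_eq)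

lemma M_expansion: "f = (\<Sum>\<alpha> | composition \<alpha> \<and> M_coeff f \<alpha> \<noteq> 0. M_coeff f \<alpha> *\<^sub>R M \<alpha>)"
proof -
  let ?S = "{\<alpha>. composition \<alpha> \<and> M_coeff f \<alpha> \<noteq> 0}"
  have "qcoeff (\<Sum>\<alpha>\<in>?S. M_coeff f \<alpha> *\<^sub>R M \<alpha>) m = qcoeff f m" for m
  proof -
    have "qcoeff (\<Sum>\<alpha>\<in>?S. M_coeff f \<alpha> *\<^sub>R M \<alpha>) m =
        (\<Sum>\<alpha>\<in>?S. if \<alpha> = exps m then M_coeff f \<alpha> else 0)"
      unfolding qcoeff_sum by (rule sum.cong) (auto simp: scaleR_qsym.rep_eq M.rep_eq)
    also have "\<dots> = qcoeff f m"
      using finite_M_support[of f] by (simp add: composition_exps M_coeff_exps)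
    finally show ?thesis .
  qed
  then show ?thesis by (intro iffD1[OF qcoeff_inject, OF ext]) (rule sym)
qed

lemma M_extend_unique:
  assumes "linear \<Phi>" "\<And>\<alpha>. composition \<alpha> \<Longrightarrow> \<Phi> (M \<alpha>) = g \<alpha>"
  shows "\<Phi> = M_extend g"
proof
  fix f
  have "\<Phi> f = \<Phi> (\<Sum>\<alpha> | composition \<alpha> \<and> M_coeff f \<alpha> \<noteq> 0. M_coeff f \<alpha> *\<^sub>R M \<alpha>)"
    using M_expansion[of f] by simp
  also have "\<dots> = M_extend g f"
    unfolding M_extend_def linear_sum[OF assms(1)]
    by (rule sum.cong) (simp_all add: linear_scale[OF assms(1)] assms(2))
  finally show "\<Phi> f = M_extend g f" .
qed

section \<open>Hopf algebra structure and endomorphisms\<close>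

text \<open>The deconcatenation coproduct; \<open>i\<close> is the length of the first factor of \<open>\<alpha> = \<beta> \<cdot> \<gamma>\<close>.\<close>

definition comult :: "qsym \<Rightarrow> (qsym, qsym) tensor" where
  "comult = M_extend (\<lambda>\<alpha>. \<Sum>i\<le>length \<alpha>. M (take i \<alpha>) \<otimes>\<^sub>R M (drop i \<alpha>))"

definition counit :: "qsym \<Rightarrow> real" where
  "counit f = qcoeff f 0"

text \<open>A bialgebra morphism between Hopf algebras automatically commutes with the antipodes, so,
  as usual, no antipode condition is imposed.\<close>

definition QSym_End :: "(qsym \<Rightarrow> qsym) set" where
  "QSym_End = {\<Phi>. linear \<Phi>
     \<and> (\<forall>n f. homogeneous n f \<longrightarrow> homogeneous n (\<Phi> f))
     \<and> \<Phi> 1 = 1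
     \<and> (\<forall>f g. \<Phi> (f * g) = \<Phi> f * \<Phi> g)
     \<and> (\<forall>f. counit (\<Phi> f) = counit f)
     \<and> (\<forall>f. comult (\<Phi> f) = tensor_map \<Phi> \<Phi> (comult f))}"

section \<open>Lyndon expansions and the operators\<close>

text \<open>Polynomials over the reals in commuting variables indexed by \<open>'x\<close>.\<close>

type_synonym 'x mpoly = "('x \<Rightarrow>\<^sub>0 nat) \<Rightarrow>\<^sub>0 real"

definition poly_eval :: "('x \<Rightarrow> 'a::{comm_ring_1, real_algebra_1}) \<Rightarrow> 'x mpoly \<Rightarrow> 'a" where
  "poly_eval v p = (\<Sum>m\<in>Poly_Mapping.keys p.
     Poly_Mapping.lookup p m *\<^sub>R (\<Prod>i\<in>Poly_Mapping.keys m. v i ^ Poly_Mapping.lookup m i))"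

definition poly_vars :: "'x mpoly \<Rightarrow> 'x set" where
  "poly_vars p = (\<Union>m\<in>Poly_Mapping.keys p. Poly_Mapping.keys m)"

definition lyndon :: "nat list \<Rightarrow> bool" where
  "lyndon \<alpha> \<longleftrightarrow> composition \<alpha> \<and> \<alpha> \<noteq> [] \<and>
     (\<forall>i. 1 \<le> i \<and> i < length \<alpha> \<longrightarrow> (\<alpha>, rotate i \<alpha>) \<in> lexord less_than)"

text \<open>The Lyndon expansion of \<open>M \<beta>\<close> with the variable \<open>u\<^sub>\<alpha>\<close> (indexed by the list \<open>\<alpha>\<close>) in place of
  \<open>M \<alpha>\<close>, that is, \<open>A\<^sub>n(\<beta>, (n))\<close> for a composition \<open>\<beta>\<close> of \<open>n\<close>.\<close>

definition lyndon_expansion :: "nat list \<Rightarrow> nat list mpoly" where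
  "lyndon_expansion \<beta> = (THE p. poly_vars p \<subseteq> Collect lyndon \<and> poly_eval M p = M \<beta>)"

text \<open>The factorization \<open>\<beta> = \<beta>\<^sub>1 \<cdots> \<beta>\<^sub>k\<close> with \<open>|\<beta>\<^sub>i| = a\<^sub>i\<close>, unique for compositions \<open>\<alpha> \<preceq> \<beta>\<close>.\<close>

definition blocks :: "nat list \<Rightarrow> nat list \<Rightarrow> nat list list" where
  "blocks \<beta> \<alpha> = (THE bs. concat bs = \<beta> \<and> map sum_list bs = \<alpha>)"

definition A_entry :: "nat list \<Rightarrow> nat list \<Rightarrow> nat list mpoly" where
  "A_entry \<beta> \<alpha> = (if \<alpha> \<preceq> \<beta> then prod_list (map lyndon_expansion (blocks \<beta> \<alpha>)) else 0)"

text \<open>The operator attached to the assignment \<open>u\<^sub>\<alpha> := u \<alpha>\<close>; see \<open>Phi_M\<close>. The values of \<open>u\<close> at lists that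
  are not Lyndon compositions do not occur.\<close>

definition Phi :: "(nat list \<Rightarrow> real) \<Rightarrow> qsym \<Rightarrow> qsym" where
  "Phi u = M_extend (\<lambda>\<beta>. \<Sum>\<alpha> | \<alpha> \<in> Comp (sum_list \<beta>) \<and> \<alpha> \<preceq> \<beta>. poly_eval u (A_entry \<beta> \<alpha>) *\<^sub>R M \<alpha>)"

lemma linear_Phi: "linear (Phi u)"
  unfolding Phi_def by (rule linear_M_extend)

lemma Phi_M:
  "\<beta> \<in> Comp n \<Longrightarrow> Phi u (M \<beta>) = (\<Sum>\<alpha> | \<alpha> \<in> Comp n \<and> \<alpha> \<preceq> \<beta>. poly_eval u (A_entry \<beta> \<alpha>) *\<^sub>R M \<alpha>)"
  unfolding Phi_def by (auto simp: Comp_def M_extend_M)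

end

(* Sorting the compositions of n by length and then lexicographically, i.e. by their value in a large
   base B, the product of the M_l over a weakly decreasing sequence of Lyndon words has a positive
   coefficient at the concatenation of the sequence and is otherwise supported on smaller compositions.
   As every word is such a concatenation in exactly one way, the products are a basis: the algebra is
   freely generated by the M_l, and every assignment u extends to a character z of the algebra.
   The coefficient of Phi u f at (a_1, ..., a_k) is (z_{a_1} x ... x z_{a_k}) applied to the iterated
   coproduct of f (x is the tensor product, z_a the degree a part of z), so that Phi u is multiplicative
   because z and the coproduct are.
   Conversely, an endomorphism F is compatible with iterated coproducts, so it is recovered in the same
   way from its character z = (evaluation at x_0 = 1, x_1 = x_2 = ... = 0) o F. *)

theory Submission
  imports Defs
begin

section \<open>Words in base \<open>B\<close>\<close>

text \<open>Words are compared numerically because the Lyndon arguments then become statements about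
  means: for nonempty words, \<open>x @ y\<close> is below \<open>y @ x\<close> iff
  \<open>rate x < rate y\<close>, and \<open>rate (x @ y)\<close> is a weighted mean of both rates.
  Letters are nonzero digits, so longer words have larger values; this disposes of quasi-shuffles
  that merge letters, and only genuine shuffles need combinatorics. No base serves all words:
  \<open>B\<close> is chosen anew for each polynomial or degree. Multiplicativity of the coproduct
  would ask for a product on tensors and for iterated tensor powers. Both are avoided: (id \<otimes>
  \<psi>) after the coproduct is an operator on quasisymmetric functions
  (\<open>apply_right\<close>), and so is extraction of a power of the first variable
  (\<open>strip\<close>), which acts on the left tensor factor. The two commute by coassociativity,
  and extraction obeys the Cauchy product rule. That rule forces exponent lists with zeros, since a
  divisor of a monomial may skip a variable; quasisymmetry removes the zeros again.\<close>

locale radix =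
  fixes B :: nat
  assumes B_gt_1: "1 < B"
begin

fun val :: "nat list \<Rightarrow> nat" where
  "val [] = 0"
| "val (a # x) = a * B ^ length x + val x"

definition word :: "nat list \<Rightarrow> bool" where
  "word x \<longleftrightarrow> set x \<subseteq> {0<..<B}"

text \<open>The number with the periodic base \<open>B\<close> expansion \<open>0.xxx\<dots>\<close>. Comparing \<open>x @ y\<close> with \<open>y @ x\<close>
  amounts to comparing the rates of \<open>x\<close> and \<open>y\<close> (for \<open>x = []\<close> the rate is the junk value \<open>0\<close>).\<close>

definition rate :: "nat list \<Rightarrow> real" where
  "rate x = val x / (real B ^ length x - 1)"

lemma word_simps [simp]: "word []" "word (a # x) \<longleftrightarrow> 0 < a \<and> a < B \<and> word x"
  "word (x @ y) \<longleftrightarrow> word x \<and> word y"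
  by (auto simp: word_def)

lemma val_append: "val (x @ y) = val x * B ^ length y + val y"
  by (induction x) (simp_all add: algebra_simps power_add)

lemma val_less_power: "word x \<Longrightarrow> val x < B ^ length x"
proof (induction x)
  case (Cons a x)
  then have "val (a # x) < a * B ^ length x + B ^ length x" by simp
  also have "\<dots> = (a + 1) * B ^ length x" by (simp add: algebra_simps)
  also have "\<dots> \<le> B * B ^ length x" using Cons.prems by (intro mult_right_mono) auto
  finally show ?case by simp
qed simp

lemma val_ge_power: "word (a # x) \<Longrightarrow> B ^ length x \<le> val (a # x)"
  by (simp add: trans_le_add1)

text \<open>A word has no digit 0, so the leading digit of the longer word alone outweighs the
  shorter word.\<close>

lemma val_less_if_shorter:
  assumes "word x" "word y" "length x < length y"
  shows "val x < val y"
proof -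
  obtain b z where y: "y = b # z" using assms(3) by (cases y) auto
  have "val x < B ^ length x" by (rule val_less_power[OF assms(1)])
  also have "\<dots> \<le> B ^ length z" using assms(3) y B_gt_1 by (intro power_increasing) auto
  also have "\<dots> \<le> val y" using assms(2) val_ge_power y by blast
  finally show ?thesis .
qed

lemma val_Cons_less_iff:
  assumes "word (a # x)" "word (b # y)" "length x = length y"
  shows "val (a # x) < val (b # y) \<longleftrightarrow> a < b \<or> a = b \<and> val x < val y"
proof -
  have *: "val (c # u) < val (d # v)" if "c < d" "word u" "length u = length v" for c d u v
  proof -
    have "val (c # u) < (c + 1) * B ^ length u" using val_less_power[OF that(2)] by simp
    also have "\<dots> \<le> d * B ^ length u" using that(1) by (intro mult_right_mono) auto
    also have "\<dots> \<le> val (d # v)" using that(3) by simp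
    finally show ?thesis .
  qed
  show ?thesis
    using *[of a b x y] *[of b a y x] assms by (cases a b rule: linorder_cases) auto
qed

lemma val_inj:
  assumes "word x" "word y" "val x = val y"
  shows "x = y"
proof -
  have "length x = length y"
    using val_less_if_shorter[of x y] val_less_if_shorter[of y x] assms
    by (metis less_irrefl linorder_neqE_nat)
  then show ?thesis using assms
  proof (induction x y rule: list_induct2)
    case (Cons a x b y)
    have "a = b" "val x = val y"
      using val_Cons_less_iff[of a x b y] val_Cons_less_iff[of b y a x] Cons
      by (metis less_irrefl linorder_neqE_nat)+
    then show ?case using Cons by auto
  qed simp
qed

lemma lexord_less_than_iff_val:
  assumes "length x = length y" "word x" "word y"
  shows "(x, y) \<in> lexord less_than \<longleftrightarrow> val x < val y"
  using assms
proof (induction x y rule: list_induct2)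
  case (Cons a x b y)
  then show ?case by (subst val_Cons_less_iff) auto
qed simp

section \<open>Rates of concatenations\<close>

lemma power_gt_1: "x \<noteq> [] \<Longrightarrow> 1 < real B ^ length x"
  using B_gt_1 by (intro one_less_power) auto

lemma val_append_less_iff:
  assumes "x \<noteq> []" "y \<noteq> []"
  shows "val (x @ y) < val (y @ x) \<longleftrightarrow> rate x < rate y"
proof -
  have "val (x @ y) < val (y @ x) \<longleftrightarrow>
      real (val x) * (real B ^ length y - 1) < real (val y) * (real B ^ length x - 1)"
    unfolding val_append of_nat_less_iff[where 'a = real, symmetric] by (simp add: algebra_simps)
  then show ?thesis
    using power_gt_1[OF assms(1)] power_gt_1[OF assms(2)] by (simp add: rate_def field_simps)
qed

lemma val_append_le_iff:
  "x \<noteq> [] \<Longrightarrow> y \<noteq> [] \<Longrightarrow> val (x @ y) \<le> val (y @ x) \<longleftrightarrow> rate x \<le> rate y"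
  using val_append_less_iff[of y x] by (simp add: not_less[symmetric])

text \<open>With X and Y the powers of \<open>B\<close> for the two lengths, the denominators
  satisfy XY - 1 = (X - 1)Y + (Y - 1), and the weights are the two summands divided by XY -
  1.\<close>

lemma rate_append:
  assumes "x \<noteq> []" "y \<noteq> []"
  obtains s t where "0 < s" "0 < t" "s + t = 1" "rate (x @ y) = s * rate x + t * rate y"
proof
  let ?X = "real B ^ length x" and ?Y = "real B ^ length y"
  let ?D = "?X * ?Y - 1"
  note X = power_gt_1[OF assms(1)] and Y = power_gt_1[OF assms(2)]
  have D: "?D > 0" using X Y by (simp add: less_1_mult)
  show "(?X - 1) * ?Y / ?D > 0" "(?Y - 1) / ?D > 0"
    using X Y D B_gt_1 by (auto intro!: divide_pos_pos mult_pos_pos)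
  show "(?X - 1) * ?Y / ?D + (?Y - 1) / ?D = 1"
    using D by (simp add: add_divide_distrib[symmetric] left_diff_distrib)
  have "rate (x @ y) = (real (val x) * ?Y + real (val y)) / ?D"
    by (simp add: rate_def val_append power_add)
  moreover have "real (val x) = rate x * (?X - 1)" "real (val y) = rate y * (?Y - 1)"
    using X Y by (simp_all add: rate_def)
  ultimately have "rate (x @ y) = (rate x * (?X - 1) * ?Y + rate y * (?Y - 1)) / ?D" by simp
  then show "rate (x @ y) = (?X - 1) * ?Y / ?D * rate x + (?Y - 1) / ?D * rate y"
    by (simp only: add_divide_distrib times_divide_eq_left times_divide_eq_right mult.commute mult.left_commute)
qed

text \<open>The bounds are conditional because either factor may be empty, and the rate of the empty
  word is a junk value.\<close>

lemma rate_append_le: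
  assumes "x \<noteq> [] \<Longrightarrow> rate x \<le> c" "y \<noteq> [] \<Longrightarrow> rate y \<le> c" "x @ y \<noteq> []"
  shows "rate (x @ y) \<le> c"
proof (cases "x = [] \<or> y = []")
  case False
  then obtain s t where st: "0 < s" "0 < t" "s + t = 1" "rate (x @ y) = s * rate x + t * rate y"
    using rate_append by metis
  have "s * rate x + t * rate y \<le> s * c + t * c"
    using st assms False by (intro add_mono mult_left_mono) auto
  then show ?thesis using st by (simp add: distrib_right[symmetric])
qed (use assms in auto)

lemma rate_append_ge:
  assumes "x \<noteq> []" "y \<noteq> []" "c \<le> rate x" "c \<le> rate y"
  shows "c \<le> rate (x @ y)"
proof -
  obtain s t where st: "0 < s" "0 < t" "s + t = 1" "rate (x @ y) = s * rate x + t * rate y"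
    using rate_append assms(1,2) by metis
  have "s * c + t * c \<le> s * rate x + t * rate y"
    using st assms by (intro add_mono mult_left_mono) auto
  then show ?thesis using st by (simp add: distrib_right[symmetric])
qed

lemma rate_append_gt:
  assumes "x \<noteq> []" "y \<noteq> []" "c < rate x" "c < rate y"
  shows "c < rate (x @ y)"
proof -
  have "min (rate x) (rate y) \<le> rate (x @ y)"
    using assms by (intro rate_append_ge) auto
  then show ?thesis using assms by linarith
qed

lemma rate_append_less:
  assumes "x \<noteq> []" "y \<noteq> []" "rate x < c" "rate y < c"
  shows "rate (x @ y) < c"
proof -
  have "rate (x @ y) \<le> max (rate x) (rate y)"
    using assms by (intro rate_append_le) auto
  then show ?thesis using assms by linarith
qed

text \<open>A nontrivial cyclic rearrangement of \<open>p @ q\<close> is \<open>q @ p\<close>. The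
  two have equal length, so comparing them lexicographically means comparing values, hence rates of
  \<open>p\<close> and \<open>q\<close>.\<close>

lemma lyndon_iff_rate:
  assumes "word x"
  shows "lyndon x \<longleftrightarrow> x \<noteq> [] \<and> (\<forall>p q. x = p @ q \<and> p \<noteq> [] \<and> q \<noteq> [] \<longrightarrow> rate p < rate q)"
proof -
  have "composition x" using assms by (auto simp: composition_def word_def)
  moreover have "(\<forall>i. 1 \<le> i \<and> i < length x \<longrightarrow> (x, rotate i x) \<in> lexord less_than) \<longleftrightarrow>
      (\<forall>p q. x = p @ q \<and> p \<noteq> [] \<and> q \<noteq> [] \<longrightarrow> rate p < rate q)"
  proof -
    have eq: "(x, rotate i x) \<in> lexord less_than \<longleftrightarrow> rate (take i x) < rate (drop i x)"
      if i: "1 \<le> i" "i < length x" for i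
    proof -
      have "(x, rotate i x) \<in> lexord less_than \<longleftrightarrow> val x < val (rotate i x)"
        by (rule lexord_less_than_iff_val) (use assms in \<open>simp_all add: word_def\<close>)
      also have "\<dots> \<longleftrightarrow> val (take i x @ drop i x) < val (drop i x @ take i x)"
        using i by (simp add: rotate_drop_take)
      also have "\<dots> \<longleftrightarrow> rate (take i x) < rate (drop i x)"
        using i by (intro val_append_less_iff) auto
      finally show ?thesis .
    qed
    have split: "\<exists>i. 1 \<le> i \<and> i < length x \<and> p = take i x \<and> q = drop i x"
      if "x = p @ q" "p \<noteq> []" "q \<noteq> []" for p q
      using that by (intro exI[of _ "length p"]) (auto simp: Suc_le_eq)
    show ?thesis
    proof (intro iffI allI impI; (elim conjE)?)
      fix p q assume "\<forall>i. 1 \<le> i \<and> i < length x \<longrightarrow> (x, rotate i x) \<in> lexord less_than"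
        and "x = p @ q" "p \<noteq> []" "q \<noteq> []"
      then show "rate p < rate q" using split eq by metis
    next
      fix i assume *: "\<forall>p q. x = p @ q \<and> p \<noteq> [] \<and> q \<noteq> [] \<longrightarrow> rate p < rate q"
        and i: "1 \<le> i" "i < length x"
      show "(x, rotate i x) \<in> lexord less_than"
        unfolding eq[OF i] using *[rule_format, of "take i x" "drop i x"] i by (cases x) auto
    qed
  qed
  ultimately show ?thesis by (auto simp: lyndon_def)
qed

lemma lyndon_rate_less: "lyndon (p @ q) \<Longrightarrow> word (p @ q) \<Longrightarrow> p \<noteq> [] \<Longrightarrow> q \<noteq> [] \<Longrightarrow> rate p < rate q"
  using lyndon_iff_rate by blast

lemma lyndon_prefix_rate_le:
  assumes "lyndon (p @ q)" "word (p @ q)" "p \<noteq> []"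
  shows "rate p \<le> rate (p @ q)"
proof (cases "q = []")
  case False
  then show ?thesis using assms lyndon_rate_less[of p q] by (intro rate_append_ge) auto
qed simp

lemma lyndon_suffix_rate_ge:
  assumes "lyndon (p @ q)" "word (p @ q)" "q \<noteq> []"
  shows "rate (p @ q) \<le> rate q"
proof (cases "p = []")
  case False
  then show ?thesis using assms lyndon_rate_less[of p q] by (intro rate_append_le) auto
qed simp

subsection \<open>Factorization into Lyndon words\<close>

text \<open>A cut may fall inside \<open>x\<close>, between the words, or inside \<open>y\<close>. A
  proper prefix of \<open>x\<close> has a smaller rate than the rest of \<open>x\<close> and than
  \<open>y\<close>, hence than their mean; dually for a proper suffix of \<open>y\<close>.\<close>

lemma lyndon_append:
  assumes "lyndon x" "lyndon y" "word x" "word y" "rate x < rate y"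
  shows "lyndon (x @ y)"
proof -
  have ne: "x \<noteq> []" "y \<noteq> []" using assms by (auto simp: lyndon_def)
  have "rate p < rate q" if pq: "x @ y = p @ q" "p \<noteq> []" "q \<noteq> []" for p q
  proof -
    consider z where "z \<noteq> []" "x = p @ z" "q = z @ y" | "p = x" "q = y"
      | z where "z \<noteq> []" "p = x @ z" "y = z @ q"
    proof -
      obtain us where "x @ us = p \<and> y = us @ q \<or> x = p @ us \<and> us @ y = q"
        using pq(1) append_eq_append_conv2[of x y p q] by blast
      then show ?thesis by (cases "us = []") (auto intro: that)
    qed
    then show ?thesis
    proof cases
      case 1
      have "rate p < rate z" "rate p \<le> rate x"
        using lyndon_rate_less lyndon_prefix_rate_le assms 1 pq by auto
      then show ?thesis unfolding 1 using assms 1 ne pq by (intro rate_append_gt) auto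
    next
      case 3
      have "rate z < rate q" "rate y \<le> rate q"
        using lyndon_rate_less lyndon_suffix_rate_ge assms 3 pq by auto
      then show ?thesis unfolding 3 using assms 3 ne pq by (intro rate_append_less) auto
    qed (use assms in simp)
  qed
  then show ?thesis using lyndon_iff_rate[of "x @ y"] assms ne by auto
qed

lemma lyndon_singleton: "0 < a \<Longrightarrow> lyndon [a]"
  by (auto simp: lyndon_def composition_def)

abbreviation decreasing :: "nat list list \<Rightarrow> bool" where
  "decreasing \<equiv> sorted_wrt (\<lambda>x y. rate y \<le> rate x)"

text \<open>While the new factor has a smaller rate than its successor, the two merge into one
  longer Lyndon word; otherwise the sequence is already decreasing.\<close>

lemma lyndon_factorization_Cons:
  assumes "word l" "lyndon l" "\<forall>x\<in>set ls. lyndon x" "decreasing ls" "word (concat ls)"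
  shows "\<exists>ms. concat ms = l @ concat ls \<and> (\<forall>x\<in>set ms. lyndon x) \<and> decreasing ms"
  using assms
proof (induction ls arbitrary: l)
  case Nil
  then show ?case by (intro exI[of _ "[l]"]) auto
next
  case (Cons m ls)
  show ?case
  proof (cases "rate l < rate m")
    case True
    then have "lyndon (l @ m)" using Cons.prems by (intro lyndon_append) auto
    then show ?thesis using Cons.IH[of "l @ m"] Cons.prems by auto
  next
    case False
    then show ?thesis using Cons.prems by (intro exI[of _ "l # m # ls"]) auto
  qed
qed

lemma lyndon_factorization_exists:
  assumes "word w"
  obtains ls where "concat ls = w" "\<forall>x\<in>set ls. lyndon x" "decreasing ls"
proof -
  have "\<exists>ls. concat ls = w \<and> (\<forall>x\<in>set ls. lyndon x) \<and> decreasing ls"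
    using assms
  proof (induction w)
    case Nil
    then show ?case by (intro exI[of _ "[]"]) auto
  next
    case (Cons a w)
    then obtain ls where "concat ls = w" "\<forall>x\<in>set ls. lyndon x" "decreasing ls" by auto
    then show ?case using lyndon_factorization_Cons[of "[a]" ls] Cons.prems lyndon_singleton by auto
  qed
  then show ?thesis using that by blast
qed

text \<open>A prefix consists of whole factors and a prefix of the next one. The latter has at most
  the rate of its factor, and the rate of the whole is a mean.\<close>

lemma decreasing_prefix_rate_le:
  assumes "\<forall>x\<in>set ls. lyndon x" "decreasing ls" "word (concat ls)" "\<forall>x\<in>set ls. rate x \<le> c"
    and "concat ls = p @ q" "p \<noteq> []"
  shows "rate p \<le> c"
  using assms
proof (induction ls arbitrary: p q)
  case (Cons l ls)
  consider z where "l = p @ z" | z where "p = l @ z" "concat ls = z @ q"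
    using Cons.prems(5) by (auto simp: append_eq_append_conv2)
  then show ?case
  proof cases
    case 1
    then have "rate p \<le> rate l" using Cons.prems by (auto intro: lyndon_prefix_rate_le)
    then show ?thesis using Cons.prems by auto
  next
    case 2
    have "rate z \<le> c" if "z \<noteq> []" using Cons.IH[OF _ _ _ _ 2(2) that] Cons.prems by auto
    then show ?thesis unfolding 2 using Cons.prems 2 by (intro rate_append_le) auto
  qed
qed simp

text \<open>If \<open>l = m @ z\<close> with \<open>z\<close> nonempty, then \<open>z\<close> is a
  prefix of the factors after \<open>m\<close>, so its rate is at most that of \<open>m\<close>. In
  the Lyndon word \<open>l\<close> it would have to be larger.\<close>

lemma lyndon_factorization_head_not_longer:
  assumes "\<forall>x\<in>set (l # ls). lyndon x" "\<forall>x\<in>set (m # ms). lyndon x" "decreasing (m # ms)"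
    and "concat (l # ls) = concat (m # ms)" "word (concat (m # ms))"
  shows "length l \<le> length m"
proof (rule ccontr)
  assume "\<not> ?thesis"
  moreover have "l @ concat ls = m @ concat ms" using assms(4) by simp
  then obtain z where "l @ z = m \<or> l = m @ z \<and> z @ concat ls = concat ms"
    using append_eq_append_conv2[of l "concat ls" m "concat ms"] by blast
  ultimately have z: "l = m @ z" "concat ms = z @ concat ls" "z \<noteq> []" by auto
  have "rate z \<le> rate m"
    by (rule decreasing_prefix_rate_le[OF _ _ _ _ z(2,3)]) (use assms in auto)
  moreover have "rate m < rate z"
  proof (rule lyndon_rate_less)
    show "lyndon (m @ z)" using assms(1) z by simp
    have "word l" using assms(4,5) word_simps(3) by (metis concat.simps(2))
    then show "word (m @ z)" using z by simp
  qed (use assms z in \<open>auto simp: lyndon_def\<close>)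
  ultimately show False by simp
qed

lemma lyndon_factorization_unique:
  assumes "\<forall>x\<in>set ls. lyndon x" "\<forall>x\<in>set ms. lyndon x" "decreasing ls" "decreasing ms"
    and "concat ls = concat ms" "word (concat ms)"
  shows "ls = ms"
  using assms
proof (induction ls arbitrary: ms)
  case Nil
  then show ?case by (cases ms) (auto simp: lyndon_def)
next
  case (Cons l ls)
  have "l \<noteq> []" using Cons.prems(1) by (auto simp: lyndon_def)
  then obtain m ms' where ms: "ms = m # ms'" using Cons.prems(5) by (cases ms) auto
  have "length l \<le> length m"
    by (rule lyndon_factorization_head_not_longer[of l ls m ms']) (use Cons.prems ms in simp_all)
  moreover have "length m \<le> length l"
    by (rule lyndon_factorization_head_not_longer[of m ms' l ls]) (use Cons.prems ms in simp_all)
  ultimately have "length l = length m" by simp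
  then have eq: "l = m" "concat ls = concat ms'" using Cons.prems(5) ms by simp_all
  have "ls = ms'" by (rule Cons.IH) (use Cons.prems ms eq in simp_all)
  then show ?case using eq ms by simp
qed

subsection \<open>The largest shuffle with a Lyndon word\<close>

lemma shuffles_append_left: "t \<in> shuffles x y \<Longrightarrow> p @ t \<in> shuffles (p @ x) y"
  by (induction p) (auto intro: Cons_in_shuffles_leftI)

lemma shuffles_append_right: "t \<in> shuffles x y \<Longrightarrow> p @ t \<in> shuffles x (p @ y)"
  by (induction p) (auto intro: Cons_in_shuffles_rightI)

text \<open>The cut is made where the shuffle takes its first letter from \<open>a # x\<close>;
  everything before it comes from \<open>w\<close>.\<close>

lemma shuffles_split_right:
  assumes "u \<in> shuffles (a # x) w"
  obtains p w' t where "w = p @ w'" "u = p @ a # t" "t \<in> shuffles x w'"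
proof -
  have "\<exists>p w' t. w = p @ w' \<and> u = p @ a # t \<and> t \<in> shuffles x w'"
    using assms
  proof (induction w arbitrary: u)
    case Nil
    then show ?case by auto
  next
    case (Cons b w)
    then consider t where "u = a # t" "t \<in> shuffles x (b # w)"
      | t where "u = b # t" "t \<in> shuffles (a # x) w" by auto
    then show ?case
    proof cases
      case 1
      then show ?thesis by (intro exI[of _ "[]"] exI[of _ "b # w"] exI[of _ t]) auto
    next
      case 2
      from Cons.IH[OF this(2)] obtain p w' t' where "w = p @ w'" "t = p @ a # t'" "t' \<in> shuffles x w'"
        by blast
      then show ?thesis using 2 by (intro exI[of _ "b # p"] exI[of _ w'] exI[of _ t']) auto
    qed
  qed
  then show ?thesis using that by blast
qed

definition max_shuffle :: "nat list \<Rightarrow> nat list \<Rightarrow> nat list \<Rightarrow> bool" where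
  "max_shuffle x w u \<longleftrightarrow> u \<in> shuffles x w \<and> (\<forall>v\<in>shuffles x w. val v \<le> val u)"

lemma max_shuffle_commute: "max_shuffle x w = max_shuffle w x"
  by (simp add: max_shuffle_def shuffles_commutes fun_eq_iff)

lemma max_shuffle_tail:
  assumes "max_shuffle (p @ x) w (p @ t)" "t \<in> shuffles x w"
  shows "max_shuffle x w t"
  unfolding max_shuffle_def
proof (intro conjI ballI)
  fix v assume v: "v \<in> shuffles x w"
  then have "val (p @ v) \<le> val (p @ t)"
    using assms(1) shuffles_append_left unfolding max_shuffle_def by blast
  then show "val v \<le> val t"
    using length_shuffles[OF v] length_shuffles[OF assms(2)] by (simp add: val_append)
qed (rule assms(2))

text \<open>The blocks \<open>p\<close> and \<open>q\<close> come from different words, so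
  exchanging them gives another shuffle, which cannot be larger.\<close>

lemma max_shuffle_swap:
  assumes "max_shuffle (p @ x) (q @ w) (p @ q @ t)" "t \<in> shuffles x w" "p \<noteq> []" "q \<noteq> []"
  shows "rate q \<le> rate p"
proof -
  have "q @ p @ t \<in> shuffles (p @ x) (q @ w)"
    by (intro shuffles_append_right shuffles_append_left assms(2))
  then have "val (q @ p @ t) \<le> val (p @ q @ t)" using assms(1) by (auto simp: max_shuffle_def)
  then have "val (q @ p) \<le> val (p @ q)"
    using B_gt_1 by (simp add: val_append power_add add_mult_distrib[symmetric] mult.assoc[symmetric])
  then show ?thesis using assms by (simp add: val_append_le_iff)
qed

text \<open>In a largest shuffle, adjacent blocks of the two words cannot be profitably swapped, so the
  rates of the successive alternating blocks decrease.\<close>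

lemma max_shuffle_first_block:
  assumes "max_shuffle (p @ x) (b # w) (p @ b # t)" "t \<in> shuffles x w" "p \<noteq> []"
  shows "rate (b # w) \<le> rate p" "x \<noteq> [] \<Longrightarrow> rate x \<le> rate p"
proof -
  have "rate (b # w) \<le> rate p \<and> (x \<noteq> [] \<longrightarrow> rate x \<le> rate p)"
    using assms
  proof (induction "length x + length w" arbitrary: p x b w t rule: less_induct)
    case less
    show ?case
    proof (cases x)
      case Nil
      then have "t = w" using less.prems by simp
      then show ?thesis using max_shuffle_swap[of p "[]" "b # w" "[]" "[]"] less.prems Nil by auto
    next
      case (Cons a x')
      \<comment> \<open>\<open>b # q\<close> is the second block: the run of letters of the second
        word that ends where \<open>x\<close> resumes with \<open>a\<close>.\<close>
      from less.prems(2) obtain q w' t' where q: "w = q @ w'" "t = q @ a # t'" "t' \<in> shuffles x' w'"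
        unfolding Cons by (rule shuffles_split_right)
      have t': "a # t' \<in> shuffles x w'" using q(3) Cons by (simp add: Cons_in_shuffles_leftI)
      have "rate (b # q) \<le> rate p"
        by (rule max_shuffle_swap[of p x _ w' "a # t'"]) (use less.prems t' q in simp_all)
      moreover have "max_shuffle (b # w) x (b # q @ a # t')"
      proof -
        have "b # t \<in> shuffles x (b # w)" using less.prems(2) by (rule Cons_in_shuffles_rightI)
        then have "max_shuffle x (b # w) (b # t)" using max_shuffle_tail less.prems(1) by blast
        then show ?thesis using q by (simp add: max_shuffle_commute)
      qed
      \<comment> \<open>With the roles of the words exchanged, the second block is the first block
        of what remains. Its rate bounds those of \<open>x\<close> and \<open>w'\<close>, and is
        itself at most that of \<open>p\<close>.\<close>
      then have "rate (a # x') \<le> rate (b # q) \<and> (w' \<noteq> [] \<longrightarrow> rate w' \<le> rate (b # q))"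
        using less.hyps[of w' x' "b # q" a t'] q Cons by (simp add: shuffles_commutes)
      ultimately show ?thesis
        using rate_append_le[of "b # q" "rate p" w'] q Cons by auto
    qed
  qed
  then show "rate (b # w) \<le> rate p" "x \<noteq> [] \<Longrightarrow> rate x \<le> rate p" by auto
qed

text \<open>If the shuffle left \<open>x\<close> before its end, the rest of \<open>x\<close> would
  have at most the rate of the part already used, by \<open>max_shuffle_first_block\<close>. In a
  Lyndon word the rest has the larger rate.\<close>

lemma lyndon_max_shuffle_block:
  assumes "lyndon x" "word x" "max_shuffle x w (a # t)" "x = a # x'" "t \<in> shuffles x' w"
  shows "a # t = x @ w"
proof (cases w)
  case (Cons b w')
  from assms(5) obtain q x'' t' where q: "x' = q @ x''" "t = q @ b # t'" "t' \<in> shuffles w' x''"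
    unfolding Cons shuffles_commutes[of x'] by (rule shuffles_split_right)
  have x'': "x'' = []"
  proof (rule ccontr)
    assume ne: "x'' \<noteq> []"
    have "rate x'' \<le> rate (a # q)"
      by (rule max_shuffle_first_block(2)[of "a # q" x'' b w' t'])
        (use assms q Cons ne in \<open>simp_all add: shuffles_commutes\<close>)
    moreover have "rate (a # q) < rate x''"
      by (rule lyndon_rate_less) (use assms q ne in simp_all)
    ultimately show False by simp
  qed
  then show ?thesis using q assms(4) Cons by simp
qed (use assms in simp)

text \<open>Once a largest shuffle enters \<open>x\<close> it must run through all of it, so it has
  the form \<open>p @ x @ w'\<close> with \<open>w = p @ w'\<close>. As
  \<open>rate p \<le> rate x\<close>, moving \<open>x\<close> to the front does not decrease the
  value.\<close>

lemma lyndon_shuffle_le: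
  assumes "lyndon x" "word x"
    and prefix: "\<And>p q. w = p @ q \<Longrightarrow> p \<noteq> [] \<Longrightarrow> rate p \<le> rate x"
    and u: "u \<in> shuffles x w"
  shows "val u \<le> val (x @ w)"
proof -
  obtain v where v: "max_shuffle x w v"
  proof -
    have "shuffles x w \<noteq> {}" using u by auto
    then have "Max (val ` shuffles x w) \<in> val ` shuffles x w" by (intro Max_in) auto
    then obtain v where "v \<in> shuffles x w" "val v = Max (val ` shuffles x w)" by auto
    then show ?thesis by (intro that[of v]) (simp add: max_shuffle_def)
  qed
  obtain a x' where x: "x = a # x'" using assms(1) by (cases x) (auto simp: lyndon_def)
  have "v \<in> shuffles x w" using v by (simp add: max_shuffle_def)
  then obtain p w' t where p: "w = p @ w'" "v = p @ a # t" "t \<in> shuffles x' w'"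
    unfolding x by (rule shuffles_split_right)
  have t: "a # t \<in> shuffles x w'" using p(3) x by (simp add: Cons_in_shuffles_leftI)
  have "max_shuffle w' x (a # t)"
    by (rule max_shuffle_tail[of p]) (use v p t in \<open>simp_all add: max_shuffle_commute shuffles_commutes\<close>)
  then have "a # t = x @ w'"
    using lyndon_max_shuffle_block[OF assms(1,2)] x p(3) max_shuffle_commute by metis
  then have "v = p @ x @ w'" using p by simp
  moreover have "val (p @ x @ w') \<le> val (x @ p @ w')"
  proof (cases "p = []")
    case False
    have "val (p @ x) \<le> val (x @ p)"
      using prefix[OF p(1) False] False x by (subst val_append_le_iff) auto
    then have "val ((p @ x) @ w') \<le> val ((x @ p) @ w')"
      unfolding val_append[of _ w'] by simp
    then show ?thesis by simp
  qed simp
  ultimately show ?thesis using v u p(1) by (auto simp: max_shuffle_def)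
qed

end

section \<open>Stripping the first variable\<close>

definition mcons :: "nat \<Rightarrow> monomial \<Rightarrow> monomial" where
  "mcons a m = Abs_poly_mapping (case_nat a (Poly_Mapping.lookup m))"

definition mtail :: "monomial \<Rightarrow> monomial" where
  "mtail m = Abs_poly_mapping (\<lambda>i. Poly_Mapping.lookup m (Suc i))"

lemma lookup_mcons: "Poly_Mapping.lookup (mcons a m) = case_nat a (Poly_Mapping.lookup m)"
proof -
  have "{i. case_nat a (Poly_Mapping.lookup m) i \<noteq> 0} \<subseteq> insert 0 (Suc ` Poly_Mapping.keys m)"
  proof
    fix i assume "i \<in> {i. case_nat a (Poly_Mapping.lookup m) i \<noteq> 0}"
    then show "i \<in> insert 0 (Suc ` Poly_Mapping.keys m)" by (cases i) (auto simp: in_keys_iff)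
  qed
  then have "finite {i. case_nat a (Poly_Mapping.lookup m) i \<noteq> 0}"
    by (rule finite_subset) simp
  then show ?thesis by (simp add: mcons_def)
qed

lemma lookup_mtail: "Poly_Mapping.lookup (mtail m) i = Poly_Mapping.lookup m (Suc i)"
proof -
  have "{i. Poly_Mapping.lookup m (Suc i) \<noteq> 0} = Suc -` Poly_Mapping.keys m"
    by (auto simp: in_keys_iff)
  then have "finite {i. Poly_Mapping.lookup m (Suc i) \<noteq> 0}"
    by (simp add: finite_vimageI)
  then show ?thesis by (simp add: mtail_def)
qed

lemma mcons_mtail: "Poly_Mapping.lookup m 0 = a \<Longrightarrow> mcons a (mtail m) = m"
  by (rule poly_mapping_eqI) (simp add: lookup_mcons lookup_mtail split: nat.splits)

lemma mtail_mcons [simp]: "mtail (mcons a m) = m"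
  by (rule poly_mapping_eqI) (simp add: lookup_mcons lookup_mtail)

lemma mcons_add: "mcons a m + mcons b n = mcons (a + b) (m + n)"
  by (rule poly_mapping_eqI) (simp add: lookup_mcons lookup_add split: nat.splits)

lemma mtail_add: "mtail (m + n) = mtail m + mtail n"
  by (rule poly_mapping_eqI) (simp add: lookup_mtail lookup_add)

lemma nth_Cons_eq_mcons: "Poly_Mapping.nth (a # es) = mcons a (Poly_Mapping.nth es)"
  by (rule poly_mapping_eqI) (simp add: lookup_mcons nth_default_Cons lookup_nth)

lemma exps_mcons: "exps (mcons a m) = (if a = 0 then exps m else a # exps m)"
proof -
  let ?l = "(if a = 0 then [] else [0]) @ map Suc (sorted_list_of_set (Poly_Mapping.keys m))"
  have "Poly_Mapping.keys (mcons a m) = set ?l"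
  proof (rule set_eqI)
    fix i show "i \<in> Poly_Mapping.keys (mcons a m) \<longleftrightarrow> i \<in> set ?l"
      by (cases i) (auto simp: in_keys_iff lookup_mcons)
  qed
  moreover have "sorted_wrt (<) ?l"
    by (auto simp: sorted_wrt_append sorted_wrt_map)
  then have "sorted_list_of_set (set ?l) = ?l"
    by (intro sorted_list_of_set.idem_if_sorted_distinct) (simp_all add: strict_sorted_iff)
  ultimately show ?thesis unfolding exps_def by (simp add: lookup_mcons)
qed

lemma mdeg_mcons: "mdeg (mcons a m) = a + mdeg m"
  by (simp add: mdeg_def exps_mcons)

text \<open>The coefficient of \<open>x\<^sub>0\<^sup>a\<close>, with the remaining variables renumbered.\<close>

lift_definition strip :: "nat \<Rightarrow> qsym \<Rightarrow> qsym" is "\<lambda>a f m. f (mcons a m)"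
proof safe
  fix a :: nat and f :: "monomial \<Rightarrow> real" and m m' :: monomial
  assume "\<forall>m m'. exps m = exps m' \<longrightarrow> f m = f m'" "exps m = exps m'"
  then show "f (mcons a m) = f (mcons a m')" by (metis exps_mcons)
next
  fix a :: nat and f :: "monomial \<Rightarrow> real" and d
  assume d: "\<forall>m. f m \<noteq> 0 \<longrightarrow> mdeg m \<le> d"
  show "\<exists>d. \<forall>m. f (mcons a m) \<noteq> 0 \<longrightarrow> mdeg m \<le> d"
  proof (intro exI allI impI)
    fix m assume "f (mcons a m) \<noteq> 0"
    then show "mdeg m \<le> d" using d by (metis add_leD2 mdeg_mcons)
  qed
qed

lemma qsym_eqI: "(\<And>m. qcoeff f m = qcoeff g m) \<Longrightarrow> f = g"
  by (intro iffD1[OF qcoeff_inject] ext)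

lemma linear_strip: "linear (strip a)"
  by (rule linearI; rule qsym_eqI) (simp_all add: strip.rep_eq plus_qsym.rep_eq scaleR_qsym.rep_eq)

text \<open>The Cauchy product rule for power series in the first variable.\<close>

lemma strip_mult: "strip a (f * g) = (\<Sum>b\<le>a. strip b f * strip (a - b) g)"
proof (rule qsym_eqI)
  fix m
  let ?P = "\<lambda>m::monomial. {(p, q). p + q = m}"
  have "qcoeff (strip a (f * g)) m = (\<Sum>(p, q)\<in>?P (mcons a m). qcoeff f p * qcoeff g q)"
    by (simp add: strip.rep_eq times_qsym.rep_eq conv_def)
  also have "\<dots> = (\<Sum>(b, (p, q))\<in>{..a} \<times> ?P m. qcoeff f (mcons b p) * qcoeff g (mcons (a - b) q))"
  proof (rule sum.reindex_bij_witness[of _ "\<lambda>(b, (p, q)). (mcons b p, mcons (a - b) q)"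
        "\<lambda>(p, q). (Poly_Mapping.lookup p 0, (mtail p, mtail q))"])
    fix x assume "x \<in> ?P (mcons a m)"
    then obtain p q where x: "x = (p, q)" and pq: "p + q = mcons a m" by auto
    have "Poly_Mapping.lookup p 0 + Poly_Mapping.lookup q 0 = a"
      using pq by (simp add: lookup_add[symmetric] lookup_mcons)
    then have a: "Poly_Mapping.lookup p 0 \<le> a" "Poly_Mapping.lookup q 0 = a - Poly_Mapping.lookup p 0"
      by auto
    have m: "mtail p + mtail q = m" using pq by (simp add: mtail_add[symmetric])
    show "(case case x of (p, q) \<Rightarrow> (Poly_Mapping.lookup p 0, (mtail p, mtail q)) of
        (b, (p, q)) \<Rightarrow> (mcons b p, mcons (a - b) q)) = x"
      using x a by (simp add: mcons_mtail)
    show "(case x of (p, q) \<Rightarrow> (Poly_Mapping.lookup p 0, (mtail p, mtail q))) \<in> {..a} \<times> ?P m"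
      using x a m by simp
    show "(case case x of (p, q) \<Rightarrow> (Poly_Mapping.lookup p 0, (mtail p, mtail q)) of
        (b, (p, q)) \<Rightarrow> qcoeff f (mcons b p) * qcoeff g (mcons (a - b) q)) =
        (case x of (p, q) \<Rightarrow> qcoeff f p * qcoeff g q)"
      using x a by (simp add: mcons_mtail)
  qed (auto simp: mcons_add lookup_mcons)
  also have "\<dots> = (\<Sum>b\<le>a. \<Sum>(p, q)\<in>?P m. qcoeff f (mcons b p) * qcoeff g (mcons (a - b) q))"
    by (subst sum.cartesian_product[symmetric]) (simp add: case_prod_unfold)
  also have "\<dots> = qcoeff (\<Sum>b\<le>a. strip b f * strip (a - b) g) m"
    by (simp add: qcoeff_sum strip.rep_eq times_qsym.rep_eq conv_def)
  finally show "qcoeff (strip a (f * g)) m = qcoeff (\<Sum>b\<le>a. strip b f * strip (a - b) g) m" .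
qed

text \<open>Quasisymmetry: setting the first variable to 0 and renumbering the others changes
  nothing.\<close>

lemma strip_0 [simp]: "strip 0 f = f"
proof (rule qsym_eqI)
  fix m show "qcoeff (strip 0 f) m = qcoeff f m"
    unfolding strip.rep_eq by (rule qcoeff_exps) (simp add: exps_mcons)
qed

text \<open>For \<open>a > 0\<close> this is the coproduct followed by reading the coefficient of
  \<open>M [a]\<close> in the left tensor factor.\<close>

lemma strip_M:
  "strip a (M \<alpha>) = (if a = 0 then M \<alpha> else if \<alpha> \<noteq> [] \<and> hd \<alpha> = a then M (tl \<alpha>) else 0)"
proof (cases "a = 0")
  case False
  then show ?thesis
    by (intro qsym_eqI, cases \<alpha>) (auto simp: strip.rep_eq M.rep_eq exps_mcons zero_qsym.rep_eq simp del: exps_eq_Nil_iff)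
qed simp

text \<open>Also valid for \<open>a = 0\<close>: coefficients are read off one variable at a time at
  arbitrary exponent lists, not only at compositions.\<close>

lemma M_coeff_Cons: "M_coeff f (a # es) = M_coeff (strip a f) es"
  by (simp add: M_coeff_def nth_Cons_eq_mcons strip.rep_eq)

lemma linear_M_coeff: "linear (\<lambda>f. M_coeff f \<alpha>)"
  by (rule linearI) simp_all

lemmas M_coeff_sum = linear_sum[OF linear_M_coeff]

lemma M_coeff_0 [simp]: "M_coeff 0 \<alpha> = 0"
  by (rule linear_0[OF linear_M_coeff])

lemma M_coeff_Nil: "M_coeff f [] = qcoeff f 0"
  by (simp add: M_coeff_def)

lemma qsym_eqI_M_coeff: "(\<And>\<alpha>. composition \<alpha> \<Longrightarrow> M_coeff f \<alpha> = M_coeff g \<alpha>) \<Longrightarrow> f = g"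
  by (metis M_coeff_exps composition_exps qsym_eqI)

lemma M_Nil [simp]: "M [] = 1"
  by (rule qsym_eqI) (simp add: M.rep_eq one_qsym.rep_eq)

lemma strip_1 [simp]: "strip a 1 = (if a = 0 then 1 else 0)"
  unfolding M_Nil[symmetric] strip_M by simp

lemma M_coeff_Nil_mult: "M_coeff (f * g) [] = M_coeff f [] * M_coeff g []"
proof -
  have "{(p, q). p + q = (0 :: monomial)} = {(0, 0)}"
    by (auto simp: poly_mapping_eq_iff lookup_add fun_eq_iff)
  then show ?thesis by (simp add: M_coeff_Nil times_qsym.rep_eq conv_def)
qed

lemma linear_eq_on_M:
  assumes "linear F" "linear G" "\<And>\<alpha>. composition \<alpha> \<Longrightarrow> F (M \<alpha>) = G (M \<alpha>)"
  shows "F f = G f"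
  using M_extend_unique[OF assms(1,3)] M_extend_unique[OF assms(2) refl] by simp

lemma bilinear_eq_on_M:
  assumes "bilinear F" "bilinear G"
    and "\<And>\<alpha> \<beta>. composition \<alpha> \<Longrightarrow> composition \<beta> \<Longrightarrow> F (M \<alpha>) (M \<beta>) = G (M \<alpha>) (M \<beta>)"
  shows "F f g = G f g"
proof -
  have "F (M \<alpha>) g = G (M \<alpha>) g" if "composition \<alpha>" for \<alpha>
    by (rule linear_eq_on_M[of "F (M \<alpha>)" "G (M \<alpha>)"]) (use assms that in \<open>auto simp: bilinear_def\<close>)
  then show ?thesis
    by (rule linear_eq_on_M[of "\<lambda>f. F f g" "\<lambda>f. G f g", rotated 2]) (use assms in \<open>auto simp: bilinear_def\<close>)
qed

lemma bilinear_linear_mult: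
  fixes F :: "qsym \<Rightarrow> 'v::real_vector"
  assumes "linear F"
  shows "bilinear (\<lambda>f g. F (f * g))"
  using assms by (auto simp: bilinear_def intro!: linearI simp: distrib_left distrib_right
      linear_add linear_scale)

lemma bilinear_mult_linear:
  fixes F G :: "'b::real_vector \<Rightarrow> 'a::real_algebra"
  assumes "linear F" "linear G"
  shows "bilinear (\<lambda>f g. F f * G g)"
  using assms by (auto simp: bilinear_def intro!: linearI simp: distrib_left distrib_right
      linear_add linear_scale)

section \<open>Products of monomial quasisymmetric functions\<close>

lemma strip_M_cases:
  obtains "strip a (M \<alpha>) = 0" | \<beta> where "strip a (M \<alpha>) = M \<beta>"
  by (cases "a = 0"; cases "\<alpha> \<noteq> [] \<and> hd \<alpha> = a") (auto simp: strip_M)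

lemma M_coeff_M_nonneg: "0 \<le> M_coeff (M \<alpha>) es"
  by (simp add: M_coeff_def M.rep_eq)

text \<open>Stripping turns each factor into 0 or another \<open>M\<close>, so only nonnegative
  terms are added. Without cancellation, a single positive summand makes a coefficient
  positive.\<close>

lemma M_coeff_mult_nonneg: "0 \<le> M_coeff (M x * M w) es"
proof (induction es arbitrary: x w)
  case Nil
  then show ?case by (simp add: M_coeff_Nil_mult M_coeff_M_nonneg)
next
  case (Cons a es)
  have "0 \<le> M_coeff (strip b (M x) * strip c (M w)) es" for b c
    by (cases rule: strip_M_cases[of b x]; cases rule: strip_M_cases[of c w]) (simp_all add: Cons)
  then show ?case by (simp add: M_coeff_Cons strip_mult M_coeff_sum sum_nonneg)
qed

lemma M_coeff_mult_append_pos: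
  assumes "composition x" "composition w"
  shows "0 < M_coeff (M x * M w) (x @ w)"
  using assms(1)
proof (induction x)
  case Nil
  then show ?case using assms(2) by (simp add: M_coeff_M)
next
  case (Cons a x)
  have a: "a \<noteq> 0" using Cons.prems by (auto simp: composition_def)
  have nonneg: "0 \<le> M_coeff (strip b (M (a # x)) * strip c (M w)) (x @ w)" for b c
    by (cases rule: strip_M_cases[of b "a # x"]; cases rule: strip_M_cases[of c w])
      (simp_all add: M_coeff_mult_nonneg)
  have "0 < M_coeff (M x * M w) (x @ w)" using Cons by (simp add: composition_def)
  \<comment> \<open>The summand in which the whole exponent \<open>a\<close> of the first variable
    comes from the first factor.\<close>
  also have "\<dots> = M_coeff (strip a (M (a # x)) * strip (a - a) (M w)) (x @ w)"
    using a by (simp add: strip_M)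
  also have "\<dots> \<le> (\<Sum>b\<le>a. M_coeff (strip b (M (a # x)) * strip (a - b) (M w)) (x @ w))"
    by (rule member_le_sum) (use nonneg in auto)
  finally show ?case by (simp add: M_coeff_Cons strip_mult M_coeff_sum)
qed

text \<open>The terms that are not shuffles come from quasi-shuffles, which merge some letters of the two
  words by addition and are therefore shorter.\<close>

lemma M_mult_support:
  assumes "M_coeff (M x * M w) \<gamma> \<noteq> 0" "composition \<gamma>"
  shows "sum_list \<gamma> = sum_list x + sum_list w \<and>
    (\<gamma> \<in> shuffles x w \<or> length \<gamma> < length x + length w)"
  using assms
proof (induction \<gamma> arbitrary: x w)
  case Nil
  then show ?case
    by (cases x; cases w) (simp_all add: M_coeff_Nil_mult M_coeff_M composition_def)
next
  case (Cons a \<gamma>)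
  have a: "a \<noteq> 0" and \<gamma>: "composition \<gamma>" using Cons.prems(2) by (auto simp: composition_def)
  have "\<exists>b\<in>{..a}. M_coeff (strip b (M x) * strip (a - b) (M w)) \<gamma> \<noteq> 0"
    using Cons.prems(1) unfolding M_coeff_Cons strip_mult M_coeff_sum by (meson sum.neutral)
  then obtain b where b: "b \<le> a" "M_coeff (strip b (M x) * strip (a - b) (M w)) \<gamma> \<noteq> 0" by auto
  note len = length_shuffles[of \<gamma>]
  \<comment> \<open>The letter \<open>a\<close> of the product comes from \<open>w\<close> alone,
    from \<open>x\<close> alone, or from adding a letter of each; the last case loses
    length.\<close>
  consider "b = 0" | "b = a" | "0 < b" "b < a" using b(1) by linarith
  then show ?case
  proof cases
    case 1
    with b a obtain w' where w: "w = a # w'" "M_coeff (M x * M w') \<gamma> \<noteq> 0"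
      by (cases w) (auto simp: strip_M split: if_splits)
    then show ?thesis using Cons.IH[OF w(2) \<gamma>] by (auto intro: Cons_in_shuffles_rightI)
  next
    case 2
    with b a obtain x' where x: "x = a # x'" "M_coeff (M x' * M w) \<gamma> \<noteq> 0"
      by (cases x) (auto simp: strip_M split: if_splits)
    then show ?thesis using Cons.IH[OF x(2) \<gamma>] by (auto intro: Cons_in_shuffles_leftI)
  next
    case 3
    with b obtain x' where x: "x = b # x'" "M_coeff (M x' * strip (a - b) (M w)) \<gamma> \<noteq> 0"
      by (cases x) (auto simp: strip_M split: if_splits)
    with 3 obtain w' where w: "w = (a - b) # w'" "M_coeff (M x' * M w') \<gamma> \<noteq> 0"
      by (cases w) (auto simp: strip_M split: if_splits)
    then show ?thesis using Cons.IH[OF w(2) \<gamma>] x 3 by (auto dest: length_shuffles)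
  qed
qed

lemma M_coeff_mult_expand:
  "M_coeff (h * f) \<gamma> = (\<Sum>\<delta> | composition \<delta> \<and> M_coeff f \<delta> \<noteq> 0. M_coeff f \<delta> * M_coeff (h * M \<delta>) \<gamma>)"
proof -
  have "h * f = (\<Sum>\<delta> | composition \<delta> \<and> M_coeff f \<delta> \<noteq> 0. M_coeff f \<delta> *\<^sub>R (h * M \<delta>))"
    using arg_cong[OF M_expansion[of f], of "\<lambda>f. h * f"]
    by (simp only: sum_distrib_left mult_scaleR_right)
  then show ?thesis by (simp add: M_coeff_sum)
qed

section \<open>Leading terms of products over decreasing Lyndon sequences\<close>

context radix
begin

lemma word_if_composition: "composition x \<Longrightarrow> sum_list x < B \<Longrightarrow> word x"
  unfolding composition_def word_def by (auto dest: le_less_trans[OF member_le_sum_list] intro!: gr0I)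

text \<open>Follow the same shuffling pattern with \<open>w\<close> in place of \<open>v\<close>. At
  the first letter where they differ \<open>w\<close> has the larger one, and this decides the
  comparison.\<close>

lemma shuffle_val_mono:
  assumes "\<gamma> \<in> shuffles x v" "length v = length w" "val v \<le> val w" "word x" "word v" "word w"
  shows "\<exists>u\<in>shuffles x w. val \<gamma> \<le> val u"
  using assms
proof (induction \<gamma> arbitrary: x v w)
  case Nil
  then show ?case by auto
next
  case (Cons a \<gamma>)
  from Cons.prems(1) consider x' where "x = a # x'" "\<gamma> \<in> shuffles x' v"
    | v' where "v = a # v'" "\<gamma> \<in> shuffles x v'"
    by (auto simp: Cons_in_shuffles_iff neq_Nil_conv)
  then show ?case
  proof cases
    case 1
    then obtain u where u: "u \<in> shuffles x' w" "val \<gamma> \<le> val u"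
      using Cons.IH[OF 1(2)] Cons.prems by auto
    moreover have "length u = length \<gamma>"
      using length_shuffles[OF u(1)] length_shuffles[OF 1(2)] Cons.prems(2) by simp
    ultimately show ?thesis using 1
      by (intro bexI[of _ "a # u"]) (auto intro: Cons_in_shuffles_leftI)
  next
    case 2
    with Cons.prems obtain c w' where w: "w = c # w'" by (cases w) auto
    have len: "length v' = length w'" using Cons.prems 2 w by simp
    have "\<not> val w < val v" using Cons.prems by simp
    then consider "a < c" | "a = c" "val v' \<le> val w'"
      using val_Cons_less_iff[of c w' a v'] len Cons.prems w 2
      by (metis linorder_neqE_nat not_less)
    then show ?thesis
    proof cases
      case less: 1
      \<comment> \<open>Any shuffle of the remaining letters will do, as the larger letter
        \<open>c\<close> precedes it.\<close>
      have u: "splice x w' \<in> shuffles x w'" by simp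
      note l = length_shuffles[OF u] length_shuffles[OF 2(2)]
      have "word (c # splice x w')" "word (a # \<gamma>)"
        using set_shuffles[OF u] set_shuffles[OF Cons.prems(1)] Cons.prems w
        by (auto simp: word_def)
      then have "val (a # \<gamma>) < val (c # splice x w')"
        using less l len by (subst val_Cons_less_iff) auto
      then show ?thesis
        using w u by (intro bexI[of _ "c # splice x w'"]) (auto intro: Cons_in_shuffles_rightI)
    next
      case eq: 2
      then obtain u where u: "u \<in> shuffles x w'" "val \<gamma> \<le> val u"
        using Cons.IH[OF 2(2) len] Cons.prems 2 w by auto
      moreover have "length u = length \<gamma>"
        using length_shuffles[OF u(1)] length_shuffles[OF 2(2)] len by simp
      ultimately show ?thesis using eq w
        by (intro bexI[of _ "a # u"]) (auto intro: Cons_in_shuffles_rightI)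
    qed
  qed
qed

lemma lyndon_mult_support_val_le:
  assumes "lyndon x" "word x" "word v" "word w" "word \<gamma>" "val v \<le> val w"
    and prefix: "\<And>p q. w = p @ q \<Longrightarrow> p \<noteq> [] \<Longrightarrow> rate p \<le> rate x"
    and supp: "M_coeff (M x * M v) \<gamma> \<noteq> 0"
  shows "val \<gamma> \<le> val (x @ w)"
proof -
  have len: "length v \<le> length w"
    using val_less_if_shorter[of w v] assms by (metis not_le)
  have "composition \<gamma>" using assms(5) by (auto simp: word_def composition_def)
  note supp = M_mult_support[OF supp this]
  show ?thesis
  proof (cases "length \<gamma> < length (x @ w)")
    case True
    then show ?thesis
      by (intro less_imp_le val_less_if_shorter) (use assms in auto)
  next
    case False
    \<comment> \<open>A support word of full length cannot have merged letters, and leaves no room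
      for \<open>v\<close> to be shorter than \<open>w\<close>.\<close>
    then have "\<gamma> \<in> shuffles x v" "length v = length w"
      using supp len by (auto dest: length_shuffles)
    then obtain u where "u \<in> shuffles x w" "val \<gamma> \<le> val u"
      using shuffle_val_mono assms by meson
    then show ?thesis using lyndon_shuffle_le[OF assms(1,2) prefix] by (meson le_trans)
  qed
qed

text \<open>The head \<open>l\<close> has the largest rate, so every nonempty prefix of the
  remaining concatenation has at most its rate, which is what \<open>lyndon_shuffle_le\<close> asks
  for. The degree bound makes every composition that occurs a word in base \<open>B\<close>.\<close>

lemma lyndon_product_leading_term:
  assumes "\<forall>x\<in>set ls. lyndon x" "decreasing ls" "sum_list (concat ls) < B"
  defines "f \<equiv> prod_list (map M ls)"
  shows "\<And>\<gamma>. 0 \<le> M_coeff f \<gamma>"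
    and "0 < M_coeff f (concat ls)"
    and "\<And>\<gamma>. composition \<gamma> \<Longrightarrow> M_coeff f \<gamma> \<noteq> 0 \<Longrightarrow>
      sum_list \<gamma> = sum_list (concat ls) \<and> val \<gamma> \<le> val (concat ls)"
proof -
  have "(\<forall>\<gamma>. 0 \<le> M_coeff f \<gamma>) \<and> 0 < M_coeff f (concat ls) \<and>
      (\<forall>\<gamma>. composition \<gamma> \<longrightarrow> M_coeff f \<gamma> \<noteq> 0 \<longrightarrow>
        sum_list \<gamma> = sum_list (concat ls) \<and> val \<gamma> \<le> val (concat ls))"
    using assms(1-3) unfolding f_def
  proof (induction ls)
    case Nil
    then show ?case
      using M_coeff_M_nonneg[of "[]"] by (auto simp: M_coeff_M composition_def simp flip: M_Nil)
  next
    case (Cons l ls)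
    define g where "g = prod_list (map M ls)"
    let ?w = "concat ls"
    have IH: "\<And>\<gamma>. 0 \<le> M_coeff g \<gamma>" "0 < M_coeff g ?w"
      "\<And>\<gamma>. composition \<gamma> \<Longrightarrow> M_coeff g \<gamma> \<noteq> 0 \<Longrightarrow> sum_list \<gamma> = sum_list ?w \<and> val \<gamma> \<le> val ?w"
      using Cons by (auto simp: g_def)
    have l: "lyndon l" "composition l" using Cons.prems(1) by (auto simp: lyndon_def)
    have w: "composition ?w" using Cons.prems(1) by (auto simp: lyndon_def composition_def)
    have words: "word l" "word ?w"
      using l w Cons.prems(3) by (auto intro!: word_if_composition)
    have prefix: "rate p \<le> rate l" if "?w = p @ q" "p \<noteq> []" for p q
      by (rule decreasing_prefix_rate_le[OF _ _ _ _ that]) (use Cons.prems words in auto)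
    have f: "M_coeff (prod_list (map M (l # ls))) \<gamma> =
        (\<Sum>\<delta> | composition \<delta> \<and> M_coeff g \<delta> \<noteq> 0. M_coeff g \<delta> * M_coeff (M l * M \<delta>) \<gamma>)" for \<gamma>
      using M_coeff_mult_expand[of "M l" g] by (simp add: g_def)
    have "0 \<le> M_coeff (prod_list (map M (l # ls))) \<gamma>" for \<gamma>
      unfolding f by (intro sum_nonneg mult_nonneg_nonneg IH M_coeff_mult_nonneg)
    moreover have "0 < M_coeff (prod_list (map M (l # ls))) (concat (l # ls))"
    proof -
      \<comment> \<open>The term \<delta> = \<open>?w\<close> of the expansion; the others are
        nonnegative.\<close>
      have "0 < M_coeff g ?w * M_coeff (M l * M ?w) (l @ ?w)"
        by (intro mult_pos_pos IH M_coeff_mult_append_pos l w)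
      also have "\<dots> \<le> (\<Sum>\<delta> | composition \<delta> \<and> M_coeff g \<delta> \<noteq> 0. M_coeff g \<delta> * M_coeff (M l * M \<delta>) (l @ ?w))"
        by (rule member_le_sum)
          (use IH(2) w in \<open>auto intro!: mult_nonneg_nonneg IH(1) M_coeff_mult_nonneg finite_M_support\<close>)
      finally show ?thesis unfolding f by simp
    qed
    moreover have "sum_list \<gamma> = sum_list (concat (l # ls)) \<and> val \<gamma> \<le> val (concat (l # ls))"
      if \<gamma>: "composition \<gamma>" "M_coeff (prod_list (map M (l # ls))) \<gamma> \<noteq> 0" for \<gamma>
    proof -
      obtain \<delta> where \<delta>: "composition \<delta>" "M_coeff g \<delta> \<noteq> 0" "M_coeff (M l * M \<delta>) \<gamma> \<noteq> 0"
        using \<gamma>(2) unfolding f by (smt (verit, best) mem_Collect_eq mult_eq_0_iff sum.neutral)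
      have sum: "sum_list \<gamma> = sum_list (concat (l # ls))" "sum_list \<delta> = sum_list ?w"
        using M_mult_support[OF \<delta>(3) \<gamma>(1)] IH(3)[OF \<delta>(1,2)] by auto
      moreover have "val \<gamma> \<le> val (l @ ?w)"
        by (rule lyndon_mult_support_val_le[of l \<delta>])
          (use l words prefix \<delta> IH(3)[OF \<delta>(1,2)] sum \<gamma> Cons.prems(3) in \<open>auto intro!: word_if_composition\<close>)
      ultimately show ?thesis by simp
    qed
    ultimately show ?case by blast
  qed
  then show "\<And>\<gamma>. 0 \<le> M_coeff f \<gamma>" "0 < M_coeff f (concat ls)"
    "\<And>\<gamma>. composition \<gamma> \<Longrightarrow> M_coeff f \<gamma> \<noteq> 0 \<Longrightarrow>
      sum_list \<gamma> = sum_list (concat ls) \<and> val \<gamma> \<le> val (concat ls)" by blast+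
qed

end

section \<open>Evaluation of polynomials\<close>

definition monom_eval :: "('x \<Rightarrow> 'a::comm_monoid_mult) \<Rightarrow> ('x \<Rightarrow>\<^sub>0 nat) \<Rightarrow> 'a" where
  "monom_eval v m = (\<Prod>i\<in>Poly_Mapping.keys m. v i ^ Poly_Mapping.lookup m i)"

lemma monom_eval_superset:
  "finite K \<Longrightarrow> Poly_Mapping.keys m \<subseteq> K \<Longrightarrow> monom_eval v m = (\<Prod>i\<in>K. v i ^ Poly_Mapping.lookup m i)"
  unfolding monom_eval_def by (intro prod.mono_neutral_left) (auto simp: in_keys_iff)

lemma monom_eval_0 [simp]: "monom_eval v 0 = 1"
  by (simp add: monom_eval_def)

lemma monom_eval_single [simp]: "monom_eval v (Poly_Mapping.single i n) = v i ^ n"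
  by (cases "n = 0") (simp_all add: monom_eval_def)

lemma monom_eval_add: "monom_eval v (m + n) = monom_eval v m * monom_eval v n"
proof -
  let ?K = "Poly_Mapping.keys m \<union> Poly_Mapping.keys n"
  have "monom_eval v (m + n) = (\<Prod>i\<in>?K. v i ^ Poly_Mapping.lookup (m + n) i)"
    by (rule monom_eval_superset) (auto dest: subsetD[OF keys_add])
  also have "\<dots> = (\<Prod>i\<in>?K. v i ^ Poly_Mapping.lookup m i) * (\<Prod>i\<in>?K. v i ^ Poly_Mapping.lookup n i)"
    by (simp add: lookup_add power_add prod.distrib)
  also have "\<dots> = monom_eval v m * monom_eval v n"
    by (subst (1 2) monom_eval_superset[of ?K]) auto
  finally show ?thesis .
qed

lemma poly_eval_formal_sum: "poly_eval v = formal_sum (monom_eval v)"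
  by (simp add: fun_eq_iff poly_eval_def formal_sum_def monom_eval_def)

lemma linear_poly_eval: "linear (poly_eval v)"
  unfolding poly_eval_formal_sum by (rule linear_formal_sum)

lemma poly_eval_single: "poly_eval v (Poly_Mapping.single m c) = c *\<^sub>R monom_eval v m"
  by (simp add: poly_eval_formal_sum formal_sum_single)

lemma poly_mapping_sum_singles:
  fixes p :: "'x \<Rightarrow>\<^sub>0 'b::comm_monoid_add"
  shows "p = (\<Sum>k\<in>Poly_Mapping.keys p. Poly_Mapping.single k (Poly_Mapping.lookup p k))"
proof (rule poly_mapping_eqI)
  fix k
  show "Poly_Mapping.lookup p k =
      Poly_Mapping.lookup (\<Sum>k\<in>Poly_Mapping.keys p. Poly_Mapping.single k (Poly_Mapping.lookup p k)) k"
    by (simp add: lookup_sum lookup_single when_def in_keys_iff)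
qed

lemma poly_eval_mult: "poly_eval v (p * q) = poly_eval v p * poly_eval v q"
proof -
  let ?s = "\<lambda>p k. Poly_Mapping.single k (Poly_Mapping.lookup p k)"
  have "p * q = (\<Sum>k\<in>Poly_Mapping.keys p. \<Sum>l\<in>Poly_Mapping.keys q. ?s p k * ?s q l)"
    using arg_cong2[OF poly_mapping_sum_singles[of p] poly_mapping_sum_singles[of q], of "(*)"]
    by (simp only: sum_product)
  then have "poly_eval v (p * q) =
      (\<Sum>k\<in>Poly_Mapping.keys p. \<Sum>l\<in>Poly_Mapping.keys q. poly_eval v (?s p k) * poly_eval v (?s q l))"
    by (simp add: linear_sum[OF linear_poly_eval] mult_single poly_eval_single monom_eval_add mult.commute)
  also have "\<dots> = (\<Sum>k\<in>Poly_Mapping.keys p. poly_eval v (?s p k)) * (\<Sum>l\<in>Poly_Mapping.keys q. poly_eval v (?s q l))"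
    by (simp add: sum_product)
  also have "\<dots> = poly_eval v p * poly_eval v q"
    by (simp add: linear_sum[OF linear_poly_eval, symmetric] poly_mapping_sum_singles[symmetric])
  finally show ?thesis .
qed

lemma poly_eval_1 [simp]: "poly_eval v 1 = 1"
  by (simp add: poly_eval_single flip: single_one)

lemma poly_eval_prod_list: "poly_eval v (prod_list ps) = prod_list (map (poly_eval v) ps)"
  by (induction ps) (simp_all add: poly_eval_mult)

lemma poly_eval_hom:
  fixes h :: "'a::{comm_ring_1, real_algebra_1} \<Rightarrow> 'b::{comm_ring_1, real_algebra_1}"
  assumes "linear h" "h 1 = 1" "\<And>f g. h (f * g) = h f * h g"
  shows "h (poly_eval v p) = poly_eval (h \<circ> v) p"
proof -
  have pow: "h (f ^ n) = h f ^ n" for f n by (induction n) (simp_all add: assms)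
  have "h (prod F S) = (\<Prod>i\<in>S. h (F i))" for F :: "'c \<Rightarrow> 'a" and S
    by (induction S rule: infinite_finite_induct) (simp_all add: assms)
  then have "h (monom_eval v m) = monom_eval (h \<circ> v) m" for m
    by (simp add: monom_eval_def pow)
  then show ?thesis
    by (simp add: poly_eval_formal_sum formal_sum_def linear_sum[OF assms(1)] linear_scale[OF assms(1)])
qed

lemma poly_vars_add: "poly_vars (p + q) \<subseteq> poly_vars p \<union> poly_vars q"
  using keys_add[of p q] by (auto simp: poly_vars_def)

lemma poly_vars_scaleR: "poly_vars (c *\<^sub>R p) \<subseteq> poly_vars p"
  by (auto simp: poly_vars_def in_keys_iff lookup_scaleR)

lemma poly_vars_mult: "poly_vars (p * q) \<subseteq> poly_vars p \<union> poly_vars q"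
proof
  fix i assume "i \<in> poly_vars (p * q)"
  then obtain m where m: "m \<in> Poly_Mapping.keys (p * q)" "i \<in> Poly_Mapping.keys m"
    by (auto simp: poly_vars_def)
  then obtain a b where "a \<in> Poly_Mapping.keys p" "b \<in> Poly_Mapping.keys q" "m = a + b"
    using keys_mult[of p q] by auto
  then show "i \<in> poly_vars p \<union> poly_vars q"
    using m(2) keys_add[of a b] by (auto simp: poly_vars_def)
qed

lemma poly_vars_0 [simp]: "poly_vars 0 = {}" and poly_vars_1 [simp]: "poly_vars 1 = {}"
  by (simp_all add: poly_vars_def flip: single_one)

text \<open>A monomial in variables indexed by words is a multiset of words. A list adds an order of
  the factors, so that Lyndon factorizations can be matched with monomials.\<close>

definition list_monom :: "'x list \<Rightarrow> ('x \<Rightarrow>\<^sub>0 nat)" where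
  "list_monom ls = (\<Sum>x\<leftarrow>ls. Poly_Mapping.single x 1)"

lemma list_monom_append: "list_monom (ls @ ks) = list_monom ls + list_monom ks"
  by (simp add: list_monom_def)

lemma monom_eval_list_monom: "monom_eval v (list_monom ls) = prod_list (map v ls)"
  by (induction ls) (simp_all add: list_monom_def monom_eval_add)

lemma keys_list_monom: "Poly_Mapping.keys (list_monom ls) = set ls"
proof (induction ls)
  case (Cons x ls)
  have "Poly_Mapping.keys (list_monom (x # ls)) = insert x (Poly_Mapping.keys (list_monom ls))"
    by (auto simp: list_monom_def in_keys_iff lookup_add lookup_single when_def split: if_splits)
  then show ?case using Cons by simp
qed (simp add: list_monom_def)

lemma list_monom_mset: "mset ls = mset ks \<Longrightarrow> list_monom ls = list_monom ks"
  unfolding list_monom_def by (metis mset_map sum_mset_sum_list)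

lemma list_monom_replicate: "list_monom (replicate n x) = Poly_Mapping.single x n"
  by (induction n) (simp_all add: list_monom_def flip: single_add)

lemma list_monom_exists: "\<exists>ls. list_monom ls = m"
proof -
  have "\<exists>ls. list_monom ls = (\<Sum>k\<in>K. Poly_Mapping.single k (Poly_Mapping.lookup m k))"
    if "finite K" for K
    using that
  proof (induction K)
    case empty
    then show ?case by (intro exI[of _ "[]"]) (simp add: list_monom_def)
  next
    case (insert k K)
    then obtain ls where "list_monom ls = (\<Sum>k\<in>K. Poly_Mapping.single k (Poly_Mapping.lookup m k))"
      by blast
    then have "list_monom (replicate (Poly_Mapping.lookup m k) k @ ls) =
        (\<Sum>k\<in>insert k K. Poly_Mapping.single k (Poly_Mapping.lookup m k))"
      using insert by (simp add: list_monom_append list_monom_replicate)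
    then show ?case by blast
  qed
  then show ?thesis using poly_mapping_sum_singles[of m] by (metis finite_keys)
qed

section \<open>The Lyndon expansion\<close>

lemma sum_list_concat: "sum_list (concat xss) = sum_list (map sum_list xss)" for xss :: "nat list list"
  by (induction xss) simp_all

text \<open>Algebraic independence. By unique factorization distinct monomials have distinct leading
  words, so the largest leading word occurs in the product of only one monomial and its coefficient
  survives.\<close>

lemma lyndon_poly_eval_eq_0:
  assumes vars: "poly_vars p \<subseteq> Collect lyndon" and eval: "poly_eval M p = 0"
  shows "p = 0"
proof (rule ccontr)
  assume "p \<noteq> 0"
  then have ne: "Poly_Mapping.keys p \<noteq> {}" by simp
  obtain L where L: "\<And>m :: nat list \<Rightarrow>\<^sub>0 nat. list_monom (L m) = m"
    using list_monom_exists by metis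
  \<comment> \<open>Exceeds the degree of every product that occurs; the 2 keeps
    \<open>B > 1\<close> for constant \<open>p\<close>.\<close>
  define B where "B = 2 + (\<Sum>m\<in>Poly_Mapping.keys p. sum_list (concat (L m)))"
  interpret radix B by standard (simp add: B_def)
  define S where "S m = sort_key (\<lambda>x. - rate x) (L m)" for m
  define w where "w m = concat (S m)" for m
  have S: "list_monom (S m) = m" for m
    unfolding S_def using L list_monom_mset mset_sort by metis
  have lyn: "\<forall>x\<in>set (S m). lyndon x" if "m \<in> Poly_Mapping.keys p" for m
    using that vars keys_list_monom[of "S m"] unfolding S poly_vars_def by auto
  have dec: "decreasing (S m)" for m
  proof -
    have "sorted (map (\<lambda>x. - rate x) (S m))" by (simp add: S_def)
    then show ?thesis by (simp add: sorted_map)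
  qed
  have sum: "sum_list (w m) < B" if "m \<in> Poly_Mapping.keys p" for m
  proof -
    have "sum_list (w m) = sum_list (map sum_list (S m))" by (simp add: w_def sum_list_concat)
    also have "\<dots> = sum_list (map sum_list (L m))"
      by (simp add: S_def flip: sum_mset_sum_list)
    also have "\<dots> = sum_list (concat (L m))" by (simp add: sum_list_concat)
    also have "\<dots> \<le> (\<Sum>m\<in>Poly_Mapping.keys p. sum_list (concat (L m)))"
      using that by (intro member_le_sum) auto
    finally show ?thesis by (simp add: B_def)
  qed
  have wC: "composition (w m)" if "m \<in> Poly_Mapping.keys p" for m
    using lyn[OF that] by (auto simp: w_def lyndon_def composition_def)
  have wW: "word (w m)" if "m \<in> Poly_Mapping.keys p" for m
    using wC sum that by (simp add: word_if_composition)
  have w_inj: "m = m'" if "w m = w m'" "m \<in> Poly_Mapping.keys p" "m' \<in> Poly_Mapping.keys p" for m m'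
    using lyndon_factorization_unique[of "S m" "S m'"] lyn dec wW that S by (metis w_def)
  note lead = lyndon_product_leading_term[OF lyn dec sum[unfolded w_def], folded w_def]
  have "Max ((val \<circ> w) ` Poly_Mapping.keys p) \<in> (val \<circ> w) ` Poly_Mapping.keys p"
    using ne by (intro Max_in) auto
  then obtain m0 where m0: "m0 \<in> Poly_Mapping.keys p"
    "val (w m0) = Max ((val \<circ> w) ` Poly_Mapping.keys p)" by auto
  have max: "val (w m) \<le> val (w m0)" if "m \<in> Poly_Mapping.keys p" for m
    using that m0(2) by simp
  have "M_coeff (poly_eval M p) (w m0) = (\<Sum>m\<in>Poly_Mapping.keys p.
      Poly_Mapping.lookup p m * M_coeff (prod_list (map M (S m))) (w m0))"
    by (simp add: poly_eval_formal_sum formal_sum_def M_coeff_sum S monom_eval_list_monom[symmetric])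
  also have "\<dots> = (\<Sum>m\<in>{m0}. Poly_Mapping.lookup p m * M_coeff (prod_list (map M (S m))) (w m0))"
  proof (rule sum.mono_neutral_right)
    show "\<forall>m\<in>Poly_Mapping.keys p - {m0}.
        Poly_Mapping.lookup p m * M_coeff (prod_list (map M (S m))) (w m0) = 0"
    proof
      fix m assume m: "m \<in> Poly_Mapping.keys p - {m0}"
      have "M_coeff (prod_list (map M (S m))) (w m0) = 0"
      proof (rule ccontr)
        assume "M_coeff (prod_list (map M (S m))) (w m0) \<noteq> 0"
        then have "val (w m0) \<le> val (w m)" using lead(3)[of m "w m0"] m wC m0 by auto
        then have "val (w m0) = val (w m)" using max[of m] m by (intro order_antisym) auto
        then have "w m0 = w m" using val_inj wW m m0(1) by blast
        then show False using w_inj m m0 by auto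
      qed
      then show "Poly_Mapping.lookup p m * M_coeff (prod_list (map M (S m))) (w m0) = 0" by simp
    qed
  qed (use m0 in auto)
  finally have "Poly_Mapping.lookup p m0 * M_coeff (prod_list (map M (S m0))) (w m0) = 0"
    using eval by simp
  then show False using lead(2)[OF m0(1)] m0(1) by (simp add: in_keys_iff)
qed

definition lyndon_span :: "qsym set" where
  "lyndon_span = poly_eval M ` {p. poly_vars p \<subseteq> Collect lyndon}"

lemma subspace_lyndon_polys: "subspace {p. poly_vars p \<subseteq> Collect lyndon}"
  unfolding subspace_def using poly_vars_add poly_vars_scaleR by fastforce

lemma subspace_lyndon_span: "subspace lyndon_span"
  unfolding lyndon_span_def by (rule linear_subspace_image[OF linear_poly_eval subspace_lyndon_polys])

text \<open>Triangularity within one degree: the Lyndon product belonging to \<beta> is a positive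
  multiple of \<open>M \<beta>\<close> plus terms of smaller value, which are in the span by
  induction.\<close>

lemma M_in_lyndon_span:
  assumes "composition \<beta>"
  shows "M \<beta> \<in> lyndon_span"
proof -
  define n where "n = sum_list \<beta>"
  define B where "B = n + 2"
  interpret radix B by standard (simp add: B_def)
  have "M \<beta> \<in> lyndon_span" if "composition \<beta>" "sum_list \<beta> = n" for \<beta>
    using that
  proof (induction "val \<beta>" arbitrary: \<beta> rule: less_induct)
    case less
    have word: "word \<gamma>" if "composition \<gamma>" "sum_list \<gamma> = n" for \<gamma>
      by (rule word_if_composition) (simp_all add: that, simp add: B_def)
    obtain ls where ls: "concat ls = \<beta>" "\<forall>x\<in>set ls. lyndon x" "decreasing ls"
      using lyndon_factorization_exists word less.prems by metis
    define f where "f = prod_list (map M ls)"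
    have bd: "sum_list (concat ls) < B" using ls less.prems by (simp add: B_def)
    note lead = lyndon_product_leading_term[OF ls(2,3) bd, folded f_def, unfolded ls(1)]
    have f: "f \<in> lyndon_span"
    proof -
      have "f = poly_eval M (Poly_Mapping.single (list_monom ls) 1)"
        by (simp add: poly_eval_single monom_eval_list_monom f_def)
      moreover have "poly_vars (Poly_Mapping.single (list_monom ls) (1::real)) \<subseteq> Collect lyndon"
        using ls by (simp add: poly_vars_def keys_list_monom subset_eq)
      ultimately show ?thesis by (auto simp: lyndon_span_def)
    qed
    let ?S = "{\<gamma>. composition \<gamma> \<and> M_coeff f \<gamma> \<noteq> 0}"
    have \<beta>: "\<beta> \<in> ?S" using lead(2) less.prems by auto
    have "M \<gamma> \<in> lyndon_span" if "\<gamma> \<in> ?S - {\<beta>}" for \<gamma>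
    proof (rule less.hyps)
      show c: "composition \<gamma>" and s: "sum_list \<gamma> = n" using that lead(3)[of \<gamma>] less.prems by auto
      have "val \<gamma> \<noteq> val \<beta>" using that val_inj[of \<gamma> \<beta>] word c s less.prems by auto
      then show "val \<gamma> < val \<beta>" using that lead(3)[of \<gamma>] by auto
    qed
    then have "f - (\<Sum>\<gamma>\<in>?S - {\<beta>}. M_coeff f \<gamma> *\<^sub>R M \<gamma>) \<in> lyndon_span"
      using subspace_lyndon_span f
      by (intro subspace_diff subspace_sum subspace_scale) auto
    moreover have "f = M_coeff f \<beta> *\<^sub>R M \<beta> + (\<Sum>\<gamma>\<in>?S - {\<beta>}. M_coeff f \<gamma> *\<^sub>R M \<gamma>)"
      using M_expansion[of f] sum.remove[OF finite_M_support \<beta>, of "\<lambda>\<gamma>. M_coeff f \<gamma> *\<^sub>R M \<gamma>"] by simp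
    ultimately have "M_coeff f \<beta> *\<^sub>R M \<beta> \<in> lyndon_span"
      by (metis add_diff_cancel_right')
    then have "(1 / M_coeff f \<beta>) *\<^sub>R M_coeff f \<beta> *\<^sub>R M \<beta> \<in> lyndon_span"
      by (rule subspace_scale[OF subspace_lyndon_span])
    then show ?case using lead(2) by simp
  qed
  then show ?thesis using assms n_def by blast
qed

lemma lyndon_span_UNIV: "f \<in> lyndon_span"
  by (subst M_expansion)
    (intro subspace_sum subspace_scale subspace_lyndon_span, simp add: M_in_lyndon_span)

lemma lyndon_poly_eval_inj:
  assumes "poly_vars p \<subseteq> Collect lyndon" "poly_vars q \<subseteq> Collect lyndon" "poly_eval M p = poly_eval M q"
  shows "p = q"
proof -
  have "poly_vars (p - q) \<subseteq> poly_vars p \<union> poly_vars q"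
    using keys_diff[of p q] by (auto simp: poly_vars_def)
  then have "p - q = 0"
    using assms by (intro lyndon_poly_eval_eq_0) (auto simp: linear_diff[OF linear_poly_eval])
  then show ?thesis by simp
qed

lemma lyndon_expansion:
  assumes "composition \<beta>"
  shows "poly_vars (lyndon_expansion \<beta>) \<subseteq> Collect lyndon" "poly_eval M (lyndon_expansion \<beta>) = M \<beta>"
proof -
  obtain p where "poly_vars p \<subseteq> Collect lyndon" "poly_eval M p = M \<beta>"
    using M_in_lyndon_span[OF assms] by (auto simp: lyndon_span_def)
  then have "\<exists>!p. poly_vars p \<subseteq> Collect lyndon \<and> poly_eval M p = M \<beta>"
    using lyndon_poly_eval_inj by metis
  from theI'[OF this] show "poly_vars (lyndon_expansion \<beta>) \<subseteq> Collect lyndon"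
    "poly_eval M (lyndon_expansion \<beta>) = M \<beta>"
    by (simp_all add: lyndon_expansion_def)
qed

text \<open>Prescribed on the linear basis of all \<open>M \<beta>\<close> instead of on the free
  generators: linearity is then immediate, and multiplicativity is what has to be shown.\<close>

definition lyndon_char :: "(nat list \<Rightarrow> real) \<Rightarrow> qsym \<Rightarrow> real" where
  "lyndon_char u = M_extend (\<lambda>\<beta>. poly_eval u (lyndon_expansion \<beta>))"

lemma linear_lyndon_char: "linear (lyndon_char u)"
  unfolding lyndon_char_def by (rule linear_M_extend)

lemma lyndon_char_M: "composition \<beta> \<Longrightarrow> lyndon_char u (M \<beta>) = poly_eval u (lyndon_expansion \<beta>)"
  by (simp add: lyndon_char_def M_extend_M)

text \<open>Both \<open>p\<close> and the linear combination \<open>q\<close> of Lyndon expansions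
  represent \<open>f\<close>, so they coincide; evaluating \<open>q\<close> at \<open>u\<close> is
  the definition of the character.\<close>

lemma lyndon_char_poly_eval:
  assumes "poly_vars p \<subseteq> Collect lyndon"
  shows "lyndon_char u (poly_eval M p) = poly_eval u p"
proof -
  define f where "f = poly_eval M p"
  let ?S = "{\<alpha>. composition \<alpha> \<and> M_coeff f \<alpha> \<noteq> 0}"
  define q where "q = (\<Sum>\<alpha>\<in>?S. M_coeff f \<alpha> *\<^sub>R lyndon_expansion \<alpha>)"
  have "q \<in> {p. poly_vars p \<subseteq> Collect lyndon}"
    unfolding q_def by (intro subspace_sum subspace_scale subspace_lyndon_polys) (use lyndon_expansion(1) in auto)
  moreover have "poly_eval M q = f"
    using M_expansion[of f]
    by (simp add: q_def linear_sum[OF linear_poly_eval] linear_scale[OF linear_poly_eval] lyndon_expansion(2))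
  ultimately have "p = q" using assms by (intro lyndon_poly_eval_inj) (simp_all add: f_def)
  then show ?thesis
    unfolding f_def[symmetric]
    by (simp add: q_def linear_sum[OF linear_poly_eval] linear_scale[OF linear_poly_eval]
        lyndon_char_def M_extend_def)
qed

lemma lyndon_poly_obtain:
  obtains p where "poly_vars p \<subseteq> Collect lyndon" "f = poly_eval M p"
  using lyndon_span_UNIV[of f] unfolding lyndon_span_def by blast

lemma lyndon_char_mult: "lyndon_char u (f * g) = lyndon_char u f * lyndon_char u g"
proof -
  obtain p where p: "poly_vars p \<subseteq> Collect lyndon" "f = poly_eval M p" by (rule lyndon_poly_obtain)
  obtain q where q: "poly_vars q \<subseteq> Collect lyndon" "g = poly_eval M q" by (rule lyndon_poly_obtain)
  have "poly_vars (p * q) \<subseteq> Collect lyndon" using poly_vars_mult p q by fastforce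
  then show ?thesis
    using lyndon_char_poly_eval[of "p * q"] lyndon_char_poly_eval p q by (simp add: poly_eval_mult)
qed

lemma lyndon_char_1: "lyndon_char u 1 = 1"
  using lyndon_char_poly_eval[of 1 u] by simp

section \<open>Coefficients of the operators\<close>

lemma composition_simps [simp]: "composition []" "composition (a # \<alpha>) \<longleftrightarrow> 0 < a \<and> composition \<alpha>"
  "composition (\<alpha> @ \<beta>) \<longleftrightarrow> composition \<alpha> \<and> composition \<beta>"
  by (auto simp: composition_def)

lemma composition_take_drop [simp]:
  assumes "composition \<beta>"
  shows "composition (take i \<beta>)" "composition (drop i \<beta>)"
  using assms by (auto simp: composition_def dest: in_set_takeD in_set_dropD)

lemma sum_list_composition_eq_0: "composition \<beta> \<Longrightarrow> sum_list \<beta> = 0 \<longleftrightarrow> \<beta> = []"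
  by (cases \<beta>) auto

section \<open>Refinement of compositions and factorizations into blocks\<close>

lemma sum_list_take_inj:
  assumes "composition \<beta>" "i \<le> length \<beta>" "j \<le> length \<beta>" "sum_list (take i \<beta>) = sum_list (take j \<beta>)"
  shows "i = j"
  using assms
proof (induction \<beta> arbitrary: i j)
  case (Cons b \<beta>)
  have b: "0 < b" using Cons.prems(1) by simp
  show ?case
  proof (cases i)
    case 0
    then show ?thesis using Cons.prems(4) b by (cases j) simp_all
  next
    case i: (Suc k)
    show ?thesis
    proof (cases j)
      case 0
      then show ?thesis using Cons.prems(4) b i by simp
    next
      case (Suc l)
      then show ?thesis using Cons.IH[of k l] Cons.prems i by simp
    qed
  qed
qed simp

lemma coarser_if_blocks:
  assumes "composition (concat bs)" "[] \<notin> set bs"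
  shows "map sum_list bs \<preceq> concat bs"
proof -
  have "sum_list (take i (map sum_list bs)) \<in> partial_sums (concat bs)" if i: "1 \<le> i" "i < length bs" for i
  proof -
    let ?j = "length (concat (take i bs))"
    have split: "concat bs = concat (take i bs) @ concat (drop i bs)"
      by (metis append_take_drop_id concat_append)
    have "sum_list (take i (map sum_list bs)) = sum_list (take ?j (concat bs))"
      unfolding split by (simp add: take_map sum_list_concat)
    moreover have ne: "concat xs \<noteq> []" if "xs \<noteq> []" "set xs \<subseteq> set bs" for xs
      using that assms(2) by (cases xs) auto
    have "concat (take i bs) \<noteq> []" "concat (drop i bs) \<noteq> []"
      by (rule ne; use i in \<open>auto simp: set_take_subset set_drop_subset\<close>)+
    then have "1 \<le> ?j" "?j < length (concat bs)" using split by (auto simp: Suc_le_eq)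
    ultimately show ?thesis unfolding partial_sums_def by blast
  qed
  then show ?thesis
    by (auto simp: coarser_def sum_list_concat partial_sums_def[of "map sum_list bs"])
qed

text \<open>The first part of \<alpha> is a partial sum of \<beta> and so determines the first
  block. Subtracting it from the other partial sums relates the two tails in the same way.\<close>

lemma blocks_if_coarser:
  assumes "composition \<alpha>" "composition \<beta>" "\<alpha> \<preceq> \<beta>"
  shows "\<exists>bs. concat bs = \<beta> \<and> map sum_list bs = \<alpha>"
  using assms
proof (induction \<alpha> arbitrary: \<beta>)
  case Nil
  then show ?case
    using sum_list_composition_eq_0[of \<beta>] by (simp add: coarser_def del: sum_list_eq_0_iff)
next
  case (Cons a \<alpha>)
  show ?case
  proof (cases "\<alpha> = []")
    case True
    then show ?thesis using Cons.prems(3) by (intro exI[of _ "[\<beta>]"]) (simp add: coarser_def)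
  next
    case False
    have "sum_list (take 1 (a # \<alpha>)) \<in> partial_sums (a # \<alpha>)"
      unfolding partial_sums_def using False by (intro CollectI exI[of _ 1]) auto
    then have "a \<in> partial_sums \<beta>" using Cons.prems(3) by (auto simp: coarser_def)
    then obtain j where j: "a = sum_list (take j \<beta>)" "1 \<le> j" "j < length \<beta>"
      by (auto simp: partial_sums_def)
    have sum: "sum_list \<beta> = a + sum_list (drop j \<beta>)"
      using j(1) by (metis append_take_drop_id sum_list_append)
    have "partial_sums \<alpha> \<subseteq> partial_sums (drop j \<beta>)"
    proof
      fix s assume "s \<in> partial_sums \<alpha>"
      then obtain i where i: "s = sum_list (take i \<alpha>)" "1 \<le> i" "i < length \<alpha>"
        by (auto simp: partial_sums_def)
      then have "s \<noteq> 0"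
        using sum_list_composition_eq_0[of "take i \<alpha>"] Cons.prems(1) by auto
      have "a + s = sum_list (take (Suc i) (a # \<alpha>))" using i by simp
      then have "a + s \<in> partial_sums (a # \<alpha>)" unfolding partial_sums_def using i by force
      then have "a + s \<in> partial_sums \<beta>" using Cons.prems(3) by (auto simp: coarser_def)
      then obtain k where k: "a + s = sum_list (take k \<beta>)" "1 \<le> k" "k < length \<beta>"
        by (auto simp: partial_sums_def)
      \<comment> \<open>Partial sums never decrease with the index, and \<open>a + s\<close> exceeds
        \<open>a\<close>.\<close>
      have "j < k"
      proof (rule ccontr)
        assume "\<not> j < k"
        then have "take j \<beta> = take k \<beta> @ take (j - k) (drop k \<beta>)"
          by (metis le_add_diff_inverse not_less take_add)
        then have "a = a + s + sum_list (take (j - k) (drop k \<beta>))"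
          using j(1) k(1) by (metis sum_list_append)
        then show False using \<open>s \<noteq> 0\<close> by simp
      qed
      then have "take k \<beta> = take j \<beta> @ take (k - j) (drop j \<beta>)"
        by (metis le_add_diff_inverse less_imp_le take_add)
      then have "s = sum_list (take (k - j) (drop j \<beta>))"
        using j(1) k(1) by (metis add_left_cancel sum_list_append)
      then show "s \<in> partial_sums (drop j \<beta>)"
        unfolding partial_sums_def using \<open>j < k\<close> k by force
    qed
    then have "\<alpha> \<preceq> drop j \<beta>" using Cons.prems(3) sum by (simp add: coarser_def)
    then obtain bs where bs: "concat bs = drop j \<beta>" "map sum_list bs = \<alpha>"
      using Cons.IH[of "drop j \<beta>"] Cons.prems by auto
    then show ?thesis using j(1) by (intro exI[of _ "take j \<beta> # bs"]) simp
  qed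
qed

text \<open>With positive parts, the sum of a prefix determines its length, hence the first
  block.\<close>

lemma blocks_unique:
  assumes "composition (concat bs)" "concat bs = concat cs" "map sum_list bs = map sum_list cs"
  shows "bs = cs"
  using assms
proof (induction bs arbitrary: cs)
  case (Cons b bs)
  then obtain c cs' where cs: "cs = c # cs'" by (cases cs) auto
  have eq: "b @ concat bs = c @ concat cs'" using Cons.prems(2) cs by simp
  have "length b = length c"
  proof (rule sum_list_take_inj)
    show "composition (concat (b # bs))" by (rule Cons.prems(1))
    have "take (length b) (b @ concat bs) = b" by simp
    moreover have "take (length c) (b @ concat bs) = c" unfolding eq by simp
    ultimately show "sum_list (take (length b) (concat (b # bs))) = sum_list (take (length c) (concat (b # bs)))"
      using Cons.prems(3) cs by simp
    show "length c \<le> length (concat (b # bs))" using arg_cong[OF eq, of length] by simp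
  qed simp
  then have "b = c" "concat bs = concat cs'" using eq by auto
  then show ?case using Cons cs by auto
qed auto

lemma blocks_eqI:
  assumes "composition \<beta>" "concat bs = \<beta>" "map sum_list bs = \<alpha>"
  shows "blocks \<beta> \<alpha> = bs"
  unfolding blocks_def
proof (rule the_equality)
  fix cs assume "concat cs = \<beta> \<and> map sum_list cs = \<alpha>"
  then show "cs = bs" using blocks_unique[of cs bs] assms by auto
qed (use assms in simp)

lemma coarser_iff_blocks:
  assumes "composition \<alpha>" "composition \<beta>"
  shows "\<alpha> \<preceq> \<beta> \<longleftrightarrow> (\<exists>bs. concat bs = \<beta> \<and> map sum_list bs = \<alpha>)"
proof
  assume "\<exists>bs. concat bs = \<beta> \<and> map sum_list bs = \<alpha>"
  then obtain bs where bs: "concat bs = \<beta>" "map sum_list bs = \<alpha>" by blast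
  have "[] \<notin> set bs"
  proof
    assume "[] \<in> set bs"
    then have "0 \<in> set (map sum_list bs)" by force
    then show False using assms(1) bs by (simp add: composition_def)
  qed
  then show "\<alpha> \<preceq> \<beta>" using coarser_if_blocks bs assms(2) by blast
qed (rule blocks_if_coarser[OF assms])

lemma poly_eval_A_entry:
  assumes "composition \<beta>" "concat bs = \<beta>" "map sum_list bs = \<alpha>" "composition \<alpha>"
  shows "poly_eval u (A_entry \<beta> \<alpha>) = prod_list (map (\<lambda>b. lyndon_char u (M b)) bs)"
proof -
  have "\<alpha> \<preceq> \<beta>" using coarser_iff_blocks assms by blast
  then have "poly_eval u (A_entry \<beta> \<alpha>) = prod_list (map (\<lambda>b. poly_eval u (lyndon_expansion b)) bs)"
    using blocks_eqI[OF assms(1-3)] by (simp add: A_entry_def poly_eval_prod_list o_def)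
  also have "map (\<lambda>b. poly_eval u (lyndon_expansion b)) bs = map (\<lambda>b. lyndon_char u (M b)) bs"
  proof (rule map_cong[OF refl])
    fix b assume "b \<in> set bs"
    then have "composition b" using assms(1,2) by (auto simp: composition_def)
    then show "poly_eval u (lyndon_expansion b) = lyndon_char u (M b)" by (simp add: lyndon_char_M)
  qed
  finally show ?thesis .
qed

lemma poly_eval_A_entry_0: "\<not> \<alpha> \<preceq> \<beta> \<Longrightarrow> poly_eval u (A_entry \<beta> \<alpha>) = 0"
  by (simp add: A_entry_def poly_eval_def)

lemma A_entry_Nil:
  fixes u :: "nat list \<Rightarrow> real"
  assumes "composition \<beta>"
  shows "poly_eval u (A_entry \<beta> []) = (if \<beta> = [] then 1 else 0)"
proof (cases "\<beta> = []")
  case True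
  then show ?thesis using poly_eval_A_entry[of "[]" "[]" "[]" u] by simp
next
  case False
  then have "\<not> [] \<preceq> \<beta>"
    using sum_list_composition_eq_0[OF assms] by (simp add: coarser_def del: sum_list_eq_0_iff)
  then show ?thesis using False by (simp add: poly_eval_A_entry_0)
qed

text \<open>At most one cut of \<beta> has a first piece of sum \<open>a\<close>. The sum over all
  cuts is written to match deconcatenation: it applies the degree \<open>a\<close> part of the
  character to the left factor.\<close>

lemma A_entry_Cons:
  assumes \<beta>: "composition \<beta>" and \<alpha>: "composition (a # \<alpha>)"
  shows "poly_eval u (A_entry \<beta> (a # \<alpha>)) = (\<Sum>i\<le>length \<beta>.
    (if sum_list (take i \<beta>) = a then lyndon_char u (M (take i \<beta>)) else 0) *
      poly_eval u (A_entry (drop i \<beta>) \<alpha>))" (is "?l = (\<Sum>i\<le>length \<beta>. ?t i)")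
proof (cases "\<exists>i\<le>length \<beta>. sum_list (take i \<beta>) = a")
  case True
  then obtain i where i: "i \<le> length \<beta>" "sum_list (take i \<beta>) = a" by blast
  have "(\<Sum>j\<le>length \<beta>. ?t j) = (\<Sum>j\<in>{i}. ?t j)"
  proof (rule sum.mono_neutral_right)
    show "\<forall>j\<in>{..length \<beta>} - {i}. ?t j = 0"
      using sum_list_take_inj[OF \<beta>] i by auto
  qed (use i in auto)
  then have r: "(\<Sum>j\<le>length \<beta>. ?t j) =
      lyndon_char u (M (take i \<beta>)) * poly_eval u (A_entry (drop i \<beta>) \<alpha>)"
    using i by simp
  show ?thesis
  proof (cases "\<alpha> \<preceq> drop i \<beta>")
    case True
    then obtain bs where bs: "concat bs = drop i \<beta>" "map sum_list bs = \<alpha>"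
      using blocks_if_coarser[of \<alpha> "drop i \<beta>"] \<alpha> \<beta> by auto
    show ?thesis
      unfolding r using poly_eval_A_entry[of \<beta> "take i \<beta> # bs" "a # \<alpha>" u]
        poly_eval_A_entry[of "drop i \<beta>" bs \<alpha> u] bs i \<alpha> \<beta> by simp
  next
    case False
    \<comment> \<open>Otherwise the first block would have to end at \<open>i\<close>, and the other
      blocks would show \<open>\<alpha> \<preceq> drop i \<beta>\<close>.\<close>
    have "\<not> a # \<alpha> \<preceq> \<beta>"
    proof
      assume "a # \<alpha> \<preceq> \<beta>"
      then obtain cs where cs: "concat cs = \<beta>" "map sum_list cs = a # \<alpha>"
        using blocks_if_coarser[OF \<alpha> \<beta>] by metis
      then obtain b bs where "cs = b # bs" by (cases cs) auto
      then have bs: "\<beta> = b @ concat bs" "sum_list b = a" "map sum_list bs = \<alpha>"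
        using cs by simp_all
      then have "sum_list (take (length b) \<beta>) = a" "length b \<le> length \<beta>" by simp_all
      then have "length b = i" using sum_list_take_inj[OF \<beta> _ i(1)] i(2) by simp
      then have "concat bs = drop i \<beta>" using bs(1) by simp
      then have "\<alpha> \<preceq> drop i \<beta>" using coarser_iff_blocks[of \<alpha> "drop i \<beta>"] bs(3) \<alpha> \<beta> by auto
      then show False using False by blast
    qed
    then show ?thesis unfolding r using False by (simp add: poly_eval_A_entry_0)
  qed
next
  case False
  have "\<not> a # \<alpha> \<preceq> \<beta>"
  proof
    assume "a # \<alpha> \<preceq> \<beta>"
    then obtain cs where cs: "concat cs = \<beta>" "map sum_list cs = a # \<alpha>"
      using blocks_if_coarser[OF \<alpha> \<beta>] by metis
    then obtain b bs where "cs = b # bs" by (cases cs) auto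
    then have "\<beta> = b @ concat bs" "sum_list b = a" using cs by simp_all
    then have "sum_list (take (length b) \<beta>) = a" "length b \<le> length \<beta>" by simp_all
    then show False using False by blast
  qed
  moreover have "(\<Sum>i\<le>length \<beta>. ?t i) = 0" using False by (intro sum.neutral) auto
  ultimately show ?thesis by (simp add: poly_eval_A_entry_0)
qed

lemma M_coeff_Phi_M:
  assumes "composition \<alpha>" "composition \<beta>"
  shows "M_coeff (Phi u (M \<beta>)) \<alpha> = poly_eval u (A_entry \<beta> \<alpha>)"
proof -
  let ?S = "{\<alpha> \<in> Comp (sum_list \<beta>). \<alpha> \<preceq> \<beta>}"
  have fin: "finite ?S" by (rule finite_subset[OF _ finite_Comp]) auto
  have "M_coeff (Phi u (M \<beta>)) \<alpha> = (\<Sum>\<gamma>\<in>?S. poly_eval u (A_entry \<beta> \<gamma>) * M_coeff (M \<gamma>) \<alpha>)"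
    using assms by (subst Phi_M[of \<beta> "sum_list \<beta>"]) (simp_all add: Comp_def M_coeff_sum)
  also have "\<dots> = (\<Sum>\<gamma>\<in>?S. if \<gamma> = \<alpha> then poly_eval u (A_entry \<beta> \<gamma>) else 0)"
    using assms by (intro sum.cong) (auto simp: M_coeff_M)
  also have "\<dots> = poly_eval u (A_entry \<beta> \<alpha>)"
  proof (cases "\<alpha> \<preceq> \<beta>")
    case True
    then have "\<alpha> \<in> ?S" using assms by (simp add: Comp_def coarser_def)
    then show ?thesis using fin by simp
  qed (simp add: poly_eval_A_entry_0 fin)
  finally show ?thesis .
qed

lemma M_coeff_Phi_M_degree:
  assumes "composition \<alpha>" "composition \<beta>" "M_coeff (Phi u (M \<beta>)) \<alpha> \<noteq> 0"
  shows "sum_list \<alpha> = sum_list \<beta>"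
  using assms poly_eval_A_entry_0 by (metis M_coeff_Phi_M coarser_def)

lemma M_coeff_Phi_M_Nil:
  "composition \<beta> \<Longrightarrow> M_coeff (Phi u (M \<beta>)) [] = (if \<beta> = [] then 1 else 0)"
  by (simp add: M_coeff_Phi_M A_entry_Nil)

lemma M_coeff_Phi_M_Cons:
  assumes "composition \<beta>" "composition (a # \<alpha>)"
  shows "M_coeff (Phi u (M \<beta>)) (a # \<alpha>) = (\<Sum>i\<le>length \<beta>.
    (if sum_list (take i \<beta>) = a then lyndon_char u (M (take i \<beta>)) else 0) *
      M_coeff (Phi u (M (drop i \<beta>))) \<alpha>)"
  using assms by (simp add: M_coeff_Phi_M A_entry_Cons del: composition_simps)
    (simp add: M_coeff_Phi_M)

section \<open>Multiplicativity of the operators\<close>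

text \<open>The exponent vectors of the divisors of a monomial; together with
  \<open>map2 (-) es bs\<close> they run through its factorizations. Zeros occur since a divisor may
  omit variables.\<close>

fun subs :: "nat list \<Rightarrow> nat list set" where
  "subs [] = {[]}"
| "subs (a # es) = (\<lambda>(b, bs). b # bs) ` ({..a} \<times> subs es)"

lemma finite_subs [simp]: "finite (subs es)"
  by (induction es) auto

lemma sum_subs_Cons: "(\<Sum>bs\<in>subs (a # es). F bs) = (\<Sum>b\<le>a. \<Sum>bs\<in>subs es. F (b # bs))"
  by (simp add: sum.reindex inj_on_def sum.cartesian_product case_prod_unfold)

lemma M_coeff_mult:
  "M_coeff (f * g) es = (\<Sum>bs\<in>subs es. M_coeff f bs * M_coeff g (map2 (-) es bs))"
proof (induction es arbitrary: f g)
  case Nil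
  then show ?case by (simp add: M_coeff_Nil_mult)
next
  case (Cons a es)
  show ?case unfolding sum_subs_Cons
    by (simp add: M_coeff_Cons strip_mult M_coeff_sum Cons)
qed

text \<open>Quasisymmetry again: absent variables may be skipped. This links exponent lists with
  zeros to compositions.\<close>

lemma M_coeff_filter: "M_coeff f (filter (\<lambda>a. 0 < a) es) = M_coeff f es"
  by (induction es arbitrary: f) (simp_all add: M_coeff_Cons)

definition graded_part :: "(qsym \<Rightarrow> real) \<Rightarrow> nat \<Rightarrow> qsym \<Rightarrow> real" where
  "graded_part z a = M_extend (\<lambda>\<beta>. if sum_list \<beta> = a then z (M \<beta>) else 0)"

lemma linear_graded_part: "linear (graded_part z a)"
  unfolding graded_part_def by (rule linear_M_extend)

lemma graded_part_M:
  "composition \<beta> \<Longrightarrow> graded_part z a (M \<beta>) = (if sum_list \<beta> = a then z (M \<beta>) else 0)"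
  by (simp add: graded_part_def M_extend_M)

lemma graded_part_homogeneous:
  assumes "linear z" "\<And>\<gamma>. composition \<gamma> \<Longrightarrow> M_coeff f \<gamma> \<noteq> 0 \<Longrightarrow> sum_list \<gamma> = n"
  shows "graded_part z a f = (if n = a then z f else 0)"
proof -
  have "z = M_extend (\<lambda>\<beta>. z (M \<beta>))" by (rule M_extend_unique[OF assms(1)]) simp
  then have "z f = (\<Sum>\<alpha> | composition \<alpha> \<and> M_coeff f \<alpha> \<noteq> 0. M_coeff f \<alpha> *\<^sub>R z (M \<alpha>))"
    unfolding M_extend_def by metis
  then show ?thesis
    unfolding graded_part_def M_extend_def using assms(2) by (auto intro!: sum.neutral sum.cong)
qed

lemma bilinear_sum_fun:
  assumes "\<And>i. i \<in> I \<Longrightarrow> bilinear (F i)"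
  shows "bilinear (\<lambda>x y. \<Sum>i\<in>I. F i x y)"
  using assms unfolding bilinear_def by (intro conjI allI linear_compose_sum ballI) auto

text \<open>On basis elements the product is homogeneous, and only the summand with \<open>b\<close>
  the degree of the first factor survives.\<close>

lemma graded_part_mult:
  assumes "linear z" "\<And>f g. z (f * g) = z f * z g"
  shows "graded_part z a (f * g) = (\<Sum>b\<le>a. graded_part z b f * graded_part z (a - b) g)"
proof (rule bilinear_eq_on_M[of "\<lambda>f g. graded_part z a (f * g)"
      "\<lambda>f g. \<Sum>b\<le>a. graded_part z b f * graded_part z (a - b) g"])
  fix \<alpha> \<beta> assume c: "composition \<alpha>" "composition \<beta>"
  have "graded_part z a (M \<alpha> * M \<beta>) =
      (if sum_list \<alpha> + sum_list \<beta> = a then z (M \<alpha> * M \<beta>) else 0)"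
    by (rule graded_part_homogeneous[OF assms(1)]) (use M_mult_support in blast)
  also have "\<dots> = (\<Sum>b\<le>a. if b = sum_list \<alpha> then
      (if sum_list \<alpha> + sum_list \<beta> = a then z (M \<alpha>) * z (M \<beta>) else 0) else 0)"
    by (simp add: assms(2))
  also have "\<dots> = (\<Sum>b\<le>a. graded_part z b (M \<alpha>) * graded_part z (a - b) (M \<beta>))"
    by (rule sum.cong) (use c in \<open>auto simp: graded_part_M\<close>)
  finally show "graded_part z a (M \<alpha> * M \<beta>) =
      (\<Sum>b\<le>a. graded_part z b (M \<alpha>) * graded_part z (a - b) (M \<beta>))" .
qed (intro bilinear_linear_mult bilinear_sum_fun bilinear_mult_linear linear_graded_part)+

text \<open>The map \<open>(id \<otimes> \<psi>) \<circ> \<Delta>\<close>.\<close>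

definition apply_right :: "(qsym \<Rightarrow> real) \<Rightarrow> qsym \<Rightarrow> qsym" where
  "apply_right \<psi> = M_extend (\<lambda>\<beta>. \<Sum>i\<le>length \<beta>. \<psi> (M (drop i \<beta>)) *\<^sub>R M (take i \<beta>))"

lemma linear_apply_right: "linear (apply_right \<psi>)"
  unfolding apply_right_def by (rule linear_M_extend)

lemma apply_right_M:
  "composition \<beta> \<Longrightarrow> apply_right \<psi> (M \<beta>) = (\<Sum>i\<le>length \<beta>. \<psi> (M (drop i \<beta>)) *\<^sub>R M (take i \<beta>))"
  by (simp add: apply_right_def M_extend_M)

text \<open>Coassociativity: \<open>strip\<close> acts on the left end of a composition and \<psi>
  on the right end.\<close>

lemma strip_apply_right: "strip c (apply_right \<psi> f) = apply_right \<psi> (strip c f)"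
proof (cases "c = 0")
  case False
  show ?thesis
  proof (rule linear_eq_on_M[of "\<lambda>f. strip c (apply_right \<psi> f)" "\<lambda>f. apply_right \<psi> (strip c f)"])
    fix \<beta> assume \<beta>: "composition \<beta>"
    show "strip c (apply_right \<psi> (M \<beta>)) = apply_right \<psi> (strip c (M \<beta>))"
    proof (cases \<beta>)
      case Nil
      then show ?thesis
        using False apply_right_M[of "[]" \<psi>]
        by (simp add: linear_0[OF linear_apply_right] linear_scale[OF linear_strip])
    next
      case (Cons b \<gamma>)
      \<comment> \<open>The cut at 0 leaves \<open>M [] = 1\<close> on the left, which is stripped
        to 0; the other cuts are those of \<gamma>, shifted by one.\<close>
      have "strip c (apply_right \<psi> (M \<beta>)) =
          (\<Sum>i\<le>length \<gamma>. \<psi> (M (drop i \<gamma>)) *\<^sub>R strip c (M (b # take i \<gamma>)))"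
        using \<beta> Cons False unfolding apply_right_M[OF \<beta>] linear_sum[OF linear_strip]
        by (simp add: sum.atMost_Suc_shift linear_scale[OF linear_strip] del: sum.atMost_Suc)
      also have "\<dots> = apply_right \<psi> (strip c (M \<beta>))"
        using \<beta> Cons False by (simp add: strip_M apply_right_M linear_0[OF linear_apply_right])
      finally show ?thesis .
    qed
  qed (use linear_compose[OF linear_apply_right linear_strip] linear_compose[OF linear_strip linear_apply_right]
      in \<open>simp_all add: o_def\<close>)
qed simp

text \<open>The counit axiom: only the cut with empty left factor has a constant term.\<close>

lemma M_coeff_apply_right_Nil:
  assumes "linear \<psi>"
  shows "M_coeff (apply_right \<psi> f) [] = \<psi> f"
proof (rule linear_eq_on_M[of "\<lambda>f. M_coeff (apply_right \<psi> f) []" \<psi>])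
  fix \<beta> assume \<beta>: "composition \<beta>"
  have "M_coeff (apply_right \<psi> (M \<beta>)) [] = (\<Sum>i\<le>length \<beta>. if i = 0 then \<psi> (M \<beta>) else 0)"
    unfolding apply_right_M[OF \<beta>] M_coeff_sum
    by (rule sum.cong) (auto simp: M_coeff_M simp del: M_Nil)
  then show "M_coeff (apply_right \<psi> (M \<beta>)) [] = \<psi> (M \<beta>)" by simp
qed (use assms linear_compose[OF linear_apply_right linear_M_coeff] in \<open>simp_all add: o_def\<close>)

text \<open>Multiplicativity of the coproduct, without a product on tensors. Stripping variables
  from both sides yields the same Cauchy sums, until only constant terms are left, where the
  hypothesis on \<psi> applies.\<close>

lemma apply_right_mult:
  assumes "linear \<psi>" "\<And>i. linear (\<psi>\<^sub>1 i)" "\<And>i. linear (\<psi>\<^sub>2 i)"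
    and mult: "\<And>f g. \<psi> (f * g) = (\<Sum>i\<in>I. \<psi>\<^sub>1 i f * \<psi>\<^sub>2 i g)"
  shows "apply_right \<psi> (f * g) = (\<Sum>i\<in>I. apply_right (\<psi>\<^sub>1 i) f * apply_right (\<psi>\<^sub>2 i) g)"
proof (rule qsym_eqI_M_coeff)
  fix \<alpha>
  show "M_coeff (apply_right \<psi> (f * g)) \<alpha> =
      M_coeff (\<Sum>i\<in>I. apply_right (\<psi>\<^sub>1 i) f * apply_right (\<psi>\<^sub>2 i) g) \<alpha>"
  proof (induction \<alpha> arbitrary: f g)
    case Nil
    show ?case
      by (simp add: M_coeff_sum M_coeff_Nil_mult M_coeff_apply_right_Nil assms(1-3) mult)
  next
    case (Cons c \<alpha>)
    have "M_coeff (apply_right \<psi> (f * g)) (c # \<alpha>) =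
        (\<Sum>b\<le>c. M_coeff (apply_right \<psi> (strip b f * strip (c - b) g)) \<alpha>)"
      by (simp add: M_coeff_Cons strip_apply_right strip_mult linear_sum[OF linear_apply_right] M_coeff_sum)
    also have "\<dots> = (\<Sum>b\<le>c. \<Sum>i\<in>I. M_coeff (apply_right (\<psi>\<^sub>1 i) (strip b f) *
        apply_right (\<psi>\<^sub>2 i) (strip (c - b) g)) \<alpha>)"
      by (simp add: Cons M_coeff_sum)
    also have "\<dots> = M_coeff (\<Sum>i\<in>I. apply_right (\<psi>\<^sub>1 i) f * apply_right (\<psi>\<^sub>2 i) g) (c # \<alpha>)"
      by (subst sum.swap) (simp add: M_coeff_Cons M_coeff_sum strip_mult linear_sum[OF linear_strip] strip_apply_right)
    finally show ?case .
  qed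
qed

text \<open>The functional \<open>(z\<^bsub>a\<^sub>1\<^esub> \<otimes> \<cdots> \<otimes> z\<^bsub>a\<^sub>k\<^esub>) \<circ> \<Delta>\<^bsup>k\<^esup>\<close>, where \<open>\<Delta>\<^bsup>k\<^esup>\<close> is the iterated coproduct and \<open>z\<^sub>a\<close>
  the part of degree \<open>a\<close> of \<open>z\<close>.\<close>

fun iterated :: "(qsym \<Rightarrow> real) \<Rightarrow> nat list \<Rightarrow> qsym \<Rightarrow> real" where
  "iterated z [] f = M_coeff f []"
| "iterated z (a # es) f = graded_part z a (apply_right (iterated z es) f)"

lemma linear_iterated: "linear (iterated z es)"
proof (cases es)
  case Nil
  then have "iterated z es = (\<lambda>f. M_coeff f [])" by (simp add: fun_eq_iff)
  then show ?thesis using linear_M_coeff by simp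
next
  case (Cons a ds)
  then have "iterated z es = graded_part z a \<circ> apply_right (iterated z ds)" by (simp add: fun_eq_iff)
  then show ?thesis using linear_compose[OF linear_apply_right linear_graded_part] by simp
qed

text \<open>The product formula \<open>M_coeff_mult\<close> with \<open>iterated z\<close> in place
  of coefficients. Since \<open>iterated\<close> gives the coefficients of \<open>Phi u f\<close>,
  comparing the two formulas makes \<open>Phi u\<close> multiplicative.\<close>

lemma iterated_mult:
  assumes "linear z" "\<And>f g. z (f * g) = z f * z g"
  shows "iterated z es (f * g) = (\<Sum>bs\<in>subs es. iterated z bs f * iterated z (map2 (-) es bs) g)"
proof (induction es arbitrary: f g)
  case Nil
  then show ?case by (simp add: M_coeff_Nil_mult)
next
  case (Cons a es)
  have "iterated z (a # es) (f * g) = (\<Sum>bs\<in>subs es. graded_part z a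
      (apply_right (iterated z bs) f * apply_right (iterated z (map2 (-) es bs)) g))"
    using apply_right_mult[OF linear_iterated linear_iterated linear_iterated Cons]
    by (simp add: linear_sum[OF linear_graded_part])
  also have "\<dots> = (\<Sum>bs\<in>subs es. \<Sum>b\<le>a. iterated z (b # bs) f * iterated z ((a - b) # map2 (-) es bs) g)"
    by (simp add: graded_part_mult[OF assms])
  also have "\<dots> = (\<Sum>bs\<in>subs (a # es). iterated z bs f * iterated z (map2 (-) (a # es) bs) g)"
    unfolding sum_subs_Cons by (subst sum.swap) simp
  finally show ?case .
qed

lemma graded_part_0:
  assumes "z 1 = 1"
  shows "graded_part z 0 f = M_coeff f []"
proof (rule linear_eq_on_M[OF linear_graded_part linear_M_coeff])
  fix \<beta> assume "composition \<beta>"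
  then show "graded_part z 0 (M \<beta>) = M_coeff (M \<beta>) []"
    using assms by (auto simp: graded_part_M M_coeff_M sum_list_composition_eq_0 simp del: sum_list_eq_0_iff)
qed

text \<open>An entry 0 applies the degree 0 part of \<open>z\<close>, which is the counit, and the
  counit axiom removes it.\<close>

lemma iterated_filter:
  assumes "z 1 = 1"
  shows "iterated z (filter (\<lambda>a. 0 < a) es) = iterated z es"
proof (induction es)
  case (Cons a es)
  have "iterated z (0 # es) = iterated z es"
    by (simp add: fun_eq_iff graded_part_0[of z, OF assms] M_coeff_apply_right_Nil[OF linear_iterated])
  moreover have "iterated z (a # filter (\<lambda>a. 0 < a) es) = iterated z (a # es)"
    unfolding fun_eq_iff iterated.simps Cons by simp
  ultimately show ?case using Cons by (cases "a = 0") simp_all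
qed simp

lemma M_coeff_Phi: "M_coeff (Phi u f) es = iterated (lyndon_char u) es f"
proof -
  have comp: "M_coeff (Phi u (M \<beta>)) \<alpha> = iterated (lyndon_char u) \<alpha> (M \<beta>)"
    if "composition \<alpha>" "composition \<beta>" for \<alpha> \<beta>
    using that
  proof (induction \<alpha> arbitrary: \<beta>)
    case Nil
    then show ?case by (simp add: M_coeff_Phi_M_Nil M_coeff_M)
  next
    case (Cons a \<alpha>)
    have "M_coeff (Phi u (M \<beta>)) (a # \<alpha>) = (\<Sum>i\<le>length \<beta>.
        graded_part (lyndon_char u) a (M (take i \<beta>)) * iterated (lyndon_char u) \<alpha> (M (drop i \<beta>)))"
      unfolding M_coeff_Phi_M_Cons[OF Cons.prems(2,1)] using Cons by (simp add: graded_part_M)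
    also have "\<dots> = iterated (lyndon_char u) (a # \<alpha>) (M \<beta>)"
      using Cons.prems by (simp add: apply_right_M linear_sum[OF linear_graded_part]
          linear_scale[OF linear_graded_part] mult.commute)
    finally show ?case .
  qed
  \<comment> \<open>The recursion for \<open>Phi\<close> is about compositions; dropping zeros
    leaves both sides unchanged for any other list.\<close>
  let ?es = "filter (\<lambda>a. 0 < a) es"
  have "M_coeff (Phi u f) ?es = iterated (lyndon_char u) ?es f"
  proof (rule linear_eq_on_M[of "\<lambda>f. M_coeff (Phi u f) ?es"])
    show "linear (\<lambda>f. M_coeff (Phi u f) ?es)"
      using linear_compose[OF linear_Phi linear_M_coeff] by (simp add: o_def)
  qed (rule linear_iterated, rule comp, auto simp: composition_def)
  then show ?thesis
    using iterated_filter[where z = "lyndon_char u"] by (simp add: M_coeff_filter lyndon_char_1)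
qed

lemma Phi_mult: "Phi u (f * g) = Phi u f * Phi u g"
  by (rule qsym_eqI_M_coeff)
    (simp add: M_coeff_Phi M_coeff_mult iterated_mult[OF linear_lyndon_char lyndon_char_mult])

section \<open>Compatibility with the coproduct\<close>

text \<open>Compatibility with the coproduct, expressed in coefficients: the blocks belonging to
  \<open>\<alpha>\<^sub>1\<close> end at some cut \<open>j\<close> of \<beta>.\<close>

lemma M_coeff_Phi_M_append:
  assumes "composition \<beta>" "composition (\<alpha>\<^sub>1 @ \<alpha>\<^sub>2)"
  shows "M_coeff (Phi u (M \<beta>)) (\<alpha>\<^sub>1 @ \<alpha>\<^sub>2) =
    (\<Sum>j\<le>length \<beta>. M_coeff (Phi u (M (take j \<beta>))) \<alpha>\<^sub>1 * M_coeff (Phi u (M (drop j \<beta>))) \<alpha>\<^sub>2)"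
  using assms
proof (induction \<alpha>\<^sub>1 arbitrary: \<beta>)
  case Nil
  have "(\<Sum>j\<le>length \<beta>. M_coeff (Phi u (M (take j \<beta>))) [] * M_coeff (Phi u (M (drop j \<beta>))) \<alpha>\<^sub>2) =
      (\<Sum>j\<le>length \<beta>. if j = 0 then M_coeff (Phi u (M \<beta>)) \<alpha>\<^sub>2 else 0)"
    by (rule sum.cong) (use Nil in \<open>auto simp: M_coeff_Phi_M_Nil\<close>)
  then show ?case by simp
next
  case (Cons a \<alpha>\<^sub>1)
  let ?n = "length \<beta>"
  let ?g = "\<lambda>i. if sum_list (take i \<beta>) = a then lyndon_char u (M (take i \<beta>)) else 0"
  let ?c = "\<lambda>i j. M_coeff (Phi u (M (take j (drop i \<beta>)))) \<alpha>\<^sub>1"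
  let ?d = "\<lambda>j. M_coeff (Phi u (M (drop j \<beta>))) \<alpha>\<^sub>2"
  have "M_coeff (Phi u (M \<beta>)) ((a # \<alpha>\<^sub>1) @ \<alpha>\<^sub>2) =
      (\<Sum>i\<le>?n. ?g i * (\<Sum>k\<le>?n - i. ?c i k * ?d (k + i)))"
    using Cons by (simp add: M_coeff_Phi_M_Cons)
  also have "\<dots> = (\<Sum>(i, k)\<in>(SIGMA i:{..?n}. {..?n - i}). ?g i * ?c i k * ?d (k + i))"
    by (simp add: sum_distrib_left sum.Sigma mult.assoc)
  \<comment> \<open>Here \<open>i\<close> is the end of the first block, and
    \<open>j = k + i\<close> counts the letters up to the cut from the start of \<beta> instead of
    from \<open>i\<close>.\<close>
  also have "\<dots> = (\<Sum>(j, i)\<in>(SIGMA j:{..?n}. {..j}). ?g i * ?c i (j - i) * ?d j)"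
    by (rule sum.reindex_bij_witness[of _ "\<lambda>(j, i). (i, j - i)" "\<lambda>(i, k). (k + i, i)"]) auto
  also have "\<dots> = (\<Sum>j\<le>?n. (\<Sum>i\<le>j. ?g i * ?c i (j - i)) * ?d j)"
    by (simp add: sum_distrib_right sum.Sigma)
  also have "\<dots> = (\<Sum>j\<le>?n. M_coeff (Phi u (M (take j \<beta>))) (a # \<alpha>\<^sub>1) * ?d j)"
  proof (rule sum.cong[OF refl])
    fix j assume j: "j \<in> {..?n}"
    have "(\<Sum>i\<le>j. ?g i * ?c i (j - i)) = M_coeff (Phi u (M (take j \<beta>))) (a # \<alpha>\<^sub>1)"
      using j Cons.prems by (subst M_coeff_Phi_M_Cons) (auto simp: drop_take min_def intro!: sum.cong)
    then show "(\<Sum>i\<le>j. ?g i * ?c i (j - i)) * ?d j =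
        M_coeff (Phi u (M (take j \<beta>))) (a # \<alpha>\<^sub>1) * ?d j" by simp
  qed
  finally show ?case .
qed

lemma linear_comult: "linear comult"
  unfolding comult_def by (rule linear_M_extend)

lemma comult_M:
  "composition \<alpha> \<Longrightarrow> comult (M \<alpha>) = (\<Sum>i\<le>length \<alpha>. M (take i \<alpha>) \<otimes>\<^sub>R M (drop i \<alpha>))"
  by (simp add: comult_def M_extend_M)

text \<open>The index set depends only on a degree bound, so one set serves \<beta> and all its
  prefixes and suffixes.\<close>

lemma Phi_M_expansion:
  assumes "composition \<beta>" "sum_list \<beta> \<le> n"
  shows "Phi u (M \<beta>) = (\<Sum>\<alpha> | composition \<alpha> \<and> sum_list \<alpha> \<le> n. M_coeff (Phi u (M \<beta>)) \<alpha> *\<^sub>R M \<alpha>)"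
proof -
  have "{\<alpha>. composition \<alpha> \<and> M_coeff (Phi u (M \<beta>)) \<alpha> \<noteq> 0} \<subseteq> {\<alpha>. composition \<alpha> \<and> sum_list \<alpha> \<le> n}"
    using M_coeff_Phi_M_degree assms by auto
  then have "(\<Sum>\<alpha> | composition \<alpha> \<and> M_coeff (Phi u (M \<beta>)) \<alpha> \<noteq> 0. M_coeff (Phi u (M \<beta>)) \<alpha> *\<^sub>R M \<alpha>) =
      (\<Sum>\<alpha> | composition \<alpha> \<and> sum_list \<alpha> \<le> n. M_coeff (Phi u (M \<beta>)) \<alpha> *\<^sub>R M \<alpha>)"
    by (intro sum.mono_neutral_left finite_compositions_le) auto
  then show ?thesis using M_expansion[of "Phi u (M \<beta>)"] by (rule trans[rotated])
qed

lemma comult_Phi_M: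
  assumes \<beta>: "composition \<beta>"
  shows "comult (Phi u (M \<beta>)) = (\<Sum>j\<le>length \<beta>. Phi u (M (take j \<beta>)) \<otimes>\<^sub>R Phi u (M (drop j \<beta>)))"
proof -
  define n where "n = sum_list \<beta>"
  define C where "C = {\<alpha>. composition \<alpha> \<and> sum_list \<alpha> \<le> n}"
  have fin: "finite C" unfolding C_def by (rule finite_compositions_le)
  let ?c = "\<lambda>\<beta> \<alpha>. M_coeff (Phi u (M \<beta>)) \<alpha>"
  let ?S = "SIGMA \<alpha>:C. {..length \<alpha>}"
  let ?P = "{(\<alpha>\<^sub>1, \<alpha>\<^sub>2) \<in> C \<times> C. \<alpha>\<^sub>1 @ \<alpha>\<^sub>2 \<in> C}"
  have expand: "Phi u (M \<gamma>) = (\<Sum>\<alpha>\<in>C. ?c \<gamma> \<alpha> *\<^sub>R M \<alpha>)" if "composition \<gamma>" "sum_list \<gamma> \<le> n" for \<gamma>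
    unfolding C_def by (rule Phi_M_expansion[OF that])
  have "comult (Phi u (M \<beta>)) = comult (\<Sum>\<alpha>\<in>C. ?c \<beta> \<alpha> *\<^sub>R M \<alpha>)"
    by (rule arg_cong[OF expand[OF \<beta>]]) (simp add: n_def)
  also have "\<dots> = (\<Sum>\<alpha>\<in>C. \<Sum>i\<le>length \<alpha>. ?c \<beta> \<alpha> *\<^sub>R (M (take i \<alpha>) \<otimes>\<^sub>R M (drop i \<alpha>)))"
    unfolding linear_sum[OF linear_comult] linear_scale[OF linear_comult]
    by (rule sum.cong) (simp_all add: C_def comult_M scaleR_sum_right)
  also have "\<dots> = (\<Sum>(\<alpha>, i)\<in>?S. ?c \<beta> \<alpha> *\<^sub>R (M (take i \<alpha>) \<otimes>\<^sub>R M (drop i \<alpha>)))"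
    using fin by (simp add: sum.Sigma)
  \<comment> \<open>A composition with a cut is the same as a pair of compositions.\<close>
  also have "\<dots> = (\<Sum>(\<alpha>\<^sub>1, \<alpha>\<^sub>2)\<in>?P. ?c \<beta> (\<alpha>\<^sub>1 @ \<alpha>\<^sub>2) *\<^sub>R (M \<alpha>\<^sub>1 \<otimes>\<^sub>R M \<alpha>\<^sub>2))"
  proof (rule sum.reindex_bij_witness[of _ "\<lambda>(\<alpha>\<^sub>1, \<alpha>\<^sub>2). (\<alpha>\<^sub>1 @ \<alpha>\<^sub>2, length \<alpha>\<^sub>1)"
        "\<lambda>(\<alpha>, i). (take i \<alpha>, drop i \<alpha>)"])
    fix x assume "x \<in> ?S"
    then obtain \<alpha> i where x: "x = (\<alpha>, i)" "\<alpha> \<in> C" "i \<le> length \<alpha>" by auto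
    have "sum_list (take i \<alpha>) + sum_list (drop i \<alpha>) = sum_list \<alpha>"
      by (metis append_take_drop_id sum_list_append)
    then show "(case x of (\<alpha>, i) \<Rightarrow> (take i \<alpha>, drop i \<alpha>)) \<in> ?P"
      using x by (simp add: C_def)
  qed (auto simp: C_def)
  \<comment> \<open>The added pairs have total degree above \<open>n\<close>, where
    \<open>Phi u (M \<beta>)\<close> has no terms. The full product set lets the double sum split
    into tensor factors.\<close>
  also have "\<dots> = (\<Sum>(\<alpha>\<^sub>1, \<alpha>\<^sub>2)\<in>C \<times> C. ?c \<beta> (\<alpha>\<^sub>1 @ \<alpha>\<^sub>2) *\<^sub>R (M \<alpha>\<^sub>1 \<otimes>\<^sub>R M \<alpha>\<^sub>2))"
  proof (rule sum.mono_neutral_left)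
    show "\<forall>x\<in>C \<times> C - ?P. (case x of (\<alpha>\<^sub>1, \<alpha>\<^sub>2) \<Rightarrow> ?c \<beta> (\<alpha>\<^sub>1 @ \<alpha>\<^sub>2) *\<^sub>R (M \<alpha>\<^sub>1 \<otimes>\<^sub>R M \<alpha>\<^sub>2)) = 0"
    proof
      fix x assume "x \<in> C \<times> C - ?P"
      then obtain \<alpha>\<^sub>1 \<alpha>\<^sub>2 where x: "x = (\<alpha>\<^sub>1, \<alpha>\<^sub>2)" "\<alpha>\<^sub>1 \<in> C" "\<alpha>\<^sub>2 \<in> C" "\<alpha>\<^sub>1 @ \<alpha>\<^sub>2 \<notin> C" by auto
      then have "?c \<beta> (\<alpha>\<^sub>1 @ \<alpha>\<^sub>2) = 0"
        using M_coeff_Phi_M_degree[of "\<alpha>\<^sub>1 @ \<alpha>\<^sub>2" \<beta> u] \<beta> by (auto simp: C_def n_def)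
      then show "(case x of (\<alpha>\<^sub>1, \<alpha>\<^sub>2) \<Rightarrow> ?c \<beta> (\<alpha>\<^sub>1 @ \<alpha>\<^sub>2) *\<^sub>R (M \<alpha>\<^sub>1 \<otimes>\<^sub>R M \<alpha>\<^sub>2)) = 0"
        using x(1) by simp
    qed
  qed (use fin in auto)
  also have "\<dots> = (\<Sum>(\<alpha>\<^sub>1, \<alpha>\<^sub>2)\<in>C \<times> C. \<Sum>j\<le>length \<beta>.
      (?c (take j \<beta>) \<alpha>\<^sub>1 *\<^sub>R M \<alpha>\<^sub>1) \<otimes>\<^sub>R (?c (drop j \<beta>) \<alpha>\<^sub>2 *\<^sub>R M \<alpha>\<^sub>2))"
    by (rule sum.cong) (auto simp: C_def M_coeff_Phi_M_append[OF \<beta>] scaleR_sum_left mult.commute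
        bilinear_lmul[OF bilinear_pure_tensor] bilinear_rmul[OF bilinear_pure_tensor])
  also have "\<dots> = (\<Sum>j\<le>length \<beta>. \<Sum>(\<alpha>\<^sub>1, \<alpha>\<^sub>2)\<in>C \<times> C.
      (?c (take j \<beta>) \<alpha>\<^sub>1 *\<^sub>R M \<alpha>\<^sub>1) \<otimes>\<^sub>R (?c (drop j \<beta>) \<alpha>\<^sub>2 *\<^sub>R M \<alpha>\<^sub>2))"
    unfolding case_prod_unfold by (rule sum.swap)
  also have "\<dots> = (\<Sum>j\<le>length \<beta>. Phi u (M (take j \<beta>)) \<otimes>\<^sub>R Phi u (M (drop j \<beta>)))"
  proof (rule sum.cong[OF refl])
    fix j
    have "sum_list (take j \<beta>) + sum_list (drop j \<beta>) = n"
      unfolding n_def by (metis append_take_drop_id sum_list_append)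
    then have "Phi u (M (take j \<beta>)) = (\<Sum>\<alpha>\<in>C. ?c (take j \<beta>) \<alpha> *\<^sub>R M \<alpha>)"
      "Phi u (M (drop j \<beta>)) = (\<Sum>\<alpha>\<in>C. ?c (drop j \<beta>) \<alpha> *\<^sub>R M \<alpha>)"
      using \<beta> by (auto intro!: expand)
    then have "Phi u (M (take j \<beta>)) \<otimes>\<^sub>R Phi u (M (drop j \<beta>)) =
        (\<Sum>\<alpha>\<in>C. ?c (take j \<beta>) \<alpha> *\<^sub>R M \<alpha>) \<otimes>\<^sub>R (\<Sum>\<alpha>\<in>C. ?c (drop j \<beta>) \<alpha> *\<^sub>R M \<alpha>)"
      by (rule arg_cong2)
    also have "\<dots> = (\<Sum>(\<alpha>\<^sub>1, \<alpha>\<^sub>2)\<in>C \<times> C. (?c (take j \<beta>) \<alpha>\<^sub>1 *\<^sub>R M \<alpha>\<^sub>1) \<otimes>\<^sub>R (?c (drop j \<beta>) \<alpha>\<^sub>2 *\<^sub>R M \<alpha>\<^sub>2))"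
      by (rule bilinear_sum[OF bilinear_pure_tensor])
    finally show "(\<Sum>(\<alpha>\<^sub>1, \<alpha>\<^sub>2)\<in>C \<times> C. (?c (take j \<beta>) \<alpha>\<^sub>1 *\<^sub>R M \<alpha>\<^sub>1) \<otimes>\<^sub>R (?c (drop j \<beta>) \<alpha>\<^sub>2 *\<^sub>R M \<alpha>\<^sub>2)) =
        Phi u (M (take j \<beta>)) \<otimes>\<^sub>R Phi u (M (drop j \<beta>))" by (rule sym)
  qed
  finally show ?thesis .
qed

lemma tensor_map_comult_M:
  assumes "linear \<Phi>" "composition \<beta>"
  shows "tensor_map \<Phi> \<Phi> (comult (M \<beta>)) = (\<Sum>j\<le>length \<beta>. \<Phi> (M (take j \<beta>)) \<otimes>\<^sub>R \<Phi> (M (drop j \<beta>)))"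
  using assms by (simp add: comult_M linear_sum[OF tensor_map_pure(2)] tensor_map_pure(1))

lemma comult_Phi: "comult (Phi u f) = tensor_map (Phi u) (Phi u) (comult f)"
proof (rule linear_eq_on_M[of "\<lambda>f. comult (Phi u f)" "\<lambda>f. tensor_map (Phi u) (Phi u) (comult f)"])
  show "linear (\<lambda>f. comult (Phi u f))" "linear (\<lambda>f. tensor_map (Phi u) (Phi u) (comult f))"
    using linear_compose[OF linear_Phi linear_comult]
      linear_compose[OF linear_comult tensor_map_pure(2)[OF linear_Phi linear_Phi]]
    by (simp_all add: o_def)
qed (simp add: comult_Phi_M tensor_map_comult_M linear_Phi)

section \<open>Degree, unit and counit\<close>

lemma homogeneous_iff_M_coeff:
  "homogeneous n f \<longleftrightarrow> (\<forall>\<alpha>. composition \<alpha> \<longrightarrow> M_coeff f \<alpha> \<noteq> 0 \<longrightarrow> sum_list \<alpha> = n)"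
  unfolding homogeneous_def mdeg_def
  by (metis M_coeff_exps M_coeff_def composition_exps exps_nth)

lemma homogeneous_M: "composition \<alpha> \<Longrightarrow> homogeneous (sum_list \<alpha>) (M \<alpha>)"
  by (simp add: homogeneous_iff_M_coeff M_coeff_M)

lemma homogeneous_M_coeff_eq_0:
  assumes "homogeneous n f" "sum_list es \<noteq> n"
  shows "M_coeff f es = 0"
proof -
  let ?es = "filter (\<lambda>a. 0 < a) es"
  have "sum_list ?es = sum_list es" by (induction es) simp_all
  moreover have "composition ?es" by (simp add: composition_def)
  moreover have "M_coeff f \<alpha> \<noteq> 0 \<Longrightarrow> sum_list \<alpha> = n" if "composition \<alpha>" for \<alpha>
    using assms(1) that unfolding homogeneous_iff_M_coeff by blast
  ultimately have "M_coeff f ?es = 0" using assms(2) by force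
  then show ?thesis by (simp only: M_coeff_filter)
qed

lemma homogeneous_Phi:
  assumes "homogeneous n f"
  shows "homogeneous n (Phi u f)"
  unfolding homogeneous_iff_M_coeff
proof (intro allI impI)
  fix \<alpha> assume \<alpha>: "composition \<alpha>" "M_coeff (Phi u f) \<alpha> \<noteq> 0"
  have "M_coeff (Phi u f) \<alpha> =
      (\<Sum>\<beta> | composition \<beta> \<and> M_coeff f \<beta> \<noteq> 0. M_coeff f \<beta> * M_coeff (Phi u (M \<beta>)) \<alpha>)"
    using arg_cong[OF M_expansion[of f], of "\<lambda>g. M_coeff (Phi u g) \<alpha>"]
    by (simp only: linear_sum[OF linear_Phi] linear_scale[OF linear_Phi] M_coeff_sum M_coeff_linear)
  then have "\<exists>\<beta>\<in>{\<beta>. composition \<beta> \<and> M_coeff f \<beta> \<noteq> 0}. M_coeff f \<beta> * M_coeff (Phi u (M \<beta>)) \<alpha> \<noteq> 0"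
    using \<alpha>(2) by (metis (no_types, lifting) sum.neutral)
  then obtain \<beta> where \<beta>: "composition \<beta>" "M_coeff f \<beta> \<noteq> 0" "M_coeff (Phi u (M \<beta>)) \<alpha> \<noteq> 0" by auto
  then show "sum_list \<alpha> = n"
    using M_coeff_Phi_M_degree[OF \<alpha>(1) \<beta>(1,3)] assms unfolding homogeneous_iff_M_coeff by simp
qed

lemma counit_eq_M_coeff: "counit f = M_coeff f []"
  by (simp add: counit_def M_coeff_Nil)

lemma Phi_in_QSym_End: "Phi u \<in> QSym_End"
  unfolding QSym_End_def
proof (intro CollectI conjI allI impI)
  show "Phi u 1 = 1"
  proof (rule qsym_eqI_M_coeff)
    fix \<alpha> assume \<alpha>: "composition \<alpha>"
    have "M_coeff (Phi u (M [])) \<alpha> = M_coeff (M []) \<alpha>"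
    proof (cases "\<alpha> = []")
      case True
      then show ?thesis using M_coeff_Phi_M_Nil[of "[]" u] M_coeff_M[of "[]" "[]"] by simp
    next
      case False
      have "M_coeff (Phi u (M [])) \<alpha> = 0"
      proof (rule ccontr)
        assume "M_coeff (Phi u (M [])) \<alpha> \<noteq> 0"
        from M_coeff_Phi_M_degree[OF \<alpha> composition_simps(1) this] have "sum_list \<alpha> = 0"
          by (simp del: sum_list_eq_0_iff)
        then show False using False sum_list_composition_eq_0[OF \<alpha>] by blast
      qed
      then show ?thesis using False \<alpha> by (simp add: M_coeff_M del: M_Nil)
    qed
    then show "M_coeff (Phi u 1) \<alpha> = M_coeff 1 \<alpha>" by simp
  qed
  show "counit (Phi u f) = counit f" for f
    by (simp add: counit_eq_M_coeff M_coeff_Phi)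
qed (simp_all add: linear_Phi homogeneous_Phi Phi_mult comult_Phi)

section \<open>Every endomorphism arises\<close>

text \<open>Expresses a coefficient as a functional of the coproduct, so that the coproduct axiom of
  an endomorphism can be applied to it.\<close>

lemma M_coeff_Cons_tensor:
  assumes "composition (a # \<alpha>)"
  shows "M_coeff f (a # \<alpha>) = tensor_lift (\<lambda>x y. M_coeff x [a] * M_coeff y \<alpha>) (comult f)"
proof -
  let ?h = "\<lambda>x y. M_coeff x [a] * M_coeff y \<alpha>"
  have h: "bilinear ?h" by (rule bilinear_mult_linear[OF linear_M_coeff linear_M_coeff])
  show ?thesis
  proof (rule linear_eq_on_M[of "\<lambda>f. M_coeff f (a # \<alpha>)" "\<lambda>f. tensor_lift ?h (comult f)"])
    show "linear (\<lambda>f. tensor_lift ?h (comult f))"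
      using linear_compose[OF linear_comult linear_tensor_lift[OF h]] by (simp add: o_def)
    fix \<beta> assume \<beta>: "composition \<beta>"
    have "tensor_lift ?h (comult (M \<beta>)) =
        (\<Sum>i\<le>length \<beta>. M_coeff (M (take i \<beta>)) [a] * M_coeff (M (drop i \<beta>)) \<alpha>)"
      by (simp add: comult_M[OF \<beta>] linear_sum[OF linear_tensor_lift[OF h]] tensor_lift_pure[OF h])
    \<comment> \<open>The left factor must be the one-letter word \<open>[a]\<close>, which leaves
      only the cut after the first letter.\<close>
    also have "\<dots> = (\<Sum>i\<le>length \<beta>. if i = 1 then (if \<beta> = a # \<alpha> then 1 else 0) else 0)"
    proof (rule sum.cong[OF refl])
      fix i assume "i \<in> {..length \<beta>}"
      then have eq: "[a] = take i \<beta> \<and> \<alpha> = drop i \<beta> \<longleftrightarrow> i = 1 \<and> \<beta> = a # \<alpha>"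
        by (cases \<beta>; cases i) auto
      have "M_coeff (M (take i \<beta>)) [a] = (if [a] = take i \<beta> then 1 else 0)"
        "M_coeff (M (drop i \<beta>)) \<alpha> = (if \<alpha> = drop i \<beta> then 1 else 0)"
        using assms by (simp_all add: M_coeff_M)
      then have "M_coeff (M (take i \<beta>)) [a] * M_coeff (M (drop i \<beta>)) \<alpha> =
          (if [a] = take i \<beta> \<and> \<alpha> = drop i \<beta> then 1 else 0)" by simp
      then show "M_coeff (M (take i \<beta>)) [a] * M_coeff (M (drop i \<beta>)) \<alpha> =
          (if i = 1 then (if \<beta> = a # \<alpha> then 1 else 0) else 0)"
        unfolding eq by simp
    qed
    also have "\<dots> = M_coeff (M \<beta>) (a # \<alpha>)"
      using assms by (auto simp: M_coeff_M)
    finally show "M_coeff (M \<beta>) (a # \<alpha>) = tensor_lift ?h (comult (M \<beta>))" by simp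
  qed (rule linear_M_coeff)
qed

text \<open>The recursion of \<open>M_coeff_Phi_M_Cons\<close> for an arbitrary endomorphism, with
  its own one-letter coefficients in place of the character.\<close>

lemma QSym_End_M_coeff_Cons:
  assumes "\<Phi> \<in> QSym_End" "composition \<beta>" "composition (a # \<alpha>)"
  shows "M_coeff (\<Phi> (M \<beta>)) (a # \<alpha>) =
    (\<Sum>i\<le>length \<beta>. M_coeff (\<Phi> (M (take i \<beta>))) [a] * M_coeff (\<Phi> (M (drop i \<beta>))) \<alpha>)"
proof -
  have lin: "linear \<Phi>" and co: "comult (\<Phi> (M \<beta>)) = tensor_map \<Phi> \<Phi> (comult (M \<beta>))"
    using assms(1) by (auto simp: QSym_End_def)
  have h: "bilinear (\<lambda>x y. M_coeff x [a] * M_coeff y \<alpha>)"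
    by (rule bilinear_mult_linear[OF linear_M_coeff linear_M_coeff])
  show ?thesis
    unfolding M_coeff_Cons_tensor[OF assms(3)] co tensor_map_comult_M[OF lin assms(2)]
    by (simp add: linear_sum[OF linear_tensor_lift[OF h]] tensor_lift_pure[OF h])
qed

text \<open>The composite of \<open>\<Phi>\<close> with the evaluation at \<open>x\<^sub>0 = 1\<close>, \<open>x\<^sub>1 = x\<^sub>2 = \<cdots> = 0\<close>.\<close>

definition end_char :: "(qsym \<Rightarrow> qsym) \<Rightarrow> qsym \<Rightarrow> real" where
  "end_char \<Phi> = M_extend (\<lambda>\<beta>. M_coeff (\<Phi> (M \<beta>)) [sum_list \<beta>])"

lemma linear_end_char: "linear (end_char \<Phi>)"
  unfolding end_char_def by (rule linear_M_extend)

lemma end_char_M: "composition \<beta> \<Longrightarrow> end_char \<Phi> (M \<beta>) = M_coeff (\<Phi> (M \<beta>)) [sum_list \<beta>]"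
  by (simp add: end_char_def M_extend_M)

lemma end_char_homogeneous:
  assumes "linear \<Phi>" "homogeneous n f"
  shows "end_char \<Phi> f = M_coeff (\<Phi> f) [n]"
proof -
  have "M_coeff (\<Phi> f) [n] = (\<Sum>\<beta> | composition \<beta> \<and> M_coeff f \<beta> \<noteq> 0. M_coeff f \<beta> * M_coeff (\<Phi> (M \<beta>)) [n])"
    using arg_cong[OF M_expansion[of f], of "\<lambda>g. M_coeff (\<Phi> g) [n]"]
    by (simp only: linear_sum[OF assms(1)] linear_scale[OF assms(1)] M_coeff_sum M_coeff_linear)
  also have "\<dots> = end_char \<Phi> f"
    unfolding end_char_def M_extend_def
    using assms(2) by (intro sum.cong) (auto simp: homogeneous_iff_M_coeff)
  finally show ?thesis by simp
qed

text \<open>\<Phi> preserves degrees, so in the product of two homogeneous images the top power of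
  the first variable arises in one way only.\<close>

lemma end_char_mult:
  assumes "\<Phi> \<in> QSym_End"
  shows "end_char \<Phi> (f * g) = end_char \<Phi> f * end_char \<Phi> g"
proof -
  have lin: "linear \<Phi>" and mult: "\<And>f g. \<Phi> (f * g) = \<Phi> f * \<Phi> g"
    and hom: "\<And>n f. homogeneous n f \<Longrightarrow> homogeneous n (\<Phi> f)"
    using assms by (auto simp: QSym_End_def)
  show ?thesis
  proof (rule bilinear_eq_on_M[of "\<lambda>f g. end_char \<Phi> (f * g)" "\<lambda>f g. end_char \<Phi> f * end_char \<Phi> g"])
    fix \<alpha> \<beta> assume c: "composition \<alpha>" "composition \<beta>"
    have "homogeneous (sum_list \<alpha> + sum_list \<beta>) (M \<alpha> * M \<beta>)"
      unfolding homogeneous_iff_M_coeff using M_mult_support by blast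
    then have "end_char \<Phi> (M \<alpha> * M \<beta>) = M_coeff (\<Phi> (M \<alpha>) * \<Phi> (M \<beta>)) [sum_list \<alpha> + sum_list \<beta>]"
      using end_char_homogeneous[OF lin] mult by metis
    also have "\<dots> = (\<Sum>b\<le>sum_list \<alpha> + sum_list \<beta>.
        M_coeff (\<Phi> (M \<alpha>)) [b] * M_coeff (\<Phi> (M \<beta>)) [sum_list \<alpha> + sum_list \<beta> - b])"
      by (simp add: M_coeff_mult sum_subs_Cons del: subs.simps(2))
    also have "\<dots> = (\<Sum>b\<le>sum_list \<alpha> + sum_list \<beta>. if b = sum_list \<alpha> then
        M_coeff (\<Phi> (M \<alpha>)) [sum_list \<alpha>] * M_coeff (\<Phi> (M \<beta>)) [sum_list \<beta>] else 0)"
    proof (rule sum.cong[OF refl])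
      fix b
      have "M_coeff (\<Phi> (M \<alpha>)) [b] = 0" if "b \<noteq> sum_list \<alpha>"
        using homogeneous_M_coeff_eq_0[OF hom[OF homogeneous_M[OF c(1)]], of "[b]"] that by simp
      then show "M_coeff (\<Phi> (M \<alpha>)) [b] * M_coeff (\<Phi> (M \<beta>)) [sum_list \<alpha> + sum_list \<beta> - b] =
          (if b = sum_list \<alpha> then M_coeff (\<Phi> (M \<alpha>)) [sum_list \<alpha>] * M_coeff (\<Phi> (M \<beta>)) [sum_list \<beta>] else 0)"
        by simp
    qed
    also have "\<dots> = end_char \<Phi> (M \<alpha>) * end_char \<Phi> (M \<beta>)"
      using c by (simp add: end_char_M)
    finally show "end_char \<Phi> (M \<alpha> * M \<beta>) = end_char \<Phi> (M \<alpha>) * end_char \<Phi> (M \<beta>)" .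
  qed (intro bilinear_linear_mult bilinear_mult_linear linear_end_char)+
qed

lemma end_char_1:
  assumes "\<Phi> \<in> QSym_End"
  shows "end_char \<Phi> 1 = 1"
proof -
  have "end_char \<Phi> (M []) = M_coeff (\<Phi> 1) [0]" 
    using end_char_M[of "[]" \<Phi>] by simp
  \<comment> \<open>\<open>[0]\<close> is the degree of \<open>M []\<close> but not a composition;
    dropping the zero gives the constant term.\<close>
  also have "\<dots> = M_coeff 1 (filter (\<lambda>a. 0 < a) [0])"
    using assms unfolding M_coeff_filter by (simp add: QSym_End_def)
  also have "\<dots> = 1" using M_coeff_M[of "[]" "[]"] by simp
  finally show ?thesis by simp
qed

lemma QSym_End_eq_Phi:
  assumes \<Phi>: "\<Phi> \<in> QSym_End"
  shows "\<Phi> = Phi (\<lambda>\<alpha>. end_char \<Phi> (M \<alpha>))"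
proof -
  define u where "u = (\<lambda>\<alpha>. end_char \<Phi> (M \<alpha>))"
  have lin: "linear \<Phi>" and hom: "\<And>n f. homogeneous n f \<Longrightarrow> homogeneous n (\<Phi> f)"
    and co: "\<And>f. counit (\<Phi> f) = counit f"
    using \<Phi> by (auto simp: QSym_End_def)
  \<comment> \<open>As an algebra homomorphism, \<open>end_char \<Phi>\<close> is determined by its
    values on the Lyndon generators, which are the values of \<open>u\<close>.\<close>
  have char: "lyndon_char u (M \<beta>) = end_char \<Phi> (M \<beta>)" if "composition \<beta>" for \<beta>
  proof -
    have "end_char \<Phi> (poly_eval M (lyndon_expansion \<beta>)) = poly_eval u (lyndon_expansion \<beta>)"
      using poly_eval_hom[OF linear_end_char end_char_1[OF \<Phi>] end_char_mult[OF \<Phi>]]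
      by (simp add: u_def o_def)
    then show ?thesis using that by (simp add: lyndon_char_M lyndon_expansion)
  qed
  have coeff: "M_coeff (\<Phi> (M \<beta>)) \<alpha> = M_coeff (Phi u (M \<beta>)) \<alpha>"
    if "composition \<alpha>" "composition \<beta>" for \<alpha> \<beta>
    using that
  proof (induction \<alpha> arbitrary: \<beta>)
    case Nil
    then show ?case
      using co[of "M \<beta>"] by (simp add: counit_eq_M_coeff M_coeff_Phi_M_Nil M_coeff_M)
  next
    case (Cons a \<alpha>)
    \<comment> \<open>This turns the recursion for \<Phi> into the one for
      \<open>Phi u\<close>.\<close>
    have "M_coeff (\<Phi> (M \<gamma>)) [a] = (if sum_list \<gamma> = a then lyndon_char u (M \<gamma>) else 0)"
      if \<gamma>: "composition \<gamma>" for \<gamma>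
    proof -
      have "M_coeff (\<Phi> (M \<gamma>)) [a] = 0" if "sum_list \<gamma> \<noteq> a"
        using homogeneous_M_coeff_eq_0[OF hom[OF homogeneous_M[OF \<gamma>]], of "[a]"] that by simp
      then show ?thesis using \<gamma> by (auto simp: char end_char_M)
    qed
    then show ?case
      using Cons.IH Cons.prems
      by (simp add: QSym_End_M_coeff_Cons[OF \<Phi> Cons.prems(2,1)] M_coeff_Phi_M_Cons[OF Cons.prems(2,1)])
  qed
  show ?thesis unfolding u_def[symmetric]
  proof
    fix f show "\<Phi> f = Phi u f"
      by (rule linear_eq_on_M[OF lin linear_Phi]) (rule qsym_eqI_M_coeff, rule coeff)
  qed
qed

theorem theorem5p1:
  shows "(\<forall>u. Phi u \<in> QSym_End) \<and> (\<forall>\<Phi>\<in>QSym_End. \<exists>u. \<Phi> = Phi u)"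
  using Phi_in_QSym_End QSym_End_eq_Phi by blast

end
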